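(* Let $n, d, d_1,\dots,d_n$ be positive integers and let $L_j:\mathbb{R}^d\to\mathbb{R}^{d_j}$ ($1\le j\le n$) be surjective linear maps whose Hölder-Brascamp-Lieb polytope $\mathcal{P}$ is nonempty. Let $B:[0,\infty)^n\to[0,\infty)$ be nondecreasing in each coordinate and satisfy $B(y_1,\dots,y_n)=0$ whenever any of the $y_j$ is $0$. Then the following are equivalent: (1) $B$ is an HBL function for $\{L_j\}$. (2) There is a constant $0<C<\infty$ such that for all $0<\lambda_j,y_j<\infty$ ($1\le j\le n$), $$B(\lambda_1y_1,\dots,\lambda_ny_n)\le C\Big(\max_{s\in\mathcal{P}}\lambda_1^{s_1}\cdots\lambda_n^{s_n}\Big)B(y_1,\dots,y_n).$$ (3) There is a constant $0<c<\infty$ such that for all $0<\lambda_j,y_j<\infty$ ($1\le j\le n$), $$B(\lambda_1y_1,\dots,\lambda_ny_n)\ge c\Big(\min_{s\in\mathcal{P}}\lambda_1^{s_1}\cdots\lambda_n^{s_n}\Big)B(y_1,\dots,y_n).$$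
   Context: The Hölder-Brascamp-Lieb (HBL) polytope $\mathcal{P}$ of surjective linear maps $L_j:\mathbb{R}^d\to\mathbb{R}^{d_j}$ is the set of $s=(s_1,\dots,s_n)\in[0,1]^n$ (one thinks of $s_j=1/p_j$ with $p_j\in[1,\infty]$) satisfying $\sum_{j=1}^n s_jd_j=d$ and $\dim(V)\le\sum_{j=1}^n s_j\dim(L_jV)$ for all linear subspaces $V\subset\mathbb{R}^d$. It is a compact convex polytope. A function $B:[0,\infty)^n\to[0,\infty)$ is an HBL function for $\{L_j\}$ if there is a constant $C<\infty$ such that $$\int_{\mathbb{R}^d}B\big(f_1(L_1(x)),\dots,f_n(L_n(x))\big)\,dx\le C\,B\Big(\int_{\mathbb{R}^{d_1}}f_1,\dots,\int_{\mathbb{R}^{d_n}}f_n\Big)$$ for all nonnegative $f_j\in L^1(\mathbb{R}^{d_j})$, $1\le j\le n$. *)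

theory Defs
  imports "HOL-Analysis.Analysis" "HOL-Analysis.Finite_Function_Topology"
begin

(* The target dimensions vary with j, so the target spaces cannot be types real^'m for a single 'm.
   R^m is realised as the subspace of the library vector space of finitely supported
   real sequences that consists of the sequences supported in {..<m}. *)
definition Rn :: "nat \<Rightarrow> (nat \<Rightarrow>\<^sub>0 real) set" where
  "Rn m = {y. Poly_Mapping.keys y \<subseteq> {..<m}}"

definition Rn_of :: "nat \<Rightarrow> (nat \<Rightarrow> real) \<Rightarrow> (nat \<Rightarrow>\<^sub>0 real)" where
  "Rn_of m x = (\<Sum>i<m. Poly_Mapping.single i (x i))"

(* Completed m-dimensional Lebesgue measure, so that integrability on Rn m is integrability of
   Lebesgue measurable (not only Borel measurable) functions. *)
definition lebesgue_Rn :: "nat \<Rightarrow> (nat \<Rightarrow>\<^sub>0 real) measure" where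
  "lebesgue_Rn m = embed_measure (completion (Pi\<^sub>M {..<m} (\<lambda>_. lborel))) (Rn_of m)"

definition HBL_polytope ::
  "('n::finite \<Rightarrow> nat) \<Rightarrow> ('n \<Rightarrow> real^'d \<Rightarrow> (nat \<Rightarrow>\<^sub>0 real)) \<Rightarrow> (real^'n) set" where
  "HBL_polytope k L = {s.
     (\<forall>j. 0 \<le> s $ j \<and> s $ j \<le> 1) \<and>
     (\<Sum>j\<in>UNIV. s $ j * real (k j)) = real CARD('d) \<and>
     (\<forall>V. subspace V \<longrightarrow> real (dim V) \<le> (\<Sum>j\<in>UNIV. s $ j * real (dim (L j ` V))))}"

definition orthant :: "(real^'n) set" where
  "orthant = {y. \<forall>j. 0 \<le> y $ j}"

(* B is only meaningful on the orthant; the values of B elsewhere are never used.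
   A coordinatewise monotone B need not make the integrand on the left measurable.  In that case
   nn_integral is the lower integral; for a measurable integrand it is the Lebesgue integral. *)
definition HBL_function ::
  "('n::finite \<Rightarrow> nat) \<Rightarrow> ('n \<Rightarrow> real^'d \<Rightarrow> (nat \<Rightarrow>\<^sub>0 real)) \<Rightarrow> (real^'n \<Rightarrow> real) \<Rightarrow> bool" where
  "HBL_function k L B \<longleftrightarrow>
     (\<exists>C\<ge>0. \<forall>f. (\<forall>j. integrable (lebesgue_Rn (k j)) (f j) \<and> (\<forall>y\<in>Rn (k j). 0 \<le> f j y)) \<longrightarrow>
        (\<integral>\<^sup>+ x. ennreal (B (\<chi> j. f j (L j x))) \<partial>lebesgue)
          \<le> ennreal (C * B (\<chi> j. integral\<^sup>L (lebesgue_Rn (k j)) (f j))))"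

lemma lookup_Rn_of: "Poly_Mapping.lookup (Rn_of m x) i = (if i < m then x i else 0)"
  by (induction m) (auto simp: Rn_of_def lookup_add lookup_single when_def)

lemma inj_on_Rn_of: "inj_on (Rn_of m) ({..<m} \<rightarrow>\<^sub>E UNIV)"
proof (rule inj_onI)
  fix x y :: "nat \<Rightarrow> real"
  assume x: "x \<in> {..<m} \<rightarrow>\<^sub>E UNIV" and y: "y \<in> {..<m} \<rightarrow>\<^sub>E UNIV" and eq: "Rn_of m x = Rn_of m y"
  have "x i = y i" if "i < m" for i
    using lookup_Rn_of[of m x i] lookup_Rn_of[of m y i] eq that by simp
  then show "x = y"
    using x y by (intro PiE_ext) auto
qed

lemma Rn_iff: "y \<in> Rn m \<longleftrightarrow> (\<forall>i\<ge>m. Poly_Mapping.lookup y i = 0)"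
  unfolding Rn_def keys.rep_eq mem_Collect_eq subset_eq lessThan_iff not_le[symmetric] by blast

lemma Rn_of_image: "Rn_of m ` ({..<m} \<rightarrow>\<^sub>E UNIV) = Rn m"
proof
  show "Rn_of m ` ({..<m} \<rightarrow>\<^sub>E UNIV) \<subseteq> Rn m"
    by (rule image_subsetI) (simp add: Rn_iff lookup_Rn_of)
next
  show "Rn m \<subseteq> Rn_of m ` ({..<m} \<rightarrow>\<^sub>E UNIV)"
  proof
    fix y assume y: "y \<in> Rn m"
    let ?x = "restrict (Poly_Mapping.lookup y) {..<m}"
    have "Poly_Mapping.lookup y i = Poly_Mapping.lookup (Rn_of m ?x) i" for i
      using y by (simp add: Rn_iff lookup_Rn_of)
    then have "y = Rn_of m ?x"
      by (rule poly_mapping_eqI)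
    moreover have "?x \<in> {..<m} \<rightarrow>\<^sub>E UNIV"
      by (rule restrict_PiE_iff[THEN iffD2]) simp
    ultimately show "y \<in> Rn_of m ` ({..<m} \<rightarrow>\<^sub>E UNIV)"
      by (rule image_eqI)
  qed
qed

lemma space_lebesgue_Rn: "space (lebesgue_Rn m) = Rn m"
  by (simp add: lebesgue_Rn_def space_embed_measure space_PiM Rn_of_image)

lemma compact_HBL_polytope: "compact (HBL_polytope k L)"
proof -
  have "HBL_polytope k L =
     (\<Inter>j. {s. 0 \<le> s $ j} \<inter> {s. s $ j \<le> 1}) \<inter>
     {s. (\<Sum>j\<in>UNIV. s $ j * real (k j)) = real CARD('b)} \<inter>
     (\<Inter>V\<in>{V. subspace V}. {s. real (dim V) \<le> (\<Sum>j\<in>UNIV. s $ j * real (dim (L j ` V)))})"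
    by (auto simp: HBL_polytope_def)
  also have "closed \<dots>"
    by (intro closed_Int closed_INT ballI closed_Collect_le closed_Collect_eq continuous_intros)
  finally have "closed (HBL_polytope k L)" .
  moreover have "HBL_polytope k L \<subseteq> cbox 0 1"
    by (auto simp: HBL_polytope_def mem_box_cart)
  ultimately show ?thesis
    using bounded_subset[OF bounded_cbox] by (auto simp: compact_eq_bounded_closed)
qed

(* The suprema and infima of these monomials over a nonempty polytope are maxima and minima. *)
lemma
  fixes t :: "real^'n"
  assumes t: "\<forall>j. 0 < t $ j" and ne: "HBL_polytope k L \<noteq> {}"
  shows HBL_polytope_SUP_attained: "\<exists>s\<in>HBL_polytope k L.
      (\<Prod>j\<in>UNIV. t $ j powr s $ j) = (SUP s\<in>HBL_polytope k L. \<Prod>j\<in>UNIV. t $ j powr s $ j)"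
    and HBL_polytope_INF_attained: "\<exists>s\<in>HBL_polytope k L.
      (\<Prod>j\<in>UNIV. t $ j powr s $ j) = (INF s\<in>HBL_polytope k L. \<Prod>j\<in>UNIV. t $ j powr s $ j)"
proof -
  let ?h = "\<lambda>s::real^'n. \<Prod>j\<in>UNIV. t $ j powr s $ j"
  have cont: "continuous_on (HBL_polytope k L) ?h"
    using t by (intro continuous_intros) (simp add: less_imp_neq[symmetric])
  obtain s where s: "s \<in> HBL_polytope k L" "\<And>s'. s' \<in> HBL_polytope k L \<Longrightarrow> ?h s' \<le> ?h s"
    using continuous_attains_sup[OF compact_HBL_polytope ne cont] by blast
  show "\<exists>s\<in>HBL_polytope k L. ?h s = (SUP s\<in>HBL_polytope k L. ?h s)"
    using s by (intro bexI[of _ s] cSup_eq_maximum[symmetric]) auto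
  obtain s where s: "s \<in> HBL_polytope k L" "\<And>s'. s' \<in> HBL_polytope k L \<Longrightarrow> ?h s \<le> ?h s'"
    using continuous_attains_inf[OF compact_HBL_polytope ne cont] by blast
  show "\<exists>s\<in>HBL_polytope k L. ?h s = (INF s\<in>HBL_polytope k L. ?h s)"
    using s by (intro bexI[of _ s] cInf_eq_minimum[symmetric]) auto
qed

end

theory Submission
  imports Defs
begin

text \<open>
  Upper and lower growth are exchanged by t \<open>\<mapsto>\<close> 1/t and y \<open>\<mapsto>\<close> ty.

  Growth implies the HBL property: the integrand is at most B at the integrals times the sum over the
  vertices s of the polytope of the products of (f_j / int f_j)^(s_j), and each of these products
  is controlled by the Hoelder-Brascamp-Lieb inequality.  That inequality is proved in the form given by
  Bennett, Carbery, Christ and Tao, by induction on dim V' - dim V for the subquotients V'/V of the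
  domain: a critical subspace W splits the inequality into the ones for W/V and V'/W, a general point of
  the polytope is a convex combination of vertices, and at a vertex without critical subspaces a
  single exponent 1 remains, where the inequality is a change of variables.  Functions on the
  subquotients are represented by invariant functions on the whole domain, and their integrals by
  iterated integrals along the vectors of a basis.

  The HBL property implies growth: by linear programming duality, the maximum of the monomial over
  the polytope is attained by a weighted family of subspaces, which can be uncrossed into a
  chain.  Testing with the indicator functions of the images of a box adapted to that chain gives the bound.
\<close>

section \<open>Iterated line integrals and change of basis\<close>

text \<open>A quotient \<open>V'/V\<close> varies along the induction and so cannot be a fixed type;
  hence the invariant functions and the line integrals, which fix the measure of a quotient only up
  to a positive factor. This is harmless because only the finiteness of constants is claimed. In
  \<open>ennreal\<close>, 0 times infinity is 0, so the data of the inequality are kept strictly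
  positive, and a function with zeros is reached by adding a positive integrable weight after
  normalisation. The passage to convex combinations of vertices is pointwise: once the integrals are
  normalised to 1, the weighted product is at most the sum of the vertex products. In the converse
  direction the obstacle is uniformity: the optimal chain depends on the scaling vector
  \<open>t\<close>, the growth constant must not. Only finitely many dimension profiles of subspaces
  occur, so fixing one subspace per profile leaves finitely many chains, and for a given chain
  \<open>t\<close> enters only through the side lengths of the box.\<close>

definition line_int :: "'a::euclidean_space \<Rightarrow> ('a \<Rightarrow> ennreal) \<Rightarrow> 'a \<Rightarrow> ennreal" where
  "line_int b g x = (\<integral>\<^sup>+ t. g (x + t *\<^sub>R b) \<partial>lborel)"

abbreviation span_int :: "'a::euclidean_space list \<Rightarrow> ('a \<Rightarrow> ennreal) \<Rightarrow> 'a \<Rightarrow> ennreal" where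
  "span_int bs g \<equiv> fold line_int bs g"

definition invariant_under :: "'a::real_vector set \<Rightarrow> ('a \<Rightarrow> 'b) \<Rightarrow> bool" where
  "invariant_under U g \<longleftrightarrow> (\<forall>u\<in>U. \<forall>x. g (x + u) = g x)"

lemma invariant_underD: "invariant_under U g \<Longrightarrow> u \<in> U \<Longrightarrow> g (x + u) = g x"
  by (simp add: invariant_under_def)

lemma invariant_under_mono: "invariant_under U g \<Longrightarrow> V \<subseteq> U \<Longrightarrow> invariant_under V g"
  by (auto simp: invariant_under_def)

lemma invariant_under_span:
  assumes "invariant_under U g" and U: "\<And>u t. u \<in> U \<Longrightarrow> t *\<^sub>R u \<in> U"
  shows "invariant_under (span U) g"
  unfolding invariant_under_def
proof
  fix u assume "u \<in> span U"
  then show "\<forall>x. g (x + u) = g x"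
  proof (induction u rule: span_induct_alt)
    case base
    show ?case by simp
  next
    case (step c x y)
    then show ?case
      using assms by (simp add: invariant_under_def add.assoc[symmetric])
  qed
qed

lemma line_int_measurable [measurable]:
  assumes [measurable]: "g \<in> borel_measurable borel"
  shows "line_int b g \<in> borel_measurable borel"
  unfolding line_int_def by measurable

lemma span_int_measurable [measurable]:
  "g \<in> borel_measurable borel \<Longrightarrow> span_int bs g \<in> borel_measurable borel"
  by (induction bs arbitrary: g) auto

lemma line_int_commute:
  assumes [measurable]: "g \<in> borel_measurable borel"
  shows "line_int b (line_int c g) = line_int c (line_int b g)"
proof
  fix x
  have "line_int b (line_int c g) x
      = (\<integral>\<^sup>+ s. (\<integral>\<^sup>+ t. g (x + t *\<^sub>R b + s *\<^sub>R c) \<partial>lborel) \<partial>lborel)"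
    unfolding line_int_def by (subst lborel_pair.Fubini') auto
  also have "\<dots> = line_int c (line_int b g) x"
    unfolding line_int_def by (simp add: add_ac)
  finally show "line_int b (line_int c g) x = line_int c (line_int b g) x" .
qed

lemma line_int_scale:
  assumes [measurable]: "g \<in> borel_measurable borel" and "a \<noteq> 0"
  shows "line_int (a *\<^sub>R b) g x = ennreal (1 / \<bar>a\<bar>) * line_int b g x"
proof -
  have "line_int b g x = ennreal \<bar>a\<bar> * line_int (a *\<^sub>R b) g x"
    unfolding line_int_def
    using nn_integral_real_affine[of "\<lambda>t. g (x + t *\<^sub>R b)" a 0] assms
    by (simp add: mult.commute)
  then have "ennreal (1 / \<bar>a\<bar>) * line_int b g x
      = (ennreal (1 / \<bar>a\<bar>) * ennreal \<bar>a\<bar>) * line_int (a *\<^sub>R b) g x"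
    by (simp add: mult.assoc)
  also have "ennreal (1 / \<bar>a\<bar>) * ennreal \<bar>a\<bar> = 1"
    using \<open>a \<noteq> 0\<close> by (simp flip: ennreal_mult)
  finally show ?thesis by simp
qed

text \<open>The shear among the elementary operations on a basis of a quotient;
  \<open>line_int_scale\<close> and \<open>line_int_commute\<close> are the other two, and together
  they yield the change of basis.\<close>

lemma line_int_add_invariant:
  assumes "invariant_under U g" "subspace U" "u \<in> U"
  shows "line_int (b + u) g = line_int b g"
proof
  fix x
  have "g (x + t *\<^sub>R (b + u)) = g (x + t *\<^sub>R b)" for t
    using invariant_underD[OF assms(1), of "t *\<^sub>R u" "x + t *\<^sub>R b"] assms(2,3)
    by (simp add: subspace_scale algebra_simps)
  then show "line_int (b + u) g x = line_int b g x"
    by (simp add: line_int_def)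
qed

lemma invariant_under_line_int:
  assumes "invariant_under U g"
  shows "invariant_under U (line_int b g)"
proof -
  have "g (x + u + t *\<^sub>R b) = g (x + t *\<^sub>R b)" if "u \<in> U" for x u t
    using invariant_underD[OF assms that, of "x + t *\<^sub>R b"] by (simp add: add_ac)
  then show ?thesis
    by (simp add: invariant_under_def line_int_def)
qed

lemma invariant_under_line_int_direction:
  assumes [measurable]: "g \<in> borel_measurable borel"
  shows "invariant_under (span {b}) (line_int b g)"
proof -
  have "line_int b g (x + a *\<^sub>R b) = line_int b g x" for a x
    unfolding line_int_def
    using nn_integral_real_affine[of "\<lambda>t. g (x + t *\<^sub>R b)" 1 a]
    by (simp add: algebra_simps)
  then show ?thesis
    by (auto simp: invariant_under_def span_singleton)
qed

lemma invariant_under_span_Un: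
  assumes "invariant_under U g" "invariant_under V g" "subspace U" "subspace V"
  shows "invariant_under (span (U \<union> V)) g"
  using assms by (intro invariant_under_span) (auto simp: invariant_under_def subspace_scale)

text \<open>By translation invariance of \<open>lborel\<close>, integration along \<open>b\<close>
  takes a function on the quotient by \<open>U\<close> to one on the smaller quotient in which
  \<open>b\<close> is killed as well.\<close>

lemma invariant_under_insert:
  assumes "invariant_under U g" "g \<in> borel_measurable borel" "subspace U"
  shows "invariant_under (span (insert b U)) (line_int b g)"
proof -
  have "span (insert b U) \<subseteq> span (U \<union> span {b})"
    by (intro span_mono) (auto intro: span_base)
  then show ?thesis
    using invariant_under_span_Un[OF invariant_under_line_int[OF assms(1)]
        invariant_under_line_int_direction[OF assms(2)] assms(3) subspace_span]
    by (blast intro: invariant_under_mono)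
qed

lemma span_insert_span: "span (A \<union> insert b (span B)) = span (A \<union> insert b B)"
  by (rule subset_antisym; rule span_minimal)
     (auto intro: span_base subspace_span subsetD[OF span_mono, rotated])

lemma span_span_Un: "span (span A \<union> B) = span (A \<union> B)"
  by (rule subset_antisym; rule span_minimal)
     (auto intro: span_base subspace_span subsetD[OF span_mono, rotated])

lemma span_Un_span: "span (A \<union> span B) = span (A \<union> B)"
  by (metis span_span_Un sup_commute)

lemma invariant_under_span_int:
  assumes "invariant_under U g" "g \<in> borel_measurable borel" "subspace U"
  shows "invariant_under (span (U \<union> set bs)) (span_int bs g)"
  using assms
proof (induction bs arbitrary: U g)
  case Nil
  then show ?case by (simp add: span_eq_iff[THEN iffD2])
next
  case (Cons b bs)
  have "invariant_under (span (span (insert b U) \<union> set bs)) (span_int bs (line_int b g))"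
    using Cons.prems by (intro Cons.IH invariant_under_insert) auto
  then show ?case by (simp add: span_span_Un)
qed

lemma line_int_cmult:
  assumes [measurable]: "g \<in> borel_measurable borel"
  shows "line_int b (\<lambda>x. c * g x) = (\<lambda>x. c * line_int b g x)"
  by (simp add: line_int_def[abs_def] nn_integral_cmult)

lemma span_int_cmult:
  assumes "g \<in> borel_measurable borel"
  shows "span_int bs (\<lambda>x. c * g x) = (\<lambda>x. c * span_int bs g x)"
  using assms by (induction bs arbitrary: g) (auto simp: line_int_cmult)

lemma line_int_mono: "(\<And>x. f x \<le> g x) \<Longrightarrow> line_int b f x \<le> line_int b g x"
  unfolding line_int_def by (intro nn_integral_mono) auto

lemma span_int_mono: "(\<And>x. f x \<le> g x) \<Longrightarrow> span_int bs f x \<le> span_int bs g x"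
proof (induction bs arbitrary: f g)
  case (Cons b bs)
  show ?case using Cons.prems by (simp, intro Cons.IH line_int_mono) auto
qed simp

lemma span_int_sum:
  assumes "finite S" "\<And>v. v \<in> S \<Longrightarrow> g v \<in> borel_measurable borel"
  shows "span_int bs (\<lambda>x. \<Sum>v\<in>S. g v x) = (\<lambda>x. \<Sum>v\<in>S. span_int bs (g v) x)"
  using assms(2)
proof (induction bs arbitrary: g)
  case (Cons b bs)
  have "line_int b (\<lambda>x. \<Sum>v\<in>S. g v x) = (\<lambda>x. \<Sum>v\<in>S. line_int b (g v) x)"
    unfolding line_int_def
    by (intro ext nn_integral_sum) (use Cons.prems in measurable)
  then show ?case
    using Cons by simp
qed simp

lemma span_int_invariant_mult:
  assumes "g \<in> borel_measurable borel" "invariant_under (span (set bs)) h"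
  shows "span_int bs (\<lambda>x. h x * g x) = (\<lambda>x. h x * span_int bs g x)"
  using assms
proof (induction bs arbitrary: g)
  case (Cons b bs)
  note [measurable] = Cons.prems(1)
  have "h (x + t *\<^sub>R b) = h x" for t x
    using invariant_underD[OF Cons.prems(2), of "t *\<^sub>R b" x] by (simp add: span_base span_scale)
  then have *: "line_int b (\<lambda>x. h x * g x) = (\<lambda>x. h x * line_int b g x)"
    by (auto simp: line_int_def nn_integral_cmult)
  have "invariant_under (span (set bs)) h"
    by (rule invariant_under_mono[OF Cons.prems(2) span_mono]) auto
  then show ?case
    using Cons * by simp
qed simp

text \<open>Keeps iterated integrals among the strictly positive functions, so that they may serve
  as data of a further inequality. The value may be infinite.\<close>

lemma line_int_pos:
  assumes [measurable]: "g \<in> borel_measurable borel" and "\<And>x. 0 < g x"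
  shows "0 < line_int b g x"
proof (rule ccontr)
  assume "\<not> 0 < line_int b g x"
  then have "(\<integral>\<^sup>+ t. g (x + t *\<^sub>R b) \<partial>lborel) = 0"
    by (simp add: line_int_def)
  then have "AE t in (lborel :: real measure). g (x + t *\<^sub>R b) = 0"
    by (subst (asm) nn_integral_0_iff_AE) auto
  then have "AE t in (lborel :: real measure). False"
    by eventually_elim (use assms(2) in \<open>metis less_irrefl\<close>)
  then show False
    by (simp add: ae_filter_eq_bot_iff trivial_limit_def[symmetric])
qed

lemma span_int_pos:
  "g \<in> borel_measurable borel \<Longrightarrow> (\<And>x. 0 < g x) \<Longrightarrow> 0 < span_int bs g x"
  by (induction bs arbitrary: g) (auto simp: line_int_pos)

text \<open>For subspaces, \<open>bs\<close> projects to a basis of \<open>U'/U\<close>. The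
  dimension equation encodes linear independence modulo \<open>U\<close>, including distinctness of
  the entries.\<close>

definition basis_mod :: "'a::euclidean_space set \<Rightarrow> 'a list \<Rightarrow> 'a set \<Rightarrow> bool" where
  "basis_mod U bs U' \<longleftrightarrow> span (U \<union> set bs) = U' \<and> dim U' = dim U + length bs"

lemma dim_span_Un_le:
  fixes U :: "'a::euclidean_space set"
  shows "dim (span (U \<union> set bs)) \<le> dim U + length bs"
proof (induction bs arbitrary: U)
  case (Cons b bs)
  have "dim (span (insert b U \<union> set bs)) \<le> dim (insert b U) + length bs"
    by (rule Cons.IH)
  also have "dim (insert b U) \<le> dim U + 1"
    by (auto simp: dim_insert)
  finally show ?case by simp
qed simp

lemma basis_mod_Nil: "subspace U \<Longrightarrow> basis_mod U [] U' \<longleftrightarrow> U' = U"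
  by (auto simp: basis_mod_def span_eq_iff[THEN iffD2])

lemma basis_mod_Cons:
  assumes "subspace U"
  shows "basis_mod U (b # bs) U' \<longleftrightarrow> b \<notin> U \<and> basis_mod (span (insert b U)) bs U'"
proof -
  have sp: "span U = U" using assms by (simp add: span_eq_iff)
  have eq: "span (span (insert b U) \<union> set bs) = span (U \<union> set (b # bs))"
    by (simp add: span_span_Un)
  have "b \<notin> U" if "basis_mod U (b # bs) U'"
  proof
    assume "b \<in> U"
    then have "span (U \<union> set (b # bs)) = span (U \<union> set bs)"
      by (simp add: insert_absorb)
    then show False
      using that dim_span_Un_le[of U bs] by (simp add: basis_mod_def)
  qed
  moreover have "dim (span (insert b U)) = dim U + 1" if "b \<notin> U"
    using that sp by (simp add: dim_insert del: span_eq_iff)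
  ultimately show ?thesis
    using eq by (auto simp: basis_mod_def)
qed

lemma basis_mod_append:
  assumes "subspace U" "basis_mod U as W" "basis_mod W bs U'"
  shows "basis_mod U (as @ bs) U'"
  using assms(2,3) span_span_Un[of "U \<union> set as" "set bs"] by (auto simp: basis_mod_def Un_assoc)

lemma basis_mod_exists:
  fixes U U' :: "'a::euclidean_space set"
  assumes "subspace U" "subspace U'" "U \<subseteq> U'"
  shows "\<exists>bs. basis_mod U bs U'"
  using assms
proof (induction "dim U' - dim U" arbitrary: U)
  case 0
  then have "dim U' = dim U"
    using dim_subset[OF 0(4)] by simp
  then have "U' = U"
    using 0 subspace_dim_equal by (metis order_refl)
  then show ?case
    using 0 basis_mod_Nil by blast
next
  case (Suc n)
  then have "U \<noteq> U'" by auto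
  then obtain b where b: "b \<in> U'" "b \<notin> U" using Suc by auto
  have sp: "span U = U" "span U' = U'" using Suc by (auto simp: span_eq_iff)
  have "dim (span (insert b U)) = dim U + 1"
    using b sp by (simp add: dim_insert del: span_eq_iff)
  moreover have "span (insert b U) \<subseteq> U'"
    using b Suc sp by (metis insert_subset span_mono)
  moreover have "n = dim U' - (dim U + 1)"
    using Suc(2) by simp
  ultimately obtain bs where "basis_mod (span (insert b U)) bs U'"
    using Suc(1)[of "span (insert b U)"] Suc(4) by (metis subspace_span)
  then show ?case
    using b Suc basis_mod_Cons by blast
qed

lemma span_insert_insert: "span (insert a (span (insert b U))) = span (insert b (insert a U))"
  using span_insert_span[of "{}" a "insert b U"] by (simp add: insert_commute)

text \<open>Steinitz exchange for integrals: \<open>b\<close> enters at the front of the list, where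
  \<open>span_int\<close> integrates first, and some other vector drops out. Each step is a shear, a
  scaling or a swap, so the value changes by a positive factor.\<close>

lemma span_int_exchange:
  fixes U :: "'a::euclidean_space set"
  assumes "subspace U" "basis_mod U cs U'" "b \<in> U'" "b \<notin> U"
  shows "\<exists>ds k. basis_mod U (b # ds) U' \<and> 0 < k \<and>
    (\<forall>g\<in>borel_measurable borel. invariant_under U g \<longrightarrow>
       (\<forall>x. span_int cs g x = ennreal k * span_int (b # ds) g x))"
  using assms
proof (induction cs arbitrary: U)
  case Nil
  then show ?case by (simp add: basis_mod_Nil)
next
  case (Cons c cs)
  have spU: "span U = U" using Cons.prems by (simp add: span_eq_iff)
  let ?U1 = "span (insert c U)"
  have c: "c \<notin> U" "basis_mod ?U1 cs U'"
    using Cons.prems basis_mod_Cons by blast+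
  show ?case
  proof (cases "b \<in> ?U1")
    case True
    \<comment> \<open>Modulo \<open>U\<close>, \<open>b\<close> is a multiple of \<open>c\<close>,
      so \<open>b\<close> takes the place of \<open>c\<close>.\<close>
    then obtain a where a: "b - a *\<^sub>R c \<in> U"
      using spU by (auto simp: span_breakdown_eq)
    have "a \<noteq> 0" using a Cons.prems by auto
    have "c \<in> span (insert b U)"
      using in_span_insert[OF True] Cons.prems spU by auto
    then have "span (insert b U) = ?U1"
      using True by (intro subset_antisym span_minimal subspace_span)
        (auto intro: span_base span_superset[THEN subsetD])
    then have "basis_mod U (b # cs) U'"
      using c Cons.prems by (simp add: basis_mod_Cons)
    moreover have "span_int (c # cs) g x = ennreal \<bar>a\<bar> * span_int (b # cs) g x"
      if g: "g \<in> borel_measurable borel" "invariant_under U g" for g x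
    proof -
      have "line_int b g = line_int (a *\<^sub>R c) g"
        using line_int_add_invariant[OF g(2) Cons.prems(1) a, of "a *\<^sub>R c"] by simp
      then have "line_int b g = (\<lambda>x. ennreal (1 / \<bar>a\<bar>) * line_int c g x)"
        using line_int_scale[OF g(1) \<open>a \<noteq> 0\<close>] by auto
      then have "span_int (b # cs) g x = ennreal (1 / \<bar>a\<bar>) * span_int (c # cs) g x"
        using span_int_cmult[OF line_int_measurable[OF g(1)]] by simp
      moreover have "ennreal \<bar>a\<bar> * ennreal (1 / \<bar>a\<bar>) = 1"
        using \<open>a \<noteq> 0\<close> by (simp flip: ennreal_mult)
      ultimately show ?thesis
        by (simp add: mult.assoc[symmetric])
    qed
    ultimately show ?thesis
      using \<open>a \<noteq> 0\<close> by (intro exI[of _ cs] exI[of _ "\<bar>a\<bar>"]) auto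
  next
    case False
    \<comment> \<open>Here \<open>b\<close> is still new after \<open>c\<close>, so the recursion
      brings it to second place, and Tonelli swaps the two.\<close>
    then obtain ds k where ds: "basis_mod ?U1 (b # ds) U'" "0 < k"
      "\<And>g x. g \<in> borel_measurable borel \<Longrightarrow> invariant_under ?U1 g \<Longrightarrow>
         span_int cs g x = ennreal k * span_int (b # ds) g x"
      using Cons.IH[OF subspace_span c(2) Cons.prems(3)] by metis
    have "c \<notin> span (insert b U)"
      using in_span_insert[of c b U] c(1) False spU by auto
    then have "basis_mod U (b # c # ds) U'"
      using ds(1) Cons.prems
      by (simp add: basis_mod_Cons span_insert_insert insert_commute)
    moreover have "span_int (c # cs) g x = ennreal k * span_int (b # c # ds) g x"
      if g: "g \<in> borel_measurable borel" "invariant_under U g" for g x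
      using ds(3)[OF line_int_measurable invariant_under_insert, OF g(1) g(2) g(1) Cons.prems(1)]
        line_int_commute[OF g(1)] by simp
    ultimately show ?thesis
      using ds(2) by blast
  qed
qed

text \<open>The factor is the absolute determinant of the change of basis modulo \<open>U\<close>,
  independent of \<open>g\<close> and \<open>x\<close>. Exchange makes the heads agree, and the
  tails are compared modulo the span of \<open>U\<close> and the head.\<close>

theorem span_int_change_of_basis:
  fixes U :: "'a::euclidean_space set"
  assumes "subspace U" "basis_mod U bs U'" "basis_mod U cs U'"
  shows "\<exists>k>0. \<forall>g\<in>borel_measurable borel. invariant_under U g \<longrightarrow>
    (\<forall>x. span_int bs g x = ennreal k * span_int cs g x)"
  using assms
proof (induction bs arbitrary: U cs)
  case Nil
  then have "cs = []"
    by (auto simp: basis_mod_def)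
  then show ?case
    by (intro exI[of _ 1]) auto
next
  case (Cons b bs)
  have b: "b \<notin> U" "basis_mod (span (insert b U)) bs U'"
    using Cons.prems basis_mod_Cons by blast+
  have "b \<in> U'"
    using Cons.prems(2) by (auto simp: basis_mod_def intro: span_base)
  obtain ds k where ds: "basis_mod U (b # ds) U'" "0 < k"
      "\<And>g x. g \<in> borel_measurable borel \<Longrightarrow> invariant_under U g \<Longrightarrow>
         span_int cs g x = ennreal k * span_int (b # ds) g x"
    using span_int_exchange[OF Cons.prems(1,3) \<open>b \<in> U'\<close> b(1)] by metis
  obtain l where l: "0 < l"
    "\<And>g x. g \<in> borel_measurable borel \<Longrightarrow> invariant_under (span (insert b U)) g \<Longrightarrow>
         span_int bs g x = ennreal l * span_int ds g x"
    using Cons.IH[OF subspace_span b(2)] ds(1) Cons.prems(1) basis_mod_Cons by meson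
  have "span_int (b # bs) g x = ennreal (l / k) * span_int cs g x"
    if g: "g \<in> borel_measurable borel" "invariant_under U g" for g x
  proof -
    have "span_int (b # bs) g x = ennreal l * span_int (b # ds) g x"
      using l(2)[OF line_int_measurable invariant_under_insert, OF g(1) g(2) g(1) Cons.prems(1)]
      by simp
    moreover have "ennreal (l / k) * ennreal k = ennreal l"
      using l(1) ds(2) by (simp flip: ennreal_mult)
    ultimately show ?thesis
      using ds(3)[OF g] by (simp add: mult.assoc[symmetric])
  qed
  then show ?case
    using l(1) ds(2) by (intro exI[of _ "l / k"]) auto
qed

section \<open>Localised Brascamp-Lieb inequalities\<close>

text \<open>Exponent 0 gives 1 also at infinity, so that a factor with exponent 0 drops out of a
  product even when its integral diverges.\<close>

definition epow :: "ennreal \<Rightarrow> real \<Rightarrow> ennreal" where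
  "epow x s = (if s = 0 then 1 else if x = \<infinity> then \<infinity> else ennreal (enn2real x powr s))"

lemma epow_0 [simp]: "epow x 0 = 1"
  by (simp add: epow_def)

lemma epow_1 [simp]: "epow x 1 = x"
  by (cases x) (auto simp: epow_def)

lemma epow_measurable [measurable (raw)]:
  assumes [measurable]: "g \<in> borel_measurable M"
  shows "(\<lambda>x. epow (g x) s) \<in> borel_measurable M"
  unfolding epow_def by measurable

lemma epow_pos: "0 < x \<Longrightarrow> 0 < epow x s"
  by (cases x) (auto simp: epow_def)

lemma epow_ennreal: "0 < c \<Longrightarrow> epow (ennreal c) s = ennreal (c powr s)"
  by (simp add: epow_def)

lemma epow_mult:
  assumes "0 < c"
  shows "epow (ennreal c * x) s = ennreal (c powr s) * epow x s"
proof (cases "x = \<infinity>")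
  case True
  then show ?thesis
    using assms by (auto simp: epow_def ennreal_mult_top)
next
  case False
  then show ?thesis
    using assms by (cases x) (auto simp: epow_def powr_mult simp flip: ennreal_mult)
qed

section \<open>Products of powers and convex combinations of exponents\<close>

lemma prod_pos_ennreal:
  fixes f :: "'n \<Rightarrow> ennreal"
  shows "(\<And>j. j \<in> A \<Longrightarrow> 0 < f j) \<Longrightarrow> 0 < (\<Prod>j\<in>A. f j)"
  by (induction A rule: infinite_finite_induct) (auto simp: ennreal_zero_less_mult_iff)

text \<open>Positivity of the other factors excludes 0 times infinity.\<close>

lemma prod_eq_top_ennreal:
  fixes f :: "'n \<Rightarrow> ennreal"
  assumes "finite A" "j \<in> A" "f j = \<infinity>" "\<And>i. i \<in> A \<Longrightarrow> 0 < f i"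
  shows "(\<Prod>j\<in>A. f j) = \<infinity>"
proof -
  have "0 < (\<Prod>j\<in>A - {j}. f j)"
    using assms(4) by (intro prod_pos_ennreal) auto
  then show ?thesis
    by (subst prod.remove[OF assms(1,2)], subst assms(3)) (metis ennreal_top_mult infinity_ennreal_def less_irrefl)
qed

lemma prod_epow_mult:
  fixes s :: "real^'n" and c :: "'n \<Rightarrow> real"
  assumes "\<And>j. 0 < c j"
  shows "(\<Prod>j\<in>UNIV. epow (ennreal (c j) * t j) (s $ j))
    = ennreal (\<Prod>j\<in>UNIV. c j powr s $ j) * (\<Prod>j\<in>UNIV. epow (t j) (s $ j))"
  using assms by (simp add: epow_mult prod.distrib prod_ennreal)

text \<open>The logarithm of the product is linear in the exponent, hence maximal over a convex hull
  at one of the generators; the sum dominates that maximum.\<close>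

lemma prod_powr_le_sum_hull:
  fixes s :: "real^'n" and t :: "'n \<Rightarrow> real"
  assumes "finite S" "s \<in> convex hull S" "\<And>j. 0 < t j"
  shows "(\<Prod>j\<in>UNIV. t j powr s $ j) \<le> (\<Sum>v\<in>S. \<Prod>j\<in>UNIV. t j powr v $ j)"
proof -
  let ?a = "\<chi> j. ln (t j)"
  have eq: "(\<Prod>j\<in>UNIV. t j powr v $ j) = exp (?a \<bullet> v)" for v :: "real^'n"
    using assms(3) by (simp add: powr_def exp_sum inner_vec_def mult.commute less_imp_neq[symmetric])
  have "S \<noteq> {}" using assms(2) by auto
  let ?M = "Max ((\<lambda>v. ?a \<bullet> v) ` S)"
  have "S \<subseteq> {x. ?a \<bullet> x \<le> ?M}"
    using assms(1) by auto
  then have "convex hull S \<subseteq> {x. ?a \<bullet> x \<le> ?M}"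
    by (intro hull_minimal) (auto simp: convex_halfspace_le)
  then have "?a \<bullet> s \<le> ?M" using assms(2) by auto
  moreover have "?M \<in> (\<lambda>v. ?a \<bullet> v) ` S"
    using assms(1) \<open>S \<noteq> {}\<close> by (intro Max_in) auto
  then obtain v where v: "v \<in> S" "?M = ?a \<bullet> v"
    by (rule imageE)
  ultimately have "exp (?a \<bullet> s) \<le> exp (?a \<bullet> v)" by simp
  also have "\<dots> \<le> (\<Sum>v\<in>S. exp (?a \<bullet> v))"
    using v(1) assms(1) by (intro member_le_sum) auto
  finally show ?thesis by (simp add: eq)
qed

lemma prod_epow_le_sum_hull:
  fixes s :: "real^'n" and t :: "'n \<Rightarrow> ennreal"
  assumes "finite S" "s \<in> convex hull S" "\<And>v j. v \<in> S \<Longrightarrow> 0 \<le> v $ j" "\<And>j. 0 < t j"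
  shows "(\<Prod>j\<in>UNIV. epow (t j) (s $ j)) \<le> (\<Sum>v\<in>S. \<Prod>j\<in>UNIV. epow (t j) (v $ j))"
proof (cases "\<exists>v\<in>S. \<exists>j. t j = \<infinity> \<and> v $ j \<noteq> 0")
  case True
  then obtain v j where v: "v \<in> S" "t j = \<infinity>" "v $ j \<noteq> 0" by auto
  have "(\<Prod>j\<in>UNIV. epow (t j) (v $ j)) = \<infinity>"
    using v by (intro prod_eq_top_ennreal[of _ j] epow_pos assms(4)) (auto simp: epow_def)
  then have "(\<Sum>v\<in>S. \<Prod>j\<in>UNIV. epow (t j) (v $ j)) = \<infinity>"
    using v(1) assms(1) by auto
  then show ?thesis by simp
next
  case False
  \<comment> \<open>Wherever \<open>t j\<close> is infinite, all of \<open>S\<close> and hence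
    \<open>s\<close> has exponent 0, so the value 1 may stand in.\<close>
  let ?t = "\<lambda>j. if t j = \<infinity> then 1 else enn2real (t j)"
  have pos: "0 < ?t j" for j
    using assms(4)[of j] by (cases "t j") auto
  have eq: "(\<Prod>j\<in>UNIV. epow (t j) (v $ j)) = ennreal (\<Prod>j\<in>UNIV. ?t j powr v $ j)"
    if "\<And>j. t j = \<infinity> \<Longrightarrow> v $ j = 0" for v :: "real^'n"
  proof -
    have "epow (t j) (v $ j) = ennreal (?t j powr v $ j)" for j
      using that[of j] assms(4)[of j] pos[of j] by (cases "t j") (auto simp: epow_def)
    then show ?thesis by (simp add: prod_ennreal)
  qed
  have "S \<subseteq> (\<Inter>j\<in>{j. t j = \<infinity>}. {v. axis j 1 \<bullet> v = 0})"
    using False by (auto simp: inner_axis')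
  then have "convex hull S \<subseteq> (\<Inter>j\<in>{j. t j = \<infinity>}. {v. axis j 1 \<bullet> v = 0})"
    by (intro hull_minimal convex_INT) (auto simp: convex_hyperplane)
  then have "t j = \<infinity> \<Longrightarrow> s $ j = 0" for j
    using assms(2) by (auto simp: inner_axis')
  then show ?thesis
    using prod_powr_le_sum_hull[OF assms(1,2), of ?t] pos eq False
    by (simp add: prod_nonneg sum_nonneg sum_ennreal del: if_split_asm)
qed

text \<open>Where \<open>s\<close> has a zero coordinate, generators with a positive coordinate
  there carry weight 0 in the convex combination. In \<open>BL_finite_hull\<close> an integral with
  exponent 0 in \<open>s\<close> may be infinite, and it must then have exponent 0 at the generators
  too.\<close>

lemma convex_hull_face_nonneg:
  fixes s :: "real^'n"
  assumes "finite S" "s \<in> convex hull S" "\<And>v j. v \<in> S \<Longrightarrow> 0 \<le> v $ j"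
  shows "s \<in> convex hull {v\<in>S. \<forall>j. s $ j = 0 \<longrightarrow> v $ j = 0}"
proof -
  obtain u where u: "\<And>v. v \<in> S \<Longrightarrow> 0 \<le> u v" "sum u S = 1" "(\<Sum>v\<in>S. u v *\<^sub>R v) = s"
    using assms(1,2) by (auto simp: convex_hull_finite)
  let ?T = "{v\<in>S. \<forall>j. s $ j = 0 \<longrightarrow> v $ j = 0}"
  have 0: "u v = 0" if v: "v \<in> S - ?T" for v
  proof -
    obtain j where j: "s $ j = 0" "v $ j \<noteq> 0" using v by auto
    have "(\<Sum>v\<in>S. u v * v $ j) = 0"
      using u(3) j(1) by (auto simp: vec_eq_iff)
    then have "\<forall>v\<in>S. u v * v $ j = 0"
      using assms(1,3) u(1) by (subst (asm) sum_nonneg_eq_0_iff) auto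
    then show ?thesis using v j by auto
  qed
  have "sum u ?T = sum u S"
    by (rule sum.mono_neutral_left[OF assms(1)]) (use 0 in auto)
  moreover have "(\<Sum>v\<in>?T. u v *\<^sub>R v) = (\<Sum>v\<in>S. u v *\<^sub>R v)"
    by (rule sum.mono_neutral_left[OF assms(1)]) (use 0 in auto)
  moreover have "finite ?T" using assms(1) by simp
  ultimately show ?thesis
    using u unfolding convex_hull_finite[OF \<open>finite ?T\<close>] mem_Collect_eq
    by (intro exI[of _ u]) simp
qed

text \<open>\<open>K j\<close> stands for the kernel of the \<open>j\<close>-th map. Invariance
  under \<open>V\<close> and \<open>K j\<close> makes \<open>g j\<close> a function on the target of
  the map induced on the quotient by \<open>V\<close>.\<close>

definition admissible ::
  "('n \<Rightarrow> 'a::euclidean_space set) \<Rightarrow> 'a set \<Rightarrow> ('n \<Rightarrow> 'a \<Rightarrow> ennreal) \<Rightarrow> bool" where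
  "admissible K V g \<longleftrightarrow> (\<forall>j. g j \<in> borel_measurable borel \<and> (\<forall>x. 0 < g j x) \<and>
     invariant_under (span (V \<union> K j)) (g j))"

text \<open>The inequality is required at each base point \<open>x\<close>, so that it can be
  applied fibrewise inside another integral. Under \<open>BL_bases\<close>, the lists
  \<open>cs\<close> and \<open>ds j\<close> carry measures on \<open>V'/V\<close> and on its image
  under the \<open>j\<close>-th induced map.\<close>

definition BL_bound_const ::
  "('n::finite \<Rightarrow> 'a::euclidean_space set) \<Rightarrow> 'a set \<Rightarrow> real^'n \<Rightarrow> 'a list \<Rightarrow> ('n \<Rightarrow> 'a list) \<Rightarrow> real \<Rightarrow> bool"
  where
  "BL_bound_const K V s cs ds C \<longleftrightarrow> (\<forall>g x. admissible K V g \<longrightarrow>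
     span_int cs (\<lambda>x. \<Prod>j\<in>UNIV. epow (g j x) (s $ j)) x
       \<le> ennreal C * (\<Prod>j\<in>UNIV. epow (span_int (ds j) (g j) x) (s $ j)))"

definition BL_bases ::
  "('n \<Rightarrow> 'a::euclidean_space set) \<Rightarrow> 'a set \<Rightarrow> 'a set \<Rightarrow> 'a list \<Rightarrow> ('n \<Rightarrow> 'a list) \<Rightarrow> bool" where
  "BL_bases K V V' cs ds \<longleftrightarrow> basis_mod V cs V' \<and>
     (\<forall>j. basis_mod (span (V \<union> K j)) (ds j) (span (V' \<union> K j)))"

definition BL_finite ::
  "('n::finite \<Rightarrow> 'a::euclidean_space set) \<Rightarrow> 'a set \<Rightarrow> 'a set \<Rightarrow> real^'n \<Rightarrow> bool" where
  "BL_finite K V V' s \<longleftrightarrow> (\<exists>cs ds C. BL_bases K V V' cs ds \<and> BL_bound_const K V s cs ds C)"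

lemma BL_bases_exist:
  assumes "subspace V" "subspace V'" "V \<subseteq> V'"
  shows "\<exists>cs ds. BL_bases K V V' cs ds"
proof -
  have "\<exists>d. basis_mod (span (V \<union> K j)) d (span (V' \<union> K j))" for j
    using assms by (intro basis_mod_exists span_mono) auto
  then show ?thesis
    using basis_mod_exists[OF assms] unfolding BL_bases_def by metis
qed

lemma admissible_prod_measurable:
  assumes "admissible K V g"
  shows "(\<lambda>x. \<Prod>j\<in>UNIV. epow (g j x) (s $ j)) \<in> borel_measurable borel"
proof -
  have [measurable]: "g j \<in> borel_measurable borel" for j
    using assms by (simp add: admissible_def)
  show ?thesis by measurable
qed

lemma admissible_invariant:
  assumes "admissible K V g"
  shows "invariant_under V (g j)"
  using assms unfolding admissible_def
  by (meson invariant_under_mono le_sup_iff span_superset)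

lemma admissible_prod_invariant:
  assumes "admissible K V g"
  shows "invariant_under V (\<lambda>x. \<Prod>j\<in>UNIV. epow (g j x) (s $ j))"
  using invariant_underD[OF admissible_invariant[OF assms]] by (simp add: invariant_under_def)

text \<open>Finiteness is independent of the bases: a change of basis multiplies both sides by
  positive constants, those on the right raised to the powers \<open>s $ j\<close>.\<close>

lemma BL_finiteD:
  assumes "BL_finite K V V' s" "subspace V" and bases: "BL_bases K V V' cs ds"
  shows "\<exists>C\<ge>0. BL_bound_const K V s cs ds C"
proof -
  obtain cs' ds' C where C: "BL_bases K V V' cs' ds'" "BL_bound_const K V s cs' ds' C"
    using assms(1) unfolding BL_finite_def by blast
  obtain k where k: "0 < k" "\<And>g x. g \<in> borel_measurable borel \<Longrightarrow> invariant_under V g \<Longrightarrow>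
       span_int cs g x = ennreal k * span_int cs' g x"
    using span_int_change_of_basis[OF \<open>subspace V\<close>] bases C(1) unfolding BL_bases_def by metis
  have "\<exists>l>0. \<forall>g\<in>borel_measurable borel. invariant_under (span (V \<union> K j)) g \<longrightarrow>
       (\<forall>x. span_int (ds' j) g x = ennreal l * span_int (ds j) g x)" (is "?L j") for j
    using bases C(1) unfolding BL_bases_def by (intro span_int_change_of_basis) auto
  then have "\<forall>j. ?L j" by blast
  from choice[OF this] obtain l where l: "\<And>j. 0 < l j"
    "\<And>j g x. g \<in> borel_measurable borel \<Longrightarrow> invariant_under (span (V \<union> K j)) g \<Longrightarrow>
       span_int (ds' j) g x = ennreal (l j) * span_int (ds j) g x"
    by blast
  let ?P = "\<Prod>j\<in>UNIV. l j powr s $ j"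
  have "?P > 0" using l(1) by (intro prod_pos ballI) (metis less_irrefl powr_gt_zero)
  have "BL_bound_const K V s cs ds (k * max C 0 * ?P)"
    unfolding BL_bound_const_def
  proof (intro allI impI)
    fix g x assume g: "admissible K V g"
    have "span_int cs (\<lambda>x. \<Prod>j\<in>UNIV. epow (g j x) (s $ j)) x
        = ennreal k * span_int cs' (\<lambda>x. \<Prod>j\<in>UNIV. epow (g j x) (s $ j)) x"
      by (rule k(2)[OF admissible_prod_measurable[OF g] admissible_prod_invariant[OF g]])
    also have "\<dots> \<le> ennreal k * (ennreal C * (\<Prod>j\<in>UNIV. epow (span_int (ds' j) (g j) x) (s $ j)))"
      using C(2) g unfolding BL_bound_const_def by (intro mult_left_mono) auto
    also have "(\<Prod>j\<in>UNIV. epow (span_int (ds' j) (g j) x) (s $ j))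
        = (\<Prod>j\<in>UNIV. epow (ennreal (l j) * span_int (ds j) (g j) x) (s $ j))"
      using l(2) g unfolding admissible_def by (intro prod.cong) auto
    also have "\<dots> = ennreal ?P * (\<Prod>j\<in>UNIV. epow (span_int (ds j) (g j) x) (s $ j))"
      by (rule prod_epow_mult[OF l(1)])
    \<comment> \<open>A negative \<open>C\<close> acts as 0.\<close>
    also have "ennreal C = ennreal (max C 0)"
      by (simp add: ennreal_neg max_def)
    also have "ennreal k * (ennreal (max C 0) * (ennreal ?P * (\<Prod>j\<in>UNIV. epow (span_int (ds j) (g j) x) (s $ j))))
       = ennreal (k * max C 0 * ?P) * (\<Prod>j\<in>UNIV. epow (span_int (ds j) (g j) x) (s $ j))"
      using k(1) \<open>?P > 0\<close> by (simp add: ennreal_mult mult.assoc)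
    finally show "span_int cs (\<lambda>x. \<Prod>j\<in>UNIV. epow (g j x) (s $ j)) x
        \<le> ennreal (k * max C 0 * ?P) * (\<Prod>j\<in>UNIV. epow (span_int (ds j) (g j) x) (s $ j))" .
  qed
  then show ?thesis
    using k(1) \<open>?P > 0\<close> by (intro exI[of _ "k * max C 0 * ?P"]) auto
qed

text \<open>Tonelli: the bound for \<open>W/V\<close> is applied on the fibres, inside the integral
  over \<open>V'/W\<close>, and the bound for \<open>V'/W\<close> is applied to the fibre
  integrals.\<close>

lemma BL_finite_trans:
  assumes "subspace V" "subspace W" and VW: "BL_finite K V W s" and WV': "BL_finite K W V' s"
  shows "BL_finite K V V' s"
proof -
  obtain as es C where 1: "BL_bases K V W as es" "BL_bound_const K V s as es C" "C \<ge> 0"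
    using VW BL_finiteD[OF VW assms(1)] unfolding BL_finite_def by metis
  obtain bs fs D where 2: "BL_bases K W V' bs fs" "BL_bound_const K W s bs fs D" "D \<ge> 0"
    using WV' BL_finiteD[OF WV' assms(2)] unfolding BL_finite_def by metis
  have "BL_bases K V V' (as @ bs) (\<lambda>j. es j @ fs j)"
    using 1(1) 2(1) basis_mod_append[OF assms(1)] basis_mod_append[OF subspace_span]
    unfolding BL_bases_def by metis
  moreover have "BL_bound_const K V s (as @ bs) (\<lambda>j. es j @ fs j) (C * D)"
    unfolding BL_bound_const_def
  proof (intro allI impI)
    fix g x assume g: "admissible K V g"
    let ?F = "\<lambda>x. \<Prod>j\<in>UNIV. epow (g j x) (s $ j)"
    let ?h = "\<lambda>j. span_int (es j) (g j)"
    \<comment> \<open>Integrating along a basis of \<open>W + K j\<close> modulo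
      \<open>V + K j\<close> removes the dependence on \<open>W\<close>.\<close>
    have h: "admissible K W ?h"
      unfolding admissible_def
    proof (intro allI conjI)
      fix j
      have gj: "g j \<in> borel_measurable borel" "\<And>x. 0 < g j x" "invariant_under (span (V \<union> K j)) (g j)"
        using g by (auto simp: admissible_def)
      show "?h j \<in> borel_measurable borel"
        using gj(1) by simp
      show "0 < ?h j x" for x
        by (rule span_int_pos[OF gj(1,2)])
      have "span (span (V \<union> K j) \<union> set (es j)) = span (W \<union> K j)"
        using 1(1) by (simp add: BL_bases_def basis_mod_def)
      then show "invariant_under (span (W \<union> K j)) (?h j)"
        using invariant_under_span_int[OF gj(3,1) subspace_span, of "es j"] by simp
    qed
    have "span_int (as @ bs) ?F x = span_int bs (span_int as ?F) x"
      by simp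
    also have "\<dots> \<le> span_int bs (\<lambda>x. ennreal C * (\<Prod>j\<in>UNIV. epow (?h j x) (s $ j))) x"
      using 1(2) g unfolding BL_bound_const_def by (intro span_int_mono) auto
    also have "\<dots> = ennreal C * span_int bs (\<lambda>x. \<Prod>j\<in>UNIV. epow (?h j x) (s $ j)) x"
      by (simp add: span_int_cmult[OF admissible_prod_measurable[OF h]])
    also have "\<dots> \<le> ennreal C * (ennreal D * (\<Prod>j\<in>UNIV. epow (span_int (fs j) (?h j) x) (s $ j)))"
      using 2(2) h unfolding BL_bound_const_def by (intro mult_left_mono) auto
    also have "\<dots> = ennreal (C * D) * (\<Prod>j\<in>UNIV. epow (span_int (es j @ fs j) (g j) x) (s $ j))"
      using 1(3) 2(3) by (simp add: ennreal_mult mult.assoc)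
    finally show "span_int (as @ bs) ?F x
      \<le> ennreal (C * D) * (\<Prod>j\<in>UNIV. epow (span_int (es j @ fs j) (g j) x) (s $ j))" .
  qed
  ultimately show ?thesis
    unfolding BL_finite_def by blast
qed

text \<open>The equation \<open>di\<close> says that the \<open>i\<close>-th induced map is
  injective on \<open>V'/V\<close>, hence a change of variables onto its image. All other factors
  have exponent 0 or are constant along \<open>V'\<close>, so both sides agree, with constant
  1.\<close>

lemma BL_finite_single:
  assumes "subspace V" "subspace V'" "V \<subseteq> V'" and i: "s $ i = 1"
    and di: "dim (span (V' \<union> K i)) + dim V = dim (span (V \<union> K i)) + dim V'"
    and others: "\<And>j. j \<noteq> i \<Longrightarrow> s $ j = 0 \<or> dim (span (V' \<union> K j)) = dim (span (V \<union> K j))"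
  shows "BL_finite K V V' s"
proof -
  obtain cs ds where b: "BL_bases K V V' cs ds"
    using BL_bases_exist[OF assms(1-3)] by blast
  have sub: "span (V \<union> K j) \<subseteq> span (V' \<union> K j)" for j
    using assms(3) by (intro span_mono) auto
  have cs: "span (V \<union> set cs) = V'" "dim V' = dim V + length cs"
    using b by (auto simp: BL_bases_def basis_mod_def)
  \<comment> \<open>The dimension equation lets the basis of the domain double as a basis of the
    \<open>i\<close>-th target.\<close>
  have "basis_mod (span (V \<union> K i)) cs (span (V' \<union> K i))"
    unfolding basis_mod_def
  proof
    have "span (span (V \<union> K i) \<union> set cs) = span (span (V \<union> set cs) \<union> K i)"
      unfolding span_span_Un by (simp add: Un_ac)
    then show "span (span (V \<union> K i) \<union> set cs) = span (V' \<union> K i)"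
      using cs by simp
  qed (use cs di in simp)
  then have b': "BL_bases K V V' cs (ds(i := cs))"
    using b by (auto simp: BL_bases_def)
  have "BL_bound_const K V s cs (ds(i := cs)) 1"
    unfolding BL_bound_const_def
  proof (intro allI impI)
    fix g x assume g: "admissible K V g"
    let ?h = "\<lambda>x. \<Prod>j\<in>UNIV - {i}. epow (g j x) (s $ j)"
    have split: "(\<Prod>j\<in>UNIV. f j) = f i * (\<Prod>j\<in>UNIV - {i}. f j)" for f :: "_ \<Rightarrow> ennreal"
      by (rule prod.remove) auto
    \<comment> \<open>Equal dimensions make the \<open>j\<close>-th target trivial: there is nothing
      to integrate, and \<open>g j\<close> is already invariant under \<open>V'\<close>.\<close>
    have jj: "s $ j = 0 \<or> (invariant_under V' (g j) \<and> ds j = [])" if "j \<noteq> i" for j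
    proof (cases "s $ j = 0")
      case False
      then have d: "dim (span (V' \<union> K j)) = dim (span (V \<union> K j))"
        using others[OF that] by simp
      then have "span (V \<union> K j) = span (V' \<union> K j)"
        using sub subspace_dim_equal[OF subspace_span subspace_span] by (metis order_refl)
      then have "invariant_under V' (g j)"
        using g unfolding admissible_def by (metis invariant_under_mono le_sup_iff span_superset)
      moreover have "ds j = []"
        using b d by (auto simp: BL_bases_def basis_mod_def)
      ultimately show ?thesis by simp
    qed simp
    have "invariant_under (span (set cs)) ?h"
      unfolding invariant_under_def
    proof (intro ballI allI prod.cong refl)
      fix u x j assume u: "u \<in> span (set cs)" and j: "j \<in> UNIV - {i}"
      have "u \<in> V'" using u cs(1) span_mono[of "set cs" "V \<union> set cs"] by auto
      then show "epow (g j (x + u)) (s $ j) = epow (g j x) (s $ j)"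
        using jj[of j] j by (auto simp: invariant_under_def)
    qed
    moreover have gi: "g i \<in> borel_measurable borel"
      using g by (simp add: admissible_def)
    ultimately have "span_int cs (\<lambda>x. ?h x * g i x) x = ?h x * span_int cs (g i) x"
      by (simp add: span_int_invariant_mult)
    moreover have "?h x = (\<Prod>j\<in>UNIV - {i}. epow (span_int (ds j) (g j) x) (s $ j))"
      using jj by (intro prod.cong) fastforce+
    moreover have "(\<lambda>x. \<Prod>j\<in>UNIV. epow (g j x) (s $ j)) = (\<lambda>x. ?h x * g i x)"
      using i by (auto simp: split mult.commute)
    ultimately show "span_int cs (\<lambda>x. \<Prod>j\<in>UNIV. epow (g j x) (s $ j)) x
       \<le> ennreal 1 * (\<Prod>j\<in>UNIV. epow (span_int ((ds(i := cs)) j) (g j) x) (s $ j))"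
      using i by (simp add: split mult.commute)
  qed
  then show ?thesis
    using b' unfolding BL_finite_def by blast
qed

lemma BL_finite_refl:
  assumes "subspace V"
  shows "BL_finite K V V s"
proof -
  have "BL_bases K V V [] (\<lambda>_. [])"
    using assms by (simp add: BL_bases_def basis_mod_Nil)
  moreover have "BL_bound_const K V s [] (\<lambda>_. []) 1"
    by (simp add: BL_bound_const_def)
  ultimately show ?thesis
    unfolding BL_finite_def by blast
qed

text \<open>By homogeneity each \<open>g j\<close> with a finite integral at the given base point
  can be scaled to integral 1 there. The product with exponents \<open>s\<close> is then pointwise
  at most the sum over the generators, each of which contributes at most its own constant.\<close>

lemma BL_finite_hull:
  fixes s :: "real^'n::finite"
  assumes "subspace V" "subspace V'" "V \<subseteq> V'"
    and S: "finite S" "s \<in> convex hull S" "\<And>v j. v \<in> S \<Longrightarrow> 0 \<le> v $ j"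
    and fin: "\<And>v. v \<in> S \<Longrightarrow> BL_finite K V V' v"
  shows "BL_finite K V V' s"
proof -
  obtain cs ds where b: "BL_bases K V V' cs ds"
    using BL_bases_exist[OF assms(1-3)] by blast
  obtain C where C: "\<And>v. v \<in> S \<Longrightarrow> C v \<ge> 0" "\<And>v. v \<in> S \<Longrightarrow> BL_bound_const K V v cs ds (C v)"
    using BL_finiteD[OF fin assms(1) b] by metis
  have "s $ j \<ge> 0" for j
  proof -
    have "convex hull S \<subseteq> {v. axis j 1 \<bullet> v \<ge> 0}"
      using S(3) by (intro hull_minimal convex_halfspace_ge) (auto simp: inner_axis')
    then show ?thesis using S(2) by (auto simp: inner_axis')
  qed
  let ?T = "{v\<in>S. \<forall>j. s $ j = 0 \<longrightarrow> v $ j = 0}"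
  have T: "finite ?T" "s \<in> convex hull ?T"
    using S convex_hull_face_nonneg by auto
  \<comment> \<open>The summand 1 makes the constant positive, so that its product with an infinite
    right-hand side is infinite.\<close>
  let ?C = "(\<Sum>v\<in>S. C v) + 1"
  have "?C > 0" using C(1) by (simp add: add_nonneg_pos sum_nonneg)
  have "BL_bound_const K V s cs ds ?C"
    unfolding BL_bound_const_def
  proof (intro allI impI)
    fix g x assume g: "admissible K V g"
    let ?F = "\<lambda>x. \<Prod>j\<in>UNIV. epow (g j x) (s $ j)"
    let ?G = "\<lambda>j. span_int (ds j) (g j) x"
    have gj: "g j \<in> borel_measurable borel" "0 < g j x" "invariant_under (span (V \<union> K j)) (g j)" for j x
      using g by (auto simp: admissible_def)
    have G: "0 < ?G j" for j
      by (rule span_int_pos[OF gj(1,2)])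
    show "span_int cs ?F x \<le> ennreal ?C * (\<Prod>j\<in>UNIV. epow (?G j) (s $ j))"
    proof (cases "\<exists>j. ?G j = \<infinity> \<and> s $ j \<noteq> 0")
      case True
      then obtain j where j: "?G j = \<infinity>" "s $ j \<noteq> 0" by auto
      have "(\<Prod>j\<in>UNIV. epow (?G j) (s $ j)) = \<infinity>"
        using j by (intro prod_eq_top_ennreal[of _ j] epow_pos G) (auto simp: epow_def)
      then show ?thesis
        using \<open>?C > 0\<close> by (simp add: ennreal_mult_top)
    next
      case False
      \<comment> \<open>An infinite integral has exponent 0 in \<open>s\<close> here, hence in all
        of \<open>?T\<close>, so that factor is left unscaled.\<close>
      let ?r = "\<lambda>j. if ?G j = \<infinity> then 1 else enn2real (?G j)"
      have r: "0 < ?r j" for j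
        using G[of j] by (cases "?G j") auto
      let ?c = "\<lambda>j. 1 / ?r j"
      have c: "0 < ?c j" for j using r[of j] by (simp only: zero_less_divide_1_iff)
      let ?g = "\<lambda>j x. ennreal (?c j) * g j x"
      have g': "admissible K V ?g"
        unfolding admissible_def
      proof (intro allI conjI)
        fix j
        note gj(1)[of j, measurable]
        show "?g j \<in> borel_measurable borel" by measurable
        show "0 < ?g j x" for x
          using gj(2) c by (simp add: ennreal_zero_less_mult_iff del: zero_less_divide_1_iff)
        show "invariant_under (span (V \<union> K j)) (?g j)"
          using gj(3)[of j] by (simp add: invariant_under_def)
      qed
      have Gr: "epow (span_int (ds j) (?g j) x) (v $ j) = 1" if v: "v \<in> ?T" for j v
      proof (cases "?G j = \<infinity>")
        case True
        then have "v $ j = 0" using False v by auto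
        then show ?thesis by simp
      next
        case fin: False
        have "span_int (ds j) (?g j) x = ennreal (?c j) * ?G j"
          by (simp add: span_int_cmult[OF gj(1)])
        also have "\<dots> = 1"
          using fin G[of j] by (cases "?G j") (auto simp flip: ennreal_mult)
        finally show ?thesis by (simp add: epow_def)
      qed
      have Fr: "ennreal (\<Prod>j\<in>UNIV. ?r j powr s $ j) = (\<Prod>j\<in>UNIV. epow (?G j) (s $ j))"
      proof -
        have "epow (?G j) (s $ j) = ennreal (?r j powr s $ j)" for j
        proof (cases "?G j = \<infinity>")
          case True
          then show ?thesis using False by auto
        next
          case fin: False
          then show ?thesis using r[of j] by (auto simp: epow_def)
        qed
        then show ?thesis by (simp add: prod_ennreal)
      qed
      let ?P = "\<Prod>j\<in>UNIV. ?c j powr s $ j" and ?R = "\<Prod>j\<in>UNIV. ?r j powr s $ j"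
      have PR: "?R * ?P = 1"
        unfolding prod.distrib[symmetric]
      proof (rule prod.neutral, rule ballI)
        fix j
        show "?r j powr s $ j * ?c j powr s $ j = 1"
          using r[of j] by (simp only: powr_mult[symmetric]) (simp only: powr_one_eq_one
            times_divide_eq_right mult_1_right divide_self less_imp_neq[symmetric] not_False_eq_True)
      qed
      have P0: "0 \<le> ?P" "0 \<le> ?R" by (intro prod_nonneg; simp)+
      have "ennreal ?P * span_int cs ?F x = span_int cs (\<lambda>x. ennreal ?P * ?F x) x"
        by (simp only: span_int_cmult[OF admissible_prod_measurable[OF g]])
      also have "(\<lambda>x. ennreal ?P * ?F x) = (\<lambda>x. \<Prod>j\<in>UNIV. epow (?g j x) (s $ j))"
        by (rule ext, rule prod_epow_mult[OF c, symmetric])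
      also have "span_int cs \<dots> x \<le> span_int cs (\<lambda>x. \<Sum>v\<in>?T. \<Prod>j\<in>UNIV. epow (?g j x) (v $ j)) x"
      proof (rule span_int_mono, rule prod_epow_le_sum_hull[OF T])
        show "0 < ?g j x" for j x
          using g' unfolding admissible_def by blast
      qed (use S(3) in blast)
      also have "\<dots> = (\<Sum>v\<in>?T. span_int cs (\<lambda>x. \<Prod>j\<in>UNIV. epow (?g j x) (v $ j)) x)"
        by (subst span_int_sum[OF T(1) admissible_prod_measurable[OF g']]) simp
      also have "\<dots> \<le> (\<Sum>v\<in>?T. ennreal (C v) * (\<Prod>j\<in>UNIV. epow (span_int (ds j) (?g j) x) (v $ j)))"
        using C(2) g' unfolding BL_bound_const_def by (intro sum_mono) auto
      also have "\<dots> = (\<Sum>v\<in>?T. ennreal (C v))"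
        using Gr by (intro sum.cong refl) simp
      also have "\<dots> \<le> (\<Sum>v\<in>S. ennreal (C v))"
        using S(1) by (intro sum_mono2) auto
      also have "\<dots> = ennreal (\<Sum>v\<in>S. C v)"
        using C(1) by (simp add: sum_ennreal)
      also have "\<dots> \<le> ennreal ?C" by (intro ennreal_leI) simp
      finally have le: "ennreal ?P * span_int cs ?F x \<le> ennreal ?C" .
      have "span_int cs ?F x = ennreal ?R * (ennreal ?P * span_int cs ?F x)"
        using PR P0 by (simp only: mult.assoc[symmetric] ennreal_mult[symmetric] ennreal_1 mult_1_left)
      also have "\<dots> \<le> ennreal ?R * ennreal ?C"
        by (intro mult_left_mono le) auto
      also have "\<dots> = ennreal ?C * (\<Prod>j\<in>UNIV. epow (?G j) (s $ j))"
        by (simp only: Fr mult.commute)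
      finally show ?thesis .
    qed
  qed
  then show ?thesis
    using b unfolding BL_finite_def by blast
qed

section \<open>Finiteness over the polytope\<close>

text \<open>For \<open>V\<close> contained in \<open>W\<close>, this is the dimension of the image
  of \<open>W/V\<close> under the \<open>j\<close>-th induced map, that is, of
  \<open>W + K j\<close> modulo \<open>V + K j\<close>.\<close>

definition quot_dim :: "('n \<Rightarrow> 'a::euclidean_space set) \<Rightarrow> 'a set \<Rightarrow> 'n \<Rightarrow> 'a set \<Rightarrow> real" where
  "quot_dim K V j W = real (dim (span (W \<union> K j))) - real (dim (span (V \<union> K j)))"

text \<open>The HBL polytope of the maps induced on \<open>V'/V\<close>.\<close>

definition BL_polytope ::
  "('n::finite \<Rightarrow> 'a::euclidean_space set) \<Rightarrow> 'a set \<Rightarrow> 'a set \<Rightarrow> (real^'n) set" where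
  "BL_polytope K V V' = {s. (\<forall>j. 0 \<le> s $ j \<and> s $ j \<le> 1) \<and>
     real (dim V') - real (dim V) = (\<Sum>j\<in>UNIV. s $ j * quot_dim K V j V') \<and>
     (\<forall>W. subspace W \<longrightarrow> V \<subseteq> W \<longrightarrow> W \<subseteq> V' \<longrightarrow>
        real (dim W) - real (dim V) \<le> (\<Sum>j\<in>UNIV. s $ j * quot_dim K V j W))}"

definition no_critical_subspace ::
  "('n::finite \<Rightarrow> 'a::euclidean_space set) \<Rightarrow> 'a set \<Rightarrow> 'a set \<Rightarrow> real^'n \<Rightarrow> bool" where
  "no_critical_subspace K V V' s \<longleftrightarrow> (\<forall>W. subspace W \<longrightarrow> V \<subseteq> W \<longrightarrow> W \<subseteq> V' \<longrightarrow>
     real (dim W) - real (dim V) = (\<Sum>j\<in>UNIV. s $ j * quot_dim K V j W) \<longrightarrow> W = V \<or> W = V')"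

text \<open>The inequalities range over infinitely many subspaces but see only dimensions, so
  finitely many different ones remain. Both the polyhedrality and the uniform radius of perturbation
  rest on this.\<close>

lemma finite_dim_profiles:
  fixes K :: "'n::finite \<Rightarrow> 'a::euclidean_space set"
  shows "finite ((\<lambda>W. (dim W, \<lambda>j. dim (span (W \<union> K j)))) ` A)"
proof (rule finite_subset)
  show "(\<lambda>W. (dim W, \<lambda>j. dim (span (W \<union> K j)))) ` A
      \<subseteq> {..DIM('a)} \<times> (UNIV \<rightarrow>\<^sub>E {..DIM('a)})"
    using dim_subset_UNIV by (auto simp del: dim_span)
  show "finite ({..DIM('a)} \<times> ((UNIV :: 'n set) \<rightarrow>\<^sub>E {..DIM('a)}))"
    by (intro finite_cartesian_product finite_PiE) auto
qed

lemma polyhedron_BL_polytope: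
  fixes K :: "'n::finite \<Rightarrow> 'a::euclidean_space set"
  shows "polyhedron (BL_polytope K V V')"
proof -
  let ?pr = "\<lambda>W. (dim W, \<lambda>j. dim (span (W \<union> K j)))"
  define vec :: "('n \<Rightarrow> nat) \<Rightarrow> real^'n"
    where "vec f = (\<chi> j. real (f j) - real (dim (span (V \<union> K j))))" for f
  define h where "h p = {s. vec (snd p) \<bullet> s \<ge> real (fst p) - real (dim V)}" for p :: "nat \<times> ('n \<Rightarrow> nat)"
  have vec: "vec (\<lambda>j. dim (span (W \<union> K j))) \<bullet> s = (\<Sum>j\<in>UNIV. s $ j * quot_dim K V j W)" for W s
    by (simp add: vec_def inner_vec_def quot_dim_def mult.commute)
  have "BL_polytope K V V' = (\<Inter>j. {s. axis j 1 \<bullet> s \<ge> 0}) \<inter> (\<Inter>j. {s. axis j 1 \<bullet> s \<le> 1})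
      \<inter> {s. vec (\<lambda>j. dim (span (V' \<union> K j))) \<bullet> s = real (dim V') - real (dim V)}
      \<inter> \<Inter>(h ` ?pr ` {W. subspace W \<and> V \<subseteq> W \<and> W \<subseteq> V'})"
    unfolding BL_polytope_def h_def by (auto simp: vec inner_axis' simp del: dim_span)
  also have "polyhedron \<dots>"
    by (intro polyhedron_Int polyhedron_Inter finite_imageI finite_dim_profiles)
       (auto simp: h_def polyhedron_halfspace_le polyhedron_halfspace_ge polyhedron_hyperplane)
  finally show ?thesis .
qed

lemma compact_BL_polytope: "compact (BL_polytope K V V')"
proof -
  have "BL_polytope K V V' \<subseteq> cbox 0 1"
    by (auto simp: BL_polytope_def mem_box_cart)
  then have "bounded (BL_polytope K V V')"
    using bounded_cbox bounded_subset by blast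
  then show ?thesis
    using polyhedron_imp_closed[OF polyhedron_BL_polytope] by (auto simp: compact_eq_bounded_closed)
qed

lemma BL_polytope_eq_hull_extreme_points:
  "BL_polytope K V V' = convex hull {x. x extreme_point_of BL_polytope K V V'}"
  by (rule Krein_Milman_Minkowski[OF compact_BL_polytope polyhedron_imp_convex[OF polyhedron_BL_polytope]])

lemma finite_extreme_points_BL_polytope: "finite {x. x extreme_point_of BL_polytope K V V'}"
  by (rule finite_polyhedron_extreme_points[OF polyhedron_BL_polytope])

lemma quot_dim_nonneg: "V \<subseteq> W \<Longrightarrow> 0 \<le> quot_dim K V j W"
  unfolding quot_dim_def using dim_subset[OF span_mono[of "V \<union> K j" "W \<union> K j"]] by fastforce

lemma quot_dim_mono: "W \<subseteq> W' \<Longrightarrow> quot_dim K V j W \<le> quot_dim K V j W'"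
  unfolding quot_dim_def using dim_subset[OF span_mono[of "W \<union> K j" "W' \<union> K j"]] by fastforce

lemma quot_dim_diff: "quot_dim K W j W' = quot_dim K V j W' - quot_dim K V j W"
  by (simp add: quot_dim_def)

lemma dim_span_Un_Int:
  fixes S T :: "'a::euclidean_space set"
  assumes "subspace S" "subspace T"
  shows "dim (span (S \<union> T)) + dim (S \<inter> T) = dim S + dim T"
proof -
  have "span (S \<union> T) = {x + y |x y. x \<in> S \<and> y \<in> T}"
    using assms by (simp add: span_Un span_eq_iff[THEN iffD2] Bex_def) 
  then show ?thesis
    using dim_sums_Int[OF assms] by simp
qed

text \<open>\<open>?W\<close> modulo \<open>V\<close> is the kernel of the \<open>i\<close>-th
  induced map. If \<open>s $ i = 1\<close>, the scaling identity forces equality in the inequality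
  for \<open>?W\<close>. Without critical subspaces the kernel is then trivial, so the
  \<open>i\<close>-th map alone accounts for the whole dimension and leaves nothing to the other
  terms.\<close>

lemma BL_finite_if_coordinate_1:
  assumes V: "subspace V" "subspace V'" "V \<subseteq> V'"
    and s: "s \<in> BL_polytope K V V'"
    and nocrit: "no_critical_subspace K V V' s"
    and i: "quot_dim K V i V' > 0"
  shows "quot_dim K V i V' \<le> real (dim V') - real (dim V)"
    and "s $ i = 1 \<Longrightarrow> BL_finite K V V' s"
proof -
  let ?W = "V' \<inter> span (V \<union> K i)"
  let ?d = "\<lambda>j. quot_dim K V j V'"
  have W: "subspace ?W" "V \<subseteq> ?W" "?W \<subseteq> V'"
    using V by (auto intro: subspace_inter span_base)
  have s01: "0 \<le> s $ j" for j using s by (auto simp: BL_polytope_def)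
  have "span (V' \<union> span (V \<union> K i)) = span (V' \<union> K i)"
    using V(3) by (simp add: span_Un_span Un_assoc[symmetric] sup.absorb1)
  then have "dim (span (V' \<union> K i)) + dim ?W = dim V' + dim (span (V \<union> K i))"
    using dim_span_Un_Int[OF V(2) subspace_span, of "V \<union> K i"] by simp
  then have dW: "real (dim ?W) - real (dim V) = real (dim V') - real (dim V) - ?d i"
    unfolding quot_dim_def by linarith
  moreover have "dim V \<le> dim ?W" by (rule dim_subset[OF W(2)])
  ultimately show le: "?d i \<le> real (dim V') - real (dim V)" by linarith
  have split: "(\<Sum>j\<in>UNIV. f j) = f i + (\<Sum>j\<in>UNIV - {i}. f j)" for f :: "_ \<Rightarrow> real"
    by (rule sum.remove) auto
  have "span (?W \<union> K i) = span (V \<union> K i)"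
    using W(2) by (intro subset_antisym span_minimal span_mono subspace_span) (auto intro: span_base)
  then have q0: "quot_dim K V i ?W = 0" by (simp add: quot_dim_def)
  assume si: "s $ i = 1"
  have "(\<Sum>j\<in>UNIV. s $ j * quot_dim K V j ?W) = (\<Sum>j\<in>UNIV - {i}. s $ j * quot_dim K V j ?W)"
    by (simp add: split q0)
  also have "\<dots> \<le> (\<Sum>j\<in>UNIV - {i}. s $ j * ?d j)"
    using s01 by (intro sum_mono mult_left_mono quot_dim_mono) auto
  also have "\<dots> = real (dim V') - real (dim V) - ?d i"
    using s si by (simp add: BL_polytope_def split)
  finally have "(\<Sum>j\<in>UNIV. s $ j * quot_dim K V j ?W) \<le> real (dim ?W) - real (dim V)"
    using dW by simp
  moreover have "real (dim ?W) - real (dim V) \<le> (\<Sum>j\<in>UNIV. s $ j * quot_dim K V j ?W)"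
    using s W unfolding BL_polytope_def by blast
  ultimately have "?W = V \<or> ?W = V'"
    using nocrit W unfolding no_critical_subspace_def by (metis order_antisym)
  moreover have "?W \<noteq> V'"
  proof
    assume eq: "?W = V'"
    show False using dW i unfolding eq by simp
  qed
  ultimately have WV: "?W = V"
    by simp
  then have D: "?d i = real (dim V') - real (dim V)"
    using dW unfolding WV by simp
  have "(\<Sum>j\<in>UNIV - {i}. s $ j * ?d j) = 0"
    using s si D by (simp add: BL_polytope_def split)
  then have others: "s $ j * ?d j = 0" if "j \<noteq> i" for j
    using that mult_nonneg_nonneg[OF s01 quot_dim_nonneg[OF V(3)]]
    by (subst (asm) sum_nonneg_eq_0_iff) (auto simp del: mult_eq_0_iff)
  show "BL_finite K V V' s"
  proof (rule BL_finite_single[OF V si])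
    show "dim (span (V' \<union> K i)) + dim V = dim (span (V \<union> K i)) + dim V'"
      using D unfolding quot_dim_def by linarith
    show "s $ j = 0 \<or> dim (span (V' \<union> K j)) = dim (span (V \<union> K j))" if "j \<noteq> i" for j
      using others[OF that] by (auto simp: quot_dim_def)
  qed
qed

text \<open>Without critical subspaces, all inequalities except those for \<open>V\<close> and
  \<open>V'\<close> are strict at \<open>s\<close>. The first assumption on \<open>u\<close>
  preserves the scaling identity, the second leaves room in the moving coordinates.\<close>

lemma BL_polytope_perturb:
  fixes K :: "'n::finite \<Rightarrow> 'a::euclidean_space set"
  assumes V: "subspace V" "subspace V'" "V \<subseteq> V'"
    and s: "s \<in> BL_polytope K V V'"
    and nocrit: "no_critical_subspace K V V' s"
    and u: "(\<Sum>j\<in>UNIV. u $ j * quot_dim K V j V') = 0"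
    and u0: "\<And>j. u $ j \<noteq> 0 \<Longrightarrow> 0 < s $ j \<and> s $ j < 1"
  shows "\<exists>\<epsilon>>0. \<forall>e. \<bar>e\<bar> \<le> \<epsilon> \<longrightarrow> s + e *\<^sub>R u \<in> BL_polytope K V V'"
proof -
  let ?pr = "\<lambda>W. (dim W, \<lambda>j. dim (span (W \<union> K j)))"
  let ?A = "{W. subspace W \<and> V \<subseteq> W \<and> W \<subseteq> V' \<and> W \<noteq> V \<and> W \<noteq> V'}"
  \<comment> \<open>\<open>F p e\<close> is the slack, at \<open>s + e *\<^sub>R u\<close>, of the
    inequality with dimension data \<open>p\<close>.\<close>
  define F :: "nat \<times> ('n \<Rightarrow> nat) \<Rightarrow> real \<Rightarrow> real" where
    "F p e = (\<Sum>j\<in>UNIV. (s $ j + e * u $ j) * (real (snd p j) - real (dim (span (V \<union> K j)))))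
       - (real (fst p) - real (dim V))" for p e
  have F: "F (?pr W) e = (\<Sum>j\<in>UNIV. (s + e *\<^sub>R u) $ j * quot_dim K V j W)
      - (real (dim W) - real (dim V))" for W e
    by (simp add: F_def quot_dim_def)
  have ev1: "eventually (\<lambda>e. F p e > 0) (nhds 0)" if p: "p \<in> ?pr ` ?A" for p
  proof -
    obtain W where W: "W \<in> ?A" "p = ?pr W" using p by blast
    have "real (dim W) - real (dim V) \<le> (\<Sum>j\<in>UNIV. s $ j * quot_dim K V j W)"
      using s W unfolding BL_polytope_def by blast
    moreover have "real (dim W) - real (dim V) \<noteq> (\<Sum>j\<in>UNIV. s $ j * quot_dim K V j W)"
      using nocrit W unfolding no_critical_subspace_def by blast
    ultimately have "F p 0 > 0"
      unfolding W(2) F by simp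
    moreover have "isCont (F p) 0"
      unfolding F_def by (intro continuous_intros)
    ultimately show ?thesis
      by (metis order_tendstoD(1) tendsto_at_iff_tendsto_nhds isCont_def)
  qed
  have ev2: "eventually (\<lambda>e. 0 \<le> s $ j + e * u $ j \<and> s $ j + e * u $ j \<le> 1) (nhds 0)" for j
  proof (cases "u $ j = 0")
    case True
    then show ?thesis using s by (auto simp: BL_polytope_def)
  next
    case False
    have "isCont (\<lambda>e. s $ j + e * u $ j) 0" by (intro continuous_intros)
    then have "((\<lambda>e. s $ j + e * u $ j) \<longlongrightarrow> s $ j) (nhds 0)"
      using tendsto_at_iff_tendsto_nhds[of "\<lambda>e. s $ j + e * u $ j" 0] by (simp add: isCont_def)
    from order_tendstoD[OF this] u0[OF False]
    have "eventually (\<lambda>e. 0 < s $ j + e * u $ j) (nhds 0)" "eventually (\<lambda>e. s $ j + e * u $ j < 1) (nhds 0)"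
      by auto
    then show ?thesis by eventually_elim auto
  qed
  \<comment> \<open>Finitely many profiles share one neighbourhood of 0.\<close>
  have "eventually (\<lambda>e. \<forall>p\<in>?pr ` ?A. F p e > 0) (nhds 0)"
    by (rule eventually_ball_finite[OF finite_dim_profiles]) (use ev1 in blast)
  moreover have "eventually (\<lambda>e. \<forall>j. 0 \<le> s $ j + e * u $ j \<and> s $ j + e * u $ j \<le> 1) (nhds 0)"
    by (rule eventually_all_finite) (rule ev2)
  ultimately have "eventually (\<lambda>e. s + e *\<^sub>R u \<in> BL_polytope K V V') (nhds 0)"
  proof eventually_elim
    case (elim e)
    have eqV': "(\<Sum>j\<in>UNIV. (s + e *\<^sub>R u) $ j * quot_dim K V j V') = real (dim V') - real (dim V)"
      using s u by (simp add: BL_polytope_def algebra_simps sum.distrib flip: sum_distrib_left)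
    have "real (dim W) - real (dim V) \<le> (\<Sum>j\<in>UNIV. (s + e *\<^sub>R u) $ j * quot_dim K V j W)"
      if W: "subspace W" "V \<subseteq> W" "W \<subseteq> V'" for W
    proof (cases "W = V \<or> W = V'")
      case True
      then show ?thesis
      proof
        assume "W = V"
        then show ?thesis by (simp add: quot_dim_def)
      next
        assume "W = V'"
        then show ?thesis by (simp only: eqV')
      qed
    next
      case False
      then have "F (?pr W) e > 0" using elim(1) W by blast
      then show ?thesis by (simp only: F)
    qed
    then show ?case
      using elim(2) eqV' unfolding BL_polytope_def by auto
  qed
  then obtain \<epsilon> where "\<epsilon> > 0" "\<And>e. dist e 0 < \<epsilon> \<Longrightarrow> s + e *\<^sub>R u \<in> BL_polytope K V V'"
    unfolding eventually_nhds_metric by auto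
  then show ?thesis
    by (intro exI[of _ "\<epsilon> / 2"]) auto
qed

text \<open>If no coordinate with positive quotient dimension equals 1, then at least two contribute
  to the scaling identity, since a single one would fall short of the dimension. These two can be
  traded against each other in both directions, which contradicts extremality.\<close>

lemma BL_finite_extreme_point:
  assumes V: "subspace V" "subspace V'" "V \<subseteq> V'" "V \<noteq> V'"
    and ext: "s extreme_point_of BL_polytope K V V'"
    and nocrit: "no_critical_subspace K V V' s"
  shows "BL_finite K V V' s"
proof (rule ccontr)
  assume no: "\<not> BL_finite K V V' s"
  let ?d = "\<lambda>j. quot_dim K V j V'"
  have s: "s \<in> BL_polytope K V V'" using ext by (simp add: extreme_point_of_def)
  have s01: "0 \<le> s $ j" "s $ j \<le> 1" for j using s by (auto simp: BL_polytope_def)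
  have d0: "0 \<le> ?d j" for j by (rule quot_dim_nonneg[OF V(3)])
  have D: "dim V < dim V'"
    using V subspace_dim_equal dim_subset by (metis not_le)
  have eq: "(\<Sum>j\<in>UNIV. s $ j * ?d j) = real (dim V') - real (dim V)"
    using s by (simp add: BL_polytope_def)
  note coord = BL_finite_if_coordinate_1[OF V(1-3) s nocrit]
  have lt1: "s $ j < 1" if "?d j > 0" for j
  proof (rule ccontr)
    assume "\<not> s $ j < 1"
    then have "s $ j = 1" using s01(2)[of j] by simp
    then show False using coord(2)[OF that] no by simp
  qed
  obtain i where i: "s $ i * ?d i > 0"
  proof (rule ccontr)
    assume "\<not> thesis"
    then have "(\<Sum>j\<in>UNIV. s $ j * ?d j) \<le> 0"
      using that by (intro sum_nonpos) (meson not_le)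
    then show False using eq D by simp
  qed
  then have i': "s $ i > 0" "?d i > 0" using s01(1)[of i] d0[of i] by (auto simp: zero_less_mult_iff)
  obtain k where k: "s $ k * ?d k > 0" "k \<noteq> i"
  proof (rule ccontr)
    assume *: "\<not> thesis"
    have "(\<Sum>j\<in>UNIV. s $ j * ?d j) = s $ i * ?d i + (\<Sum>j\<in>UNIV - {i}. s $ j * ?d j)"
      by (rule sum.remove) auto
    also have "(\<Sum>j\<in>UNIV - {i}. s $ j * ?d j) \<le> 0"
      using that * by (intro sum_nonpos) (metis DiffD2 not_le singletonI)
    also have "s $ i * ?d i < ?d i" using lt1[OF i'(2)] i' by simp
    also have "?d i \<le> real (dim V') - real (dim V)" by (rule coord(1)) (use i' in auto)
    finally show False using eq by simp
  qed
  then have k': "s $ k > 0" "?d k > 0" using s01(1)[of k] d0[of k] by (auto simp: zero_less_mult_iff)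
  \<comment> \<open>The coefficients are chosen so that moving along \<open>u\<close> preserves the
    scaling identity.\<close>
  define u where "u = ?d k *\<^sub>R axis i 1 - ?d i *\<^sub>R (axis k 1 :: real^_)"
  have u_nth: "u $ j = (if j = i then ?d k else if j = k then - ?d i else 0)" for j
    using k(2) by (auto simp: u_def axis_def)
  have "(\<Sum>j\<in>UNIV. u $ j * ?d j)
      = (\<Sum>j\<in>UNIV. ?d k * (if j = i then ?d j else 0) - ?d i * (if j = k then ?d j else 0))"
    using k(2) by (intro sum.cong) (auto simp: u_nth)
  also have "\<dots> = 0"
    by (simp add: sum_subtractf flip: sum_distrib_left)
  finally have "(\<Sum>j\<in>UNIV. u $ j * ?d j) = 0" .
  moreover have "0 < s $ j \<and> s $ j < 1" if "u $ j \<noteq> 0" for j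
    using that i' k' lt1 by (auto simp: u_nth split: if_splits)
  ultimately obtain e where e: "e > 0" "\<And>r. \<bar>r\<bar> \<le> e \<Longrightarrow> s + r *\<^sub>R u \<in> BL_polytope K V V'"
    using BL_polytope_perturb[OF V(1-3) s nocrit] by metis
  have "u \<noteq> 0" using k'(2) u_nth[of i] by auto
  then have ne: "s + e *\<^sub>R u \<noteq> s + (- e) *\<^sub>R u"
    unfolding add_left_cancel scaleR_cancel_right using e(1) by simp
  have "midpoint (s + e *\<^sub>R u) (s + (- e) *\<^sub>R u) = s"
    by (simp add: midpoint_def scaleR_2[symmetric])
  then have "s \<in> open_segment (s + e *\<^sub>R u) (s + (- e) *\<^sub>R u)"
    using ne midpoint_in_open_segment by metis
  then show False
    using ext e(2)[of e] e(2)[of "- e"] e(1) unfolding extreme_point_of_def by auto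
qed

theorem BL_finite_polytope:
  assumes "subspace V" "subspace V'" "V \<subseteq> V'" "s \<in> BL_polytope K V V'"
  shows "BL_finite K V V' s"
  using assms
proof (induction "dim V' - dim V" arbitrary: V V' s rule: less_induct)
  case less
  note V = less.prems(1-3)
  show ?case
  proof (cases "V = V'")
    case True
    then show ?thesis using BL_finite_refl V(1) by blast
  next
    case VV': False
    show ?thesis
    proof (rule BL_finite_hull[OF V finite_extreme_points_BL_polytope])
      show "s \<in> convex hull {x. x extreme_point_of BL_polytope K V V'}"
        using less.prems(4) BL_polytope_eq_hull_extreme_points by blast
      fix v assume v: "v \<in> {x. x extreme_point_of BL_polytope K V V'}"
      then have vP: "v \<in> BL_polytope K V V'" by (simp add: extreme_point_of_def)
      then show "0 \<le> v $ j" for j by (auto simp: BL_polytope_def)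
      show "BL_finite K V V' v"
      proof (cases "\<exists>W. subspace W \<and> V \<subseteq> W \<and> W \<subseteq> V' \<and> W \<noteq> V \<and> W \<noteq> V' \<and>
          real (dim W) - real (dim V) = (\<Sum>j\<in>UNIV. v $ j * quot_dim K V j W)")
        case False
        then show ?thesis
          using v unfolding no_critical_subspace_def[symmetric]
          by (intro BL_finite_extreme_point[OF V VV']) (auto simp: no_critical_subspace_def)
      next
        case True
        then obtain W where W: "subspace W" "V \<subseteq> W" "W \<subseteq> V'" "W \<noteq> V" "W \<noteq> V'"
          and crit: "real (dim W) - real (dim V) = (\<Sum>j\<in>UNIV. v $ j * quot_dim K V j W)"
          by blast
        have dims: "dim V < dim W" "dim W < dim V'"
          using V W subspace_dim_equal dim_subset by (metis not_le)+
        have "v \<in> BL_polytope K V W"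
          using vP crit W unfolding BL_polytope_def by auto
        then have "BL_finite K V W v"
          using dims by (intro less.hyps V W) auto
        moreover have "v \<in> BL_polytope K W V'"
        proof -
          \<comment> \<open>Subtracting the equality at the critical \<open>W\<close> from the
            inequalities relative to \<open>V\<close> gives those relative to
            \<open>W\<close>.\<close>
          have "(\<Sum>j\<in>UNIV. v $ j * quot_dim K W j W')
              = (\<Sum>j\<in>UNIV. v $ j * quot_dim K V j W') - (real (dim W) - real (dim V))" for W'
            unfolding crit quot_dim_diff[of K W _ W' V] by (simp add: right_diff_distrib sum_subtractf)
          moreover have "real (dim W') \<le> (\<Sum>j\<in>UNIV. v $ j * quot_dim K V j W') + real (dim V)"
            if "subspace W'" "W \<subseteq> W'" "W' \<subseteq> V'" for W'
          proof -
            have "real (dim W') - real (dim V) \<le> (\<Sum>j\<in>UNIV. v $ j * quot_dim K V j W')"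
              using vP that W(2) unfolding BL_polytope_def by blast
            then show ?thesis by simp
          qed
          ultimately show ?thesis
            using vP unfolding BL_polytope_def by simp
        qed
        then have "BL_finite K W V' v"
          using dims by (intro less.hyps V W) auto
        ultimately show ?thesis
          using BL_finite_trans V W by blast
      qed
    qed
  qed
qed

section \<open>Coordinates on the target spaces\<close>

text \<open>Tonelli, one coordinate at a time; the head of the list is the innermost
  integral.\<close>

lemma nn_integral_PiM_eq_span_int:
  fixes c :: "'i \<Rightarrow> 'a::euclidean_space"
  assumes [measurable]: "g \<in> borel_measurable borel" and "distinct is"
  shows "(\<integral>\<^sup>+ t. g (x + (\<Sum>i\<in>set is. t i *\<^sub>R c i)) \<partial>Pi\<^sub>M (set is) (\<lambda>_. lborel))
    = span_int (map c is) g x"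
  using assms
proof (induction "is" arbitrary: g)
  case Nil
  show ?case by (simp add: PiM_empty nn_integral_count_space_finite)
next
  case (Cons i "is")
  interpret product_sigma_finite "\<lambda>_::'i. lborel :: real measure" ..
  note [measurable] = Cons.prems(1)
  let ?M = "Pi\<^sub>M (set is) (\<lambda>_. lborel :: real measure)"
  have i: "i \<notin> set is" using Cons.prems by simp
  have "(\<integral>\<^sup>+ t. g (x + (\<Sum>j\<in>set (i # is). t j *\<^sub>R c j)) \<partial>Pi\<^sub>M (insert i (set is)) (\<lambda>_. lborel))
    = (\<integral>\<^sup>+ t. (\<integral>\<^sup>+ y. g (x + (\<Sum>j\<in>set (i # is). (t(i := y)) j *\<^sub>R c j)) \<partial>lborel) \<partial>?M)"
    by (intro product_nn_integral_insert) (use i in \<open>simp, simp, measurable\<close>)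
  also have "\<dots> = (\<integral>\<^sup>+ t. line_int (c i) g (x + (\<Sum>j\<in>set is. t j *\<^sub>R c j)) \<partial>?M)"
  proof -
    have "(\<Sum>j\<in>set (i # is). (t(i := y)) j *\<^sub>R c j) = (\<Sum>j\<in>set is. t j *\<^sub>R c j) + y *\<^sub>R c i" for t y
    proof -
      have "(\<Sum>j\<in>set is. (t(i := y)) j *\<^sub>R c j) = (\<Sum>j\<in>set is. t j *\<^sub>R c j)"
        using i by (intro sum.cong) auto
      then show ?thesis using i by simp
    qed
    then show ?thesis
      by (simp add: line_int_def add.assoc)
  qed
  also have "\<dots> = span_int (map c is) (line_int (c i) g) x"
    using Cons by simp
  finally show ?case by simp
qed

lemma nn_integral_lborel_eq_span_int:
  fixes g :: "'a::euclidean_space \<Rightarrow> ennreal"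
  assumes [measurable]: "g \<in> borel_measurable borel" and bs: "set bs = Basis" "distinct bs"
  shows "(\<integral>\<^sup>+ x. g x \<partial>lborel) = span_int bs g 0"
proof -
  have "(\<integral>\<^sup>+ x. g x \<partial>lborel)
      = (\<integral>\<^sup>+ t. g (\<Sum>b\<in>Basis. t b *\<^sub>R b) \<partial>Pi\<^sub>M Basis (\<lambda>_. lborel))"
    by (subst lborel_eq) (subst nn_integral_distr, measurable)
  also have "\<dots> = span_int bs g 0"
    using nn_integral_PiM_eq_span_int[OF assms(1) bs(2), of 0 "\<lambda>b. b"] bs(1) by simp
  finally show ?thesis .
qed

lemma basis_mod_Basis:
  assumes "set bs = (Basis :: 'a::euclidean_space set)" "distinct bs"
  shows "basis_mod {0} bs (UNIV :: 'a set)"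
  using assms distinct_card[OF assms(2)] by (simp add: basis_mod_def span_insert_0)

lemma span_int_const_eq_lborel:
  assumes "basis_mod {0} cs (UNIV :: 'a::euclidean_space set)"
  shows "\<exists>k>0. \<forall>g\<in>borel_measurable borel. span_int cs g 0 = ennreal k * (\<integral>\<^sup>+ x. g x \<partial>lborel)"
proof -
  obtain bs where bs: "set bs = (Basis :: 'a set)" "distinct bs"
    using finite_distinct_list finite_Basis by blast
  show ?thesis
    using span_int_change_of_basis[OF _ assms basis_mod_Basis[OF bs]]
      nn_integral_lborel_eq_span_int[OF _ bs]
    by (auto simp: invariant_under_def)
qed

text \<open>Rank-nullity for a target that is merely a real vector space, because the finitely
  supported sequences are infinite-dimensional. A basis of \<open>V\<close> modulo the kernel maps
  injectively to a basis of the image.\<close>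

lemma dim_image_linear:
  fixes f :: "'a::euclidean_space \<Rightarrow> 'b::real_vector"
  assumes f: "linear f" and V: "subspace V"
  shows "dim (f ` V) + dim (V \<inter> {x. f x = 0}) = dim V"
proof -
  let ?K = "{x. f x = 0}"
  have K: "subspace (V \<inter> ?K)"
    using V linear_subspace_kernel[OF f] by (rule subspace_inter)
  obtain bs where "basis_mod (V \<inter> ?K) bs V"
    using basis_mod_exists[OF K V] by blast
  then have bs: "span (V \<inter> ?K \<union> set bs) = V" "dim V = dim (V \<inter> ?K) + length bs"
    by (auto simp: basis_mod_def)
  have "set bs \<subseteq> span (V \<inter> ?K \<union> set bs)" by (auto intro: span_base)
  then have bsV: "set bs \<subseteq> V" unfolding bs(1) .
  then have sbsV: "span (set bs) \<subseteq> V" using V by (simp add: span_minimal)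
  have card: "card (set bs) \<le> length bs" by (rule card_length)
  have d: "dim (set bs) \<le> card (set bs)" by (simp add: dim_le_card')
  \<comment> \<open>Counting dimensions shows both that \<open>bs\<close> is independent and that
    its span meets the kernel only in 0.\<close>
  have "dim V + dim (V \<inter> ?K \<inter> span (set bs)) = dim (V \<inter> ?K) + dim (set bs)"
    using dim_span_Un_Int[OF K subspace_span, of "set bs"] bs(1) by (simp add: span_Un_span del: dim_span) (simp)
  then have *: "dim (V \<inter> ?K \<inter> span (set bs)) = 0" "dim (set bs) = length bs" "card (set bs) = length bs"
    using bs(2) card d by linarith+
  have 0: "V \<inter> ?K \<inter> span (set bs) \<subseteq> {0}"
    using *(1) by simp
  have inj: "inj_on f (span (set bs))"
  proof (rule inj_onI)
    fix x y assume xy: "x \<in> span (set bs)" "y \<in> span (set bs)" "f x = f y"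
    then have "x - y \<in> span (set bs)" "f (x - y) = 0"
      by (auto simp: span_diff linear_diff[OF f])
    then have "x - y \<in> {0}" using 0 sbsV by blast
    then show "x = y" by simp
  qed
  have ind: "independent (set bs)"
    using *(2,3) by (intro card_le_dim_spanning[of _ "span (set bs)"]) (auto intro: span_base)
  have "dim (f ` V) = length bs"
  proof (rule dim_unique[of "f ` set bs"])
    show "f ` set bs \<subseteq> f ` V" using bsV by blast
    show "f ` V \<subseteq> span (f ` set bs)"
    proof
      fix y assume "y \<in> f ` V"
      then obtain v where v: "v \<in> span (V \<inter> ?K \<union> set bs)" "y = f v" using bs(1) by blast
      then have "y \<in> span (f ` (V \<inter> ?K \<union> set bs))"
        using linear_span_image[OF f] by blast
      also have "\<dots> \<subseteq> span (f ` set bs)"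
        by (intro span_minimal) (auto intro: span_base span_zero)
      finally show "y \<in> span (f ` set bs)" .
    qed
    show "independent (f ` set bs)"
      using linear_dependent_inj_imageD[OF f _ inj] ind by blast
    have "inj_on f (set bs)" by (rule inj_on_subset[OF inj span_superset])
    then show "card (f ` set bs) = length bs" using *(3) by (simp add: card_image)
  qed
  then show ?thesis using bs(2) by simp
qed

section \<open>The spaces \<open>Rn m\<close> and their Lebesgue measure in coordinates\<close>

lemma lookup_scaleR_poly_mapping:
  "Poly_Mapping.lookup (r *\<^sub>R x) i = r *\<^sub>R Poly_Mapping.lookup x i"
  for x :: "'b \<Rightarrow>\<^sub>0 'c::real_vector"
proof -
  have "finite {i. r *\<^sub>R Poly_Mapping.lookup x i \<noteq> 0}"
    by (rule finite_subset[OF _ finite_lookup[of x]]) auto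
  then show ?thesis
    by (simp add: scaleR_poly_mapping_def Abs_poly_mapping_inverse)
qed

lemma Rn_of_eq_sum: "Rn_of m x = (\<Sum>i<m. x i *\<^sub>R Poly_Mapping.single i 1)"
  by (intro poly_mapping_eqI) (simp add: lookup_Rn_of lookup_sum lookup_scaleR_poly_mapping
      lookup_single when_def if_distrib cong: if_cong)

lemma Rn_of_lookup: "y \<in> Rn m \<Longrightarrow> Rn_of m (Poly_Mapping.lookup y) = y"
  by (intro poly_mapping_eqI) (auto simp: lookup_Rn_of Rn_iff)

lemma dim_Rn: "dim (Rn m) = m"
proof (rule dim_unique)
  let ?e = "\<lambda>i::nat. Poly_Mapping.single i (1::real)"
  show "?e ` {..<m} \<subseteq> Rn m"
    by (auto simp: Rn_iff lookup_single when_def)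
  have inj: "inj_on ?e A" for A
    by (intro inj_onI) (metis lookup_single_eq lookup_single_not_eq zero_neq_one)
  then show "card (?e ` {..<m}) = m" by (simp add: card_image)
  show "Rn m \<subseteq> span (?e ` {..<m})"
  proof
    fix y assume "y \<in> Rn m"
    then have "y = (\<Sum>i<m. Poly_Mapping.lookup y i *\<^sub>R ?e i)"
      using Rn_of_lookup Rn_of_eq_sum by metis
    also have "\<dots> \<in> span (?e ` {..<m})"
      by (intro span_sum span_scale span_base) auto
    finally show "y \<in> span (?e ` {..<m})" .
  qed
  show "independent (?e ` {..<m})"
  proof (rule independent_if_scalars_zero)
    fix f x assume 0: "(\<Sum>x\<in>?e ` {..<m}. f x *\<^sub>R x) = 0" and x: "x \<in> ?e ` {..<m}"
    then obtain i where i: "i < m" "x = ?e i" by auto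
    have "(\<Sum>j<m. f (?e j) *\<^sub>R ?e j) = 0"
      using 0 by (simp add: sum.reindex[OF inj])
    then have "Rn_of m (\<lambda>j. f (?e j)) = 0" by (simp add: Rn_of_eq_sum)
    then show "f x = 0"
      using i lookup_Rn_of[of m "\<lambda>j. f (?e j)" i] by simp
  qed simp
qed

abbreviation coord_measure :: "nat \<Rightarrow> (nat \<Rightarrow> real) measure" where
  "coord_measure m \<equiv> Pi\<^sub>M {..<m} (\<lambda>_. lborel)"

lemma inj_on_Rn_of_space: "inj_on (Rn_of m) (space (completion (coord_measure m)))"
  using inj_on_Rn_of by (simp add: space_PiM)

lemma Rn_of_measurable: "Rn_of m \<in> measurable (completion (coord_measure m)) (lebesgue_Rn m)"
  unfolding lebesgue_Rn_def by (rule measurable_embed_measure2'[OF inj_on_Rn_of_space])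

text \<open>Exchanges a Lebesgue measurable function for a Borel one without changing the integral.
  Domination at every point survives the pullback along a linear map and suits the lower integral of
  a possibly nonmeasurable integrand.\<close>

lemma lebesgue_Rn_borel_majorant:
  assumes f: "integrable (lebesgue_Rn m) f" and nonneg: "\<And>y. y \<in> Rn m \<Longrightarrow> 0 \<le> f y"
  shows "\<exists>h\<in>borel_measurable (coord_measure m).
    (\<forall>x\<in>space (coord_measure m). ennreal (f (Rn_of m x)) \<le> h x) \<and>
    (\<integral>\<^sup>+ x. h x \<partial>coord_measure m) = ennreal (integral\<^sup>L (lebesgue_Rn m) f)"
proof -
  let ?N = "coord_measure m" and ?M = "completion (coord_measure m)"
  have fm: "f \<in> borel_measurable (lebesgue_Rn m)" using f by auto
  have g: "(\<lambda>x. ennreal (f (Rn_of m x))) \<in> borel_measurable ?M"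
    using measurable_compose[OF Rn_of_measurable fm] by measurable
  obtain h0 where h0: "h0 \<in> borel_measurable ?N" "AE x in ?N. ennreal (f (Rn_of m x)) = h0 x"
    using completion_ex_borel_measurable[OF g] by blast
  obtain Z where Z: "{x\<in>space ?N. \<not> ennreal (f (Rn_of m x)) = h0 x} \<subseteq> Z" "emeasure ?N Z = 0" "Z \<in> sets ?N"
    using AE_E[OF h0(2)] by blast
  note [measurable] = h0(1) Z(3)
  \<comment> \<open>On the null set that contains the points of disagreement the value is infinite,
    so that domination has no exceptions.\<close>
  let ?h = "\<lambda>x. if x \<in> Z then \<infinity> else h0 x"
  have "?h \<in> borel_measurable ?N" by measurable
  moreover have "\<forall>x\<in>space ?N. ennreal (f (Rn_of m x)) \<le> ?h x"
    using Z(1) by auto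
  moreover have "(\<integral>\<^sup>+ x. ?h x \<partial>?N) = ennreal (integral\<^sup>L (lebesgue_Rn m) f)"
  proof -
    have "AE x in ?N. x \<notin> Z"
      using Z(2,3) by (intro AE_not_in) (auto simp: null_sets_def)
    then have "AE x in ?N. ?h x = ennreal (f (Rn_of m x))"
      using h0(2) by eventually_elim simp
    then have "(\<integral>\<^sup>+ x. ?h x \<partial>?N) = (\<integral>\<^sup>+ x. ennreal (f (Rn_of m x)) \<partial>?N)"
      by (rule nn_integral_cong_AE)
    also have "\<dots> = (\<integral>\<^sup>+ x. ennreal (f (Rn_of m x)) \<partial>?M)"
      by (simp add: nn_integral_completion)
    also have "\<dots> = (\<integral>\<^sup>+ y. ennreal (f y) \<partial>lebesgue_Rn m)"
      unfolding lebesgue_Rn_def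
      by (subst nn_integral_embed_measure'[OF inj_on_Rn_of_space])
         (use fm in \<open>auto simp: lebesgue_Rn_def\<close>)
    also have "\<dots> = ennreal (integral\<^sup>L (lebesgue_Rn m) f)"
      using nonneg by (intro nn_integral_eq_integral f) (auto simp: space_lebesgue_Rn)
    finally show ?thesis .
  qed
  ultimately show ?thesis by (intro bexI[of _ ?h]) auto
qed

lemma lebesgue_Rn_integral_from_coords:
  assumes f: "(\<lambda>x. f (Rn_of m x)) \<in> borel_measurable (coord_measure m)" and nonneg: "\<And>y. 0 \<le> f y"
    and r: "(\<integral>\<^sup>+ x. ennreal (f (Rn_of m x)) \<partial>coord_measure m) = ennreal r" "0 \<le> r"
  shows "integrable (lebesgue_Rn m) f" "integral\<^sup>L (lebesgue_Rn m) f = r"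
proof -
  let ?M = "completion (coord_measure m)"
  have "(\<lambda>x. f (Rn_of m x)) \<in> borel_measurable ?M"
    using f by (rule measurable_completion)
  then have fm: "f \<in> borel_measurable (lebesgue_Rn m)"
    unfolding lebesgue_Rn_def by (rule measurable_embed_measure1)
  have nn: "(\<integral>\<^sup>+ y. ennreal (f y) \<partial>lebesgue_Rn m) = ennreal r"
    unfolding lebesgue_Rn_def
    by (subst nn_integral_embed_measure'[OF inj_on_Rn_of_space])
       (use fm r in \<open>auto simp: lebesgue_Rn_def nn_integral_completion\<close>)
  then show "integrable (lebesgue_Rn m) f"
    using nonneg by (intro integrableI_nn_integral_finite[OF fm _ nn]) auto
  show "integral\<^sup>L (lebesgue_Rn m) f = r"
    using nonneg r(2) nn by (subst integral_eq_nn_integral[OF fm]) auto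
qed

section \<open>Pullbacks along the maps in coordinates\<close>

definition coords :: "nat \<Rightarrow> ('a \<Rightarrow> (nat \<Rightarrow>\<^sub>0 real)) \<Rightarrow> 'a \<Rightarrow> nat \<Rightarrow> real" where
  "coords m L x = restrict (Poly_Mapping.lookup (L x)) {..<m}"

lemma linear_lookup: "linear (\<lambda>y. Poly_Mapping.lookup y i :: real)"
  by (intro linearI) (auto simp: lookup_add lookup_scaleR_poly_mapping)

lemma coords_measurable [measurable]:
  fixes L :: "'a::euclidean_space \<Rightarrow> (nat \<Rightarrow>\<^sub>0 real)"
  assumes "linear L"
  shows "coords m L \<in> measurable borel (coord_measure m)"
  unfolding coords_def
proof (rule measurable_restrict)
  fix i
  have "linear (\<lambda>x. Poly_Mapping.lookup (L x) i)"
    using linear_compose[OF assms linear_lookup] by (simp add: o_def)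
  then show "(\<lambda>x. Poly_Mapping.lookup (L x) i) \<in> measurable borel lborel"
    by (simp add: borel_measurable_continuous_onI linear_continuous_on linear_conv_bounded_linear)
qed

lemma Rn_of_coords:
  assumes "L x \<in> Rn m"
  shows "Rn_of m (coords m L x) = L x"
  using assms by (intro poly_mapping_eqI) (auto simp: lookup_Rn_of coords_def Rn_iff)

lemma invariant_under_coords:
  assumes "linear L"
  shows "invariant_under {x. L x = 0} (\<lambda>x. h (coords m L x))"
  using assms by (simp add: invariant_under_def coords_def linear_add)

text \<open>The \<open>c i\<close> are lifts of the unit vectors. They are a basis modulo the kernel
  for which the iterated integral of a pullback is the integral over the target, with factor
  1.\<close>

lemma coords_basis_exists:
  fixes L :: "'a::euclidean_space \<Rightarrow> (nat \<Rightarrow>\<^sub>0 real)"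
  assumes L: "linear L" "range L = Rn m"
  shows "\<exists>c. (\<forall>i<m. L (c i) = Poly_Mapping.single i 1) \<and>
    basis_mod {x. L x = 0} (map c [0..<m]) UNIV \<and>
    (\<forall>h\<in>borel_measurable (coord_measure m).
       span_int (map c [0..<m]) (\<lambda>x. h (coords m L x)) 0 = (\<integral>\<^sup>+ t. h t \<partial>coord_measure m))"
proof -
  have "\<exists>x. L x = Poly_Mapping.single i 1" if "i < m" for i
  proof -
    have "Poly_Mapping.single i 1 \<in> Rn m"
      using that by (auto simp: Rn_iff lookup_single when_def)
    then show ?thesis using L(2) by (metis imageE)
  qed
  then obtain c where c: "\<And>i. i < m \<Longrightarrow> L (c i) = Poly_Mapping.single i 1" by metis
  have Lc: "L (\<Sum>i<m. t i *\<^sub>R c i) = Rn_of m t" for t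
    using c by (simp add: linear_sum[OF L(1)] linear_scale[OF L(1)] Rn_of_eq_sum)
  have "basis_mod {x. L x = 0} (map c [0..<m]) UNIV"
    unfolding basis_mod_def
  proof
    show "span ({x. L x = 0} \<union> set (map c [0..<m])) = UNIV"
    proof (rule UNIV_eq_I[symmetric])
      fix x
      let ?y = "\<Sum>i<m. Poly_Mapping.lookup (L x) i *\<^sub>R c i"
      have "L x \<in> Rn m" using L(2) by blast
      then have "L (x - ?y) = 0"
        by (simp add: linear_diff[OF L(1)] Lc Rn_of_lookup)
      then have "x - ?y \<in> span ({x. L x = 0} \<union> set (map c [0..<m]))"
        by (intro span_base) auto
      moreover have "?y \<in> span ({x. L x = 0} \<union> set (map c [0..<m]))"
        by (intro span_sum span_scale span_base) auto
      ultimately have "x - ?y + ?y \<in> span ({x. L x = 0} \<union> set (map c [0..<m]))"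
        by (rule span_add)
      then show "x \<in> span ({x. L x = 0} \<union> set (map c [0..<m]))" by simp
    qed
    show "dim (UNIV :: 'a set) = dim {x. L x = 0} + length (map c [0..<m])"
      using dim_image_linear[OF L(1) subspace_UNIV] L(2) by (simp add: dim_Rn)
  qed
  moreover have "span_int (map c [0..<m]) (\<lambda>x. h (coords m L x)) 0 = (\<integral>\<^sup>+ t. h t \<partial>coord_measure m)"
    if h[measurable]: "h \<in> borel_measurable (coord_measure m)" for h
  proof -
    note coords_measurable[OF L(1), measurable]
    have "(\<integral>\<^sup>+ t. h (coords m L (0 + (\<Sum>i\<in>set [0..<m]. t i *\<^sub>R c i))) \<partial>Pi\<^sub>M (set [0..<m]) (\<lambda>_. lborel))
       = span_int (map c [0..<m]) (\<lambda>x. h (coords m L x)) 0"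
      by (rule nn_integral_PiM_eq_span_int) auto
    moreover have "(\<integral>\<^sup>+ t. h (coords m L (\<Sum>i<m. t i *\<^sub>R c i)) \<partial>coord_measure m)
       = (\<integral>\<^sup>+ t. h t \<partial>coord_measure m)"
    proof (rule nn_integral_cong)
      fix t assume t: "t \<in> space (coord_measure m)"
      have "coords m L (\<Sum>i<m. t i *\<^sub>R c i) = t"
        unfolding coords_def Lc using t
        by (intro ext) (auto simp: lookup_Rn_of space_PiM PiE_def extensional_def)
      then show "h (coords m L (\<Sum>i<m. t i *\<^sub>R c i)) = h t" by simp
    qed
    ultimately show ?thesis by (simp add: atLeast0LessThan)
  qed
  ultimately show ?thesis using c by blast
qed

text \<open>By rank-nullity, \<open>quot_dim\<close> relative to the kernels is the dimension of the
  image, so the given maps are one instance of the localised setting.\<close>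

lemma HBL_polytope_eq_BL_polytope:
  fixes L :: "'n::finite \<Rightarrow> real^'d \<Rightarrow> (nat \<Rightarrow>\<^sub>0 real)"
  assumes L: "\<And>j. linear (L j)" "\<And>j. range (L j) = Rn (k j)"
  shows "HBL_polytope k L = BL_polytope (\<lambda>j. {x. L j x = 0}) {0} UNIV"
proof -
  let ?K = "\<lambda>j. {x. L j x = 0}"
  have q: "quot_dim ?K {0} j W = real (dim (L j ` W))" if "subspace W" for j W
  proof -
    have K: "subspace (?K j)" by (rule linear_subspace_kernel[OF L(1)])
    have "span ({0} \<union> ?K j) = ?K j"
      using K by (simp add: span_insert_0 span_eq_iff[THEN iffD2])
    moreover have "dim (span (W \<union> ?K j)) = dim (L j ` W) + dim (?K j)"
      using dim_image_linear[OF L(1)[of j] that] dim_span_Un_Int[OF that K] by linarith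
    ultimately show ?thesis
      by (simp add: quot_dim_def)
  qed
  have "real (dim (L j ` UNIV)) = real (k j)" for j
    using L(2) by (simp add: dim_Rn)
  then show ?thesis
    unfolding HBL_polytope_def BL_polytope_def
    using q[OF subspace_UNIV] by (auto simp: q subspace_0)
qed

section \<open>Growth implies the HBL property\<close>

lemma epow_ge_powr:
  assumes "0 \<le> s" "0 < t" "ennreal t \<le> x"
  shows "ennreal (t powr s) \<le> epow x s"
proof (cases x)
  case (real r)
  then show ?thesis
    using assms by (auto simp: epow_def intro!: ennreal_leI powr_mono2)
qed (auto simp: epow_def)

lemma BL_inequality_coords:
  fixes L :: "'n::finite \<Rightarrow> real^'d \<Rightarrow> (nat \<Rightarrow>\<^sub>0 real)"
  assumes L: "\<And>j. linear (L j)" "\<And>j. range (L j) = Rn (k j)"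
    and s: "s \<in> HBL_polytope k L"
  shows "\<exists>C\<ge>0. \<forall>h. (\<forall>j. h j \<in> borel_measurable (coord_measure (k j)) \<and> (\<forall>x. 0 < h j x)) \<longrightarrow>
    (\<integral>\<^sup>+ x. (\<Prod>j\<in>UNIV. epow (h j (coords (k j) (L j) x)) (s $ j)) \<partial>lborel)
      \<le> ennreal C * (\<Prod>j\<in>UNIV. epow (\<integral>\<^sup>+ t. h j t \<partial>coord_measure (k j)) (s $ j))"
proof -
  let ?K = "\<lambda>j. {x. L j x = 0}"
  have K: "subspace (?K j)" for j by (rule linear_subspace_kernel[OF L(1)])
  have K0: "span ({0} \<union> ?K j) = ?K j" for j
    using K by (simp add: span_insert_0 span_eq_iff[THEN iffD2])
  obtain c where c: "\<And>j. basis_mod (?K j) (map (c j) [0..<k j]) UNIV"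
    "\<And>j h. h \<in> borel_measurable (coord_measure (k j)) \<Longrightarrow>
       span_int (map (c j) [0..<k j]) (\<lambda>x. h (coords (k j) (L j) x)) 0 = (\<integral>\<^sup>+ t. h t \<partial>coord_measure (k j))"
    using coords_basis_exists[OF L] by metis
  obtain bs where bs: "set bs = (Basis :: (real^'d) set)" "distinct bs"
    using finite_distinct_list finite_Basis by blast
  have "BL_finite ?K {0} UNIV s"
    using s unfolding HBL_polytope_eq_BL_polytope[OF L]
    by (intro BL_finite_polytope) (auto simp: subspace_0)
  moreover have "BL_bases ?K {0} UNIV bs (\<lambda>j. map (c j) [0..<k j])"
    unfolding BL_bases_def K0 using c(1) basis_mod_Basis[OF bs] by simp
  ultimately obtain C where C: "C \<ge> 0" "BL_bound_const ?K {0} s bs (\<lambda>j. map (c j) [0..<k j]) C"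
    using BL_finiteD[of ?K "{0}" UNIV s] by (auto simp: subspace_0)
  show ?thesis
  proof (intro exI[of _ C] conjI allI impI C(1))
    fix h :: "'n \<Rightarrow> (nat \<Rightarrow> real) \<Rightarrow> ennreal"
    assume h: "\<forall>j. h j \<in> borel_measurable (coord_measure (k j)) \<and> (\<forall>x. 0 < h j x)"
    then have [measurable]: "h j \<in> borel_measurable (coord_measure (k j))" for j by simp
    note coords_measurable[OF L(1), measurable]
    have adm: "admissible ?K {0} (\<lambda>j x. h j (coords (k j) (L j) x))"
      unfolding admissible_def K0 using h invariant_under_coords[OF L(1)] by auto
    have "(\<integral>\<^sup>+ x. (\<Prod>j\<in>UNIV. epow (h j (coords (k j) (L j) x)) (s $ j)) \<partial>lborel)
        = span_int bs (\<lambda>x. \<Prod>j\<in>UNIV. epow (h j (coords (k j) (L j) x)) (s $ j)) 0"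
      by (rule nn_integral_lborel_eq_span_int[OF _ bs]) measurable
    also have "\<dots> \<le> ennreal C * (\<Prod>j\<in>UNIV. epow (span_int (map (c j) [0..<k j]) (\<lambda>x. h j (coords (k j) (L j) x)) 0) (s $ j))"
      using C(2) adm unfolding BL_bound_const_def by blast
    also have "\<dots> = ennreal C * (\<Prod>j\<in>UNIV. epow (\<integral>\<^sup>+ t. h j t \<partial>coord_measure (k j)) (s $ j))"
      using h by (simp add: c(2))
    finally show "(\<integral>\<^sup>+ x. (\<Prod>j\<in>UNIV. epow (h j (coords (k j) (L j) x)) (s $ j)) \<partial>lborel)
      \<le> ennreal C * (\<Prod>j\<in>UNIV. epow (\<integral>\<^sup>+ t. h j t \<partial>coord_measure (k j)) (s $ j))" .
  qed
qed

text \<open>Serves the case of a vanishing integral, where \<open>B\<close> is 0 at the integrals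
  and the left-hand side must vanish as well. Integration along the lifted unit vectors leaves a
  constant function, here 0, before the kernel directions are integrated.\<close>

lemma nn_integral_coords_eq_0:
  fixes L :: "real^'d \<Rightarrow> (nat \<Rightarrow>\<^sub>0 real)"
  assumes L: "linear L" "range L = Rn m"
    and h[measurable]: "h \<in> borel_measurable (coord_measure m)" and 0: "(\<integral>\<^sup>+ t. h t \<partial>coord_measure m) = 0"
  shows "(\<integral>\<^sup>+ x. h (coords m L x) \<partial>lborel) = 0"
proof -
  let ?K = "{x. L x = 0}"
  let ?F = "\<lambda>x. h (coords m L x)"
  have K: "subspace ?K" by (rule linear_subspace_kernel[OF L(1)])
  note coords_measurable[OF L(1), measurable]
  have F: "?F \<in> borel_measurable borel" by measurable
  obtain c where c: "basis_mod ?K (map c [0..<m]) UNIV"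
    "span_int (map c [0..<m]) ?F 0 = (\<integral>\<^sup>+ t. h t \<partial>coord_measure m)"
    using coords_basis_exists[OF L] h by metis
  let ?cs = "map c [0..<m]"
  have "invariant_under UNIV (span_int ?cs ?F)"
    using invariant_under_span_int[OF invariant_under_coords[OF L(1)] F K, of ?cs] c(1)
    by (simp add: basis_mod_def)
  then have z: "span_int ?cs ?F = (\<lambda>x. 0)"
    using c(2) 0 by (auto simp: invariant_under_def) (metis add_0)
  obtain bs where bs: "basis_mod {0} bs ?K"
    using basis_mod_exists[of "{0}" ?K] K subspace_0[OF K] by auto
  have "basis_mod {0} (bs @ ?cs) UNIV"
    using basis_mod_append[OF _ bs c(1)] by simp
  then have b: "basis_mod {0} (?cs @ bs) UNIV"
    by (simp add: basis_mod_def Un_ac)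
  have z': "span_int bs (\<lambda>x. 0) = (\<lambda>x. 0)"
    using span_int_cmult[of "\<lambda>x. 0" bs 0] by simp
  obtain l where l: "l > 0" "\<forall>g\<in>borel_measurable borel. span_int (?cs @ bs) g 0 = ennreal l * (\<integral>\<^sup>+ x. g x \<partial>lborel)"
    using span_int_const_eq_lborel[OF b] by blast
  have "ennreal l * (\<integral>\<^sup>+ x. ?F x \<partial>lborel) = span_int bs (span_int ?cs ?F) 0"
    using l(2) F by simp
  also have "\<dots> = 0" by (simp only: z z')
  finally show ?thesis
    using l(1) by simp
qed

lemma SUP_HBL_polytope_le_sum:
  fixes L :: "'n::finite \<Rightarrow> real^'d \<Rightarrow> (nat \<Rightarrow>\<^sub>0 real)"
  assumes L: "\<And>j. linear (L j)" "\<And>j. range (L j) = Rn (k j)"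
    and ne: "HBL_polytope k L \<noteq> {}" and t: "\<And>j. 0 < t j"
  shows "(SUP s\<in>HBL_polytope k L. \<Prod>j\<in>UNIV. t j powr s $ j)
    \<le> (\<Sum>v | v extreme_point_of HBL_polytope k L. \<Prod>j\<in>UNIV. t j powr v $ j)"
proof (rule cSUP_least[OF ne])
  fix s assume "s \<in> HBL_polytope k L"
  then show "(\<Prod>j\<in>UNIV. t j powr s $ j)
      \<le> (\<Sum>v | v extreme_point_of HBL_polytope k L. \<Prod>j\<in>UNIV. t j powr v $ j)"
    unfolding HBL_polytope_eq_BL_polytope[OF L] using BL_polytope_eq_hull_extreme_points
    by (intro prod_powr_le_sum_hull finite_extreme_points_BL_polytope t) blast
qed

lemma mono_on_coordinates_imp_mono:
  fixes B :: "real^'n \<Rightarrow> real"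
  assumes mono: "\<forall>y\<in>orthant. \<forall>j. mono_on {0..} (\<lambda>u. B (\<chi> i. if i = j then u else y $ i))"
    and xy: "x \<in> orthant" "\<And>j. x $ j \<le> y $ j"
  shows "B x \<le> B y"
proof -
  have x0: "0 \<le> x $ j" for j using xy(1) by (simp add: orthant_def)
  have "B x \<le> B (\<chi> i. if i \<in> A then y $ i else x $ i)" for A :: "'n set"
    using finite[of A]
  proof (induction A rule: finite_induct)
    case empty
    show ?case by simp
  next
    case (insert j A)
    let ?z = "\<chi> i. if i \<in> A then y $ i else x $ i"
    have z: "?z \<in> orthant"
      using x0 xy(2) by (auto simp: orthant_def intro: order_trans)
    have "mono_on {0..} (\<lambda>u. B (\<chi> i. if i = j then u else ?z $ i))"
      using mono z by blast
    then have "B (\<chi> i. if i = j then x $ j else ?z $ i) \<le> B (\<chi> i. if i = j then y $ j else ?z $ i)"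
      using x0[of j] xy(2)[of j] by (auto simp: mono_on_def intro: order_trans)
    moreover have "(\<chi> i. if i = j then x $ j else ?z $ i) = ?z"
      using insert(2) by (auto simp: vec_eq_iff)
    moreover have "(\<chi> i. if i = j then y $ j else ?z $ i) = (\<chi> i. if i \<in> insert j A then y $ i else x $ i)"
      by (auto simp: vec_eq_iff)
    ultimately show ?case using insert.IH by simp
  qed
  from this[of UNIV] show ?thesis by (simp add: vec_nth_inverse)
qed

theorem HBL_function_if_growth:
  fixes k :: "'n::finite \<Rightarrow> nat"
    and L :: "'n \<Rightarrow> real^'d \<Rightarrow> (nat \<Rightarrow>\<^sub>0 real)"
    and B :: "real^'n \<Rightarrow> real"
  assumes L: "\<And>j. linear (L j)" "\<And>j. range (L j) = Rn (k j)"
    and ne: "HBL_polytope k L \<noteq> {}"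
    and B0: "\<forall>y\<in>orthant. 0 \<le> B y"
    and Bz: "\<forall>y\<in>orthant. (\<exists>j. y $ j = 0) \<longrightarrow> B y = 0"
    and C: "C > 0" "\<And>t y :: real^'n. (\<And>j. 0 < t $ j \<and> 0 < y $ j) \<Longrightarrow>
       B (\<chi> j. t $ j * y $ j) \<le> C * (SUP s\<in>HBL_polytope k L. \<Prod>j\<in>UNIV. t $ j powr s $ j) * B y"
  shows "HBL_function k L B"
proof -
  let ?P = "HBL_polytope k L"
  define X where "X = {v. v extreme_point_of ?P}"
  have X: "finite X"
    unfolding X_def HBL_polytope_eq_BL_polytope[OF L] by (rule finite_extreme_points_BL_polytope)
  have XP: "v \<in> ?P" if "v \<in> X" for v
    using that by (simp add: X_def extreme_point_of_def)
  have "\<exists>C\<ge>0. \<forall>h. (\<forall>j. h j \<in> borel_measurable (coord_measure (k j)) \<and> (\<forall>x. 0 < h j x)) \<longrightarrow>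
    (\<integral>\<^sup>+ x. (\<Prod>j\<in>UNIV. epow (h j (coords (k j) (L j) x)) (v $ j)) \<partial>lborel)
      \<le> ennreal C * (\<Prod>j\<in>UNIV. epow (\<integral>\<^sup>+ t. h j t \<partial>coord_measure (k j)) (v $ j))" (is "?BL v")
    if "v \<in> X" for v
    by (rule BL_inequality_coords[OF L XP[OF that]])
  then have "\<forall>v\<in>X. ?BL v" by blast
  from bchoice[OF this] obtain D where D: "\<And>v. v \<in> X \<Longrightarrow> D v \<ge> 0"
    "\<And>v h. v \<in> X \<Longrightarrow> (\<And>j. h j \<in> borel_measurable (coord_measure (k j)) \<and> (\<forall>x. 0 < h j x)) \<Longrightarrow>
    (\<integral>\<^sup>+ x. (\<Prod>j\<in>UNIV. epow (h j (coords (k j) (L j) x)) (v $ j)) \<partial>lborel)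
      \<le> ennreal (D v) * (\<Prod>j\<in>UNIV. epow (\<integral>\<^sup>+ t. h j t \<partial>coord_measure (k j)) (v $ j))"
    by blast
  \<comment> \<open>A strictly positive integrable weight, which repairs the zeros of the data; it
    enlarges the normalised integrals from 1 to \<open>1 + a j\<close>, whence the powers in
    \<open>E\<close>.\<close>
  have "\<exists>w. w \<in> borel_measurable (coord_measure (k j)) \<and> (\<integral>\<^sup>+ t. w t \<partial>coord_measure (k j)) \<noteq> \<infinity> \<and>
     (\<forall>x\<in>space (coord_measure (k j)). 0 < w x)" (is "?W j") for j
  proof -
    interpret product_sigma_finite "\<lambda>_::nat. lborel :: real measure" ..
    interpret sigma_finite_measure "coord_measure (k j)" by (rule sigma_finite) simp
    show ?thesis using Ex_finite_integrable_function by blast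
  qed
  then have "\<forall>j. ?W j" by blast
  from choice[OF this] obtain w where w: "\<And>j. w j \<in> borel_measurable (coord_measure (k j))"
    "\<And>j. (\<integral>\<^sup>+ t. w j t \<partial>coord_measure (k j)) \<noteq> \<infinity>"
    "\<And>j x. x \<in> space (coord_measure (k j)) \<Longrightarrow> 0 < w j x"
    by blast
  note w(1)[measurable]
  define a where "a j = enn2real (\<integral>\<^sup>+ t. w j t \<partial>coord_measure (k j))" for j
  have a: "(\<integral>\<^sup>+ t. w j t \<partial>coord_measure (k j)) = ennreal (a j)" "0 \<le> a j" for j
    using w(2)[of j] by (auto simp: a_def top.not_eq_extremum)
  define E where "E = C * (\<Sum>v\<in>X. D v * (\<Prod>j\<in>UNIV. (1 + a j) powr v $ j))"
  have "E \<ge> 0"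
    unfolding E_def using C(1) D(1) by (intro mult_nonneg_nonneg sum_nonneg prod_nonneg) auto
  show ?thesis
    unfolding HBL_function_def
  proof (intro exI[of _ E] conjI allI impI \<open>E \<ge> 0\<close>)
    fix f :: "'n \<Rightarrow> (nat \<Rightarrow>\<^sub>0 real) \<Rightarrow> real"
    assume f: "\<forall>j. integrable (lebesgue_Rn (k j)) (f j) \<and> (\<forall>y\<in>Rn (k j). 0 \<le> f j y)"
    define y where "y j = integral\<^sup>L (lebesgue_Rn (k j)) (f j)" for j
    have LR: "L j x \<in> Rn (k j)" for j x using L(2)[of j] by blast
    have y0: "0 \<le> y j" for j
      unfolding y_def
      by (rule Bochner_Integration.integral_nonneg_AE, rule AE_I2) (use f in \<open>auto simp: space_lebesgue_Rn\<close>)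
    have fL0: "0 \<le> f j (L j x)" for j x using f LR by blast
    have "\<exists>h\<in>borel_measurable (coord_measure (k j)).
       (\<forall>x\<in>space (coord_measure (k j)). ennreal (f j (Rn_of (k j) x)) \<le> h x) \<and>
       (\<integral>\<^sup>+ x. h x \<partial>coord_measure (k j)) = ennreal (y j)" (is "?H j") for j
      unfolding y_def using f by (intro lebesgue_Rn_borel_majorant) auto
    then have "\<forall>j. ?H j" by blast
    from this[unfolded Bex_def, THEN choice] obtain h where h: "\<And>j. h j \<in> borel_measurable (coord_measure (k j))"
       "\<And>j x. x \<in> space (coord_measure (k j)) \<Longrightarrow> ennreal (f j (Rn_of (k j) x)) \<le> h j x"
       "\<And>j. (\<integral>\<^sup>+ x. h j x \<partial>coord_measure (k j)) = ennreal (y j)"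
      by blast
    note h(1)[measurable]
    have cspace: "coords (k j) (L j) x \<in> space (coord_measure (k j))" for j x
      by (simp add: coords_def space_PiM)
    have fh: "ennreal (f j (L j x)) \<le> h j (coords (k j) (L j) x)" for j x
      using h(2)[OF cspace, of j x] by (simp add: Rn_of_coords[of "L j" x "k j", OF LR])
    note coords_measurable[OF L(1), measurable]
    let ?fx = "\<lambda>x. \<chi> j. f j (L j x)"
    have fxo: "?fx x \<in> orthant" for x using fL0 by (simp add: orthant_def)
    have yo: "(\<chi> j. y j) \<in> orthant" using y0 by (simp add: orthant_def)
    show "(\<integral>\<^sup>+ x. ennreal (B (?fx x)) \<partial>lebesgue)
       \<le> ennreal (E * B (\<chi> j. integral\<^sup>L (lebesgue_Rn (k j)) (f j)))"
      unfolding y_def[symmetric] nn_integral_completion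
    proof (cases "\<exists>j. y j = 0")
      \<comment> \<open>Where the pullback of \<open>h j\<close> vanishes so does the integrand, by
        the hypothesis on \<open>B\<close>; elsewhere infinity is a bound. The factor infinity is
        harmless because that pullback has integral 0.\<close>
      case True
      then obtain j where j: "y j = 0" by blast
      have "(\<integral>\<^sup>+ x. ennreal (B (?fx x)) \<partial>lborel) \<le> (\<integral>\<^sup>+ x. \<infinity> * h j (coords (k j) (L j) x) \<partial>lborel)"
      proof (rule nn_integral_mono)
        fix x
        show "ennreal (B (?fx x)) \<le> \<infinity> * h j (coords (k j) (L j) x)"
        proof (cases "h j (coords (k j) (L j) x) = 0")
          case True
          then have "f j (L j x) = 0" using fh[of j x] fL0[of j x] by simp
          then have "B (?fx x) = 0" using Bz fxo[of x] by auto
          then show ?thesis by simp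
        next
          case False
          then show ?thesis by (simp add: ennreal_top_mult)
        qed
      qed
      also have "\<dots> = \<infinity> * (\<integral>\<^sup>+ x. h j (coords (k j) (L j) x) \<partial>lborel)"
        by (rule nn_integral_cmult) measurable
      also have "\<dots> = 0"
        using nn_integral_coords_eq_0[OF L h(1)] h(3)[of j] j by simp
      finally show "(\<integral>\<^sup>+ x. ennreal (B (?fx x)) \<partial>lborel) \<le> ennreal (E * B (\<chi> j. y j))"
        by simp
    next
      case False
      then have ypos: "0 < y j" for j using y0[of j] by (metis less_eq_real_def)
      \<comment> \<open>The majorant scaled to integral 1, plus the weight. The value 1 outside the
        space makes positivity hold at every argument.\<close>
      let ?g = "\<lambda>j t. if t \<in> space (coord_measure (k j)) then ennreal (1 / y j) * h j t + w j t else 1"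
      let ?G = "\<lambda>j x. ?g j (coords (k j) (L j) x)"
      have g: "?g j \<in> borel_measurable (coord_measure (k j)) \<and> (\<forall>x. 0 < ?g j x)" for j
      proof (intro conjI allI)
        show "?g j \<in> borel_measurable (coord_measure (k j))" by measurable
        show "0 < ?g j x" for x
          using w(3)[of x j] by (auto simp: add_nonneg_pos)
      qed
      have Ig: "(\<integral>\<^sup>+ t. ?g j t \<partial>coord_measure (k j)) = ennreal (1 + a j)" for j
      proof -
        have "(\<integral>\<^sup>+ t. ?g j t \<partial>coord_measure (k j))
            = (\<integral>\<^sup>+ t. ennreal (1 / y j) * h j t + w j t \<partial>coord_measure (k j))"
          by (intro nn_integral_cong) simp
        also have "\<dots> = ennreal (1 / y j) * ennreal (y j) + ennreal (a j)"
          by (subst nn_integral_add) (auto simp: nn_integral_cmult h(3) a(1))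
        also have "ennreal (1 / y j) * ennreal (y j) = 1"
          using ypos[of j] by (simp flip: ennreal_mult)
        finally show ?thesis using a(2)[of j] by simp
      qed
      \<comment> \<open>The scaling vector is \<open>f j (L j x) / y j\<close>; if one of its
        entries is 0, then the left-hand side is 0.\<close>
      have pw: "ennreal (B (?fx x)) \<le> ennreal (C * B (\<chi> j. y j)) * (\<Sum>v\<in>X. \<Prod>j\<in>UNIV. epow (?G j x) (v $ j))" for x
      proof (cases "\<exists>j. f j (L j x) = 0")
        case True
        then have "B (?fx x) = 0" using Bz fxo[of x] by auto
        then show ?thesis by simp
      next
        case False
        then have fpos: "0 < f j (L j x)" for j using fL0[of j x] by (metis less_eq_real_def)
        let ?t = "\<lambda>j. f j (L j x) / y j"
        have tpos: "0 < ?t j" for j using fpos ypos by simp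
        have "B (\<chi> j. (\<chi> j. ?t j) $ j * (\<chi> j. y j) $ j)
            \<le> C * (SUP s\<in>?P. \<Prod>j\<in>UNIV. (\<chi> j. ?t j) $ j powr s $ j) * B (\<chi> j. y j)"
          using tpos ypos by (intro C(2)) simp
        moreover have "(\<chi> j. (\<chi> j. ?t j) $ j * (\<chi> j. y j) $ j) = ?fx x"
          using ypos by (simp add: vec_eq_iff less_imp_neq[symmetric])
        ultimately have "B (?fx x) \<le> C * (SUP s\<in>?P. \<Prod>j\<in>UNIV. ?t j powr s $ j) * B (\<chi> j. y j)"
          by simp
        also have "\<dots> \<le> C * (\<Sum>v\<in>X. \<Prod>j\<in>UNIV. ?t j powr v $ j) * B (\<chi> j. y j)"
          using SUP_HBL_polytope_le_sum[OF L ne tpos] C(1) B0 yo unfolding X_def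
          by (intro mult_right_mono mult_left_mono) auto
        finally have "ennreal (B (?fx x)) \<le> ennreal (C * B (\<chi> j. y j) * (\<Sum>v\<in>X. \<Prod>j\<in>UNIV. ?t j powr v $ j))"
          by (intro ennreal_leI) (simp add: mult_ac)
        also have "\<dots> = ennreal (C * B (\<chi> j. y j)) * (\<Sum>v\<in>X. \<Prod>j\<in>UNIV. ennreal (?t j powr v $ j))"
          using C(1) B0 yo
          by (simp add: ennreal_mult sum_nonneg prod_nonneg prod_ennreal sum_ennreal)
        also have "\<dots> \<le> ennreal (C * B (\<chi> j. y j)) * (\<Sum>v\<in>X. \<Prod>j\<in>UNIV. epow (?G j x) (v $ j))"
        proof (intro mult_left_mono sum_mono prod_mono_ennreal)
          fix v j assume v: "v \<in> X"
          have v0: "0 \<le> v $ j" using XP[OF v] by (simp add: HBL_polytope_def)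
          have "ennreal (?t j) = ennreal (1 / y j) * ennreal (f j (L j x))"
            using ypos[of j] fpos[of j] by (simp flip: ennreal_mult)
          also have "\<dots> \<le> ennreal (1 / y j) * h j (coords (k j) (L j) x) + w j (coords (k j) (L j) x)"
            using fh[of j x] by (intro order_trans[OF mult_left_mono add_increasing2]) auto
          finally have "ennreal (?t j) \<le> ?G j x" using cspace[of j x] by simp
          then show "ennreal (?t j powr v $ j) \<le> epow (?G j x) (v $ j)"
            using v0 tpos[of j] by (intro epow_ge_powr)
        qed auto
        finally show ?thesis .
      qed
      have "(\<integral>\<^sup>+ x. ennreal (B (?fx x)) \<partial>lborel)
         \<le> (\<integral>\<^sup>+ x. ennreal (C * B (\<chi> j. y j)) * (\<Sum>v\<in>X. \<Prod>j\<in>UNIV. epow (?G j x) (v $ j)) \<partial>lborel)"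
        by (intro nn_integral_mono pw)
      also have "\<dots> = ennreal (C * B (\<chi> j. y j)) * (\<Sum>v\<in>X. \<integral>\<^sup>+ x. (\<Prod>j\<in>UNIV. epow (?G j x) (v $ j)) \<partial>lborel)"
      proof -
        have [measurable]: "?G j \<in> borel_measurable borel" for j
          using measurable_compose[OF coords_measurable[OF L(1)] conjunct1[OF g]] .
        show ?thesis
          by (subst nn_integral_cmult, measurable) (subst nn_integral_sum, measurable)
      qed
      also have "\<dots> \<le> ennreal (C * B (\<chi> j. y j)) *
           (\<Sum>v\<in>X. ennreal (D v) * (\<Prod>j\<in>UNIV. epow (\<integral>\<^sup>+ t. ?g j t \<partial>coord_measure (k j)) (v $ j)))"
        by (intro mult_left_mono sum_mono D(2) g) auto
      also have "\<dots> = ennreal (C * B (\<chi> j. y j)) * (\<Sum>v\<in>X. ennreal (D v) * (\<Prod>j\<in>UNIV. ennreal ((1 + a j) powr v $ j)))"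
        unfolding Ig epow_ennreal[OF add_pos_nonneg[OF zero_less_one a(2)]] ..
      also have "\<dots> = ennreal (E * B (\<chi> j. y j))"
        unfolding E_def using C(1) B0 yo D(1)
        by (simp add: prod_ennreal sum_ennreal sum_nonneg prod_nonneg mult_ac flip: ennreal_mult)
      finally show "(\<integral>\<^sup>+ x. ennreal (B (?fx x)) \<partial>lborel) \<le> ennreal (E * B (\<chi> j. y j))" .
    qed
  qed
qed

section \<open>Linear programming duality and chains of subspaces\<close>

text \<open>The first two components are the data of the inequality for \<open>W\<close>; the
  squared dimension is the potential that uncrossing increases.\<close>

definition profile :: "('n::finite \<Rightarrow> 'a::euclidean_space \<Rightarrow> 'b::real_vector) \<Rightarrow> 'a set \<Rightarrow> (real^'n) \<times> real \<times> real"
  where "profile L W = ((\<chi> j. real (dim (L j ` W))), real (dim W), (real (dim W))\<^sup>2)"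

definition profiles :: "('n::finite \<Rightarrow> 'a::euclidean_space \<Rightarrow> 'b::real_vector) \<Rightarrow> ((real^'n) \<times> real \<times> real) set"
  where "profiles L = profile L ` {W. subspace W}"

text \<open>One subspace per profile: the certificates then draw their subspaces from a finite set
  that depends on \<open>L\<close> alone.\<close>

definition profile_rep :: "('n::finite \<Rightarrow> 'a::euclidean_space \<Rightarrow> 'b::real_vector) \<Rightarrow> (real^'n) \<times> real \<times> real \<Rightarrow> 'a set"
  where "profile_rep L p = (SOME W. subspace W \<and> profile L W = p)"

lemma profile_rep: "p \<in> profiles L \<Longrightarrow> subspace (profile_rep L p) \<and> profile L (profile_rep L p) = p"
  unfolding profile_rep_def profiles_def by (rule someI_ex) auto

section \<open>Monotonicity and submodularity of image dimensions\<close>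

lemma dim_image_eq_dim_span_Un:
  fixes f :: "'a::euclidean_space \<Rightarrow> 'b::real_vector"
  assumes "linear f" "subspace W"
  shows "dim (f ` W) + dim {x. f x = 0} = dim (span (W \<union> {x. f x = 0}))"
  using dim_image_linear[OF assms] dim_span_Un_Int[OF assms(2) linear_subspace_kernel[OF assms(1)]] by linarith

lemma dim_image_mono:
  fixes f :: "'a::euclidean_space \<Rightarrow> 'b::real_vector"
  assumes "linear f" "subspace V" "subspace W" "V \<subseteq> W"
  shows "dim (f ` V) \<le> dim (f ` W)"
proof -
  let ?K = "{x. f x = 0}"
  have "dim (span (V \<union> ?K)) \<le> dim (span (W \<union> ?K))"
    by (intro dim_subset span_mono) (use assms(4) in auto)
  then show ?thesis
    using dim_image_eq_dim_span_Un[OF assms(1)] assms(2,3) by (metis add_le_cancel_right)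
qed

text \<open>Once the kernel is added, dimensions of sum and intersection obey an equation; the
  inequality arises because \<open>V \<inter> W + ?K\<close> may be smaller than the intersection of
  \<open>V + ?K\<close> and \<open>W + ?K\<close>.\<close>

lemma dim_image_submodular:
  fixes f :: "'a::euclidean_space \<Rightarrow> 'b::real_vector"
  assumes f: "linear f" and VW: "subspace V" "subspace W"
  shows "dim (f ` span (V \<union> W)) + dim (f ` (V \<inter> W)) \<le> dim (f ` V) + dim (f ` W)"
proof -
  let ?K = "{x. f x = 0}"
  have eq: "span (span (V \<union> ?K) \<union> span (W \<union> ?K)) = span (span (V \<union> W) \<union> ?K)"
    unfolding span_span_Un span_Un_span by (simp add: Un_ac)
  have "dim (span (span (V \<union> W) \<union> ?K)) + dim (span (V \<union> ?K) \<inter> span (W \<union> ?K))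
      = dim (span (V \<union> ?K)) + dim (span (W \<union> ?K))"
    using dim_span_Un_Int[OF subspace_span subspace_span, of "V \<union> ?K" "W \<union> ?K"] unfolding eq .
  moreover have "dim (span (V \<inter> W \<union> ?K)) \<le> dim (span (V \<union> ?K) \<inter> span (W \<union> ?K))"
    by (intro dim_subset Int_greatest span_mono) auto
  ultimately show ?thesis
    using dim_image_eq_dim_span_Un[OF f VW(1)] dim_image_eq_dim_span_Un[OF f VW(2)]
      dim_image_eq_dim_span_Un[OF f subspace_span, of "V \<union> W"]
      dim_image_eq_dim_span_Un[OF f subspace_inter[OF VW]]
    by linarith
qed

lemma finite_profiles:
  fixes L :: "'n::finite \<Rightarrow> 'a::euclidean_space \<Rightarrow> 'b::real_vector"
  assumes "\<And>j. linear (L j)"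
  shows "finite (profiles L)"
proof -
  let ?K = "\<lambda>j. {x. L j x = 0}"
  let ?F = "\<lambda>p :: nat \<times> ('n \<Rightarrow> nat). ((\<chi> j. real (snd p j) - real (dim (?K j))), real (fst p), (real (fst p))\<^sup>2)"
  have "profile L W = ?F (dim W, \<lambda>j. dim (span (W \<union> ?K j)))" if "subspace W" for W
    using dim_image_eq_dim_span_Un[OF assms that]
    by (simp add: profile_def vec_eq_iff eq_diff_eq flip: of_nat_add)
  then have "profiles L \<subseteq> ?F ` (\<lambda>W. (dim W, \<lambda>j. dim (span (W \<union> ?K j)))) ` {W. subspace W}"
    unfolding profiles_def by blast
  then show ?thesis
    by (rule finite_subset) (intro finite_imageI finite_dim_profiles)
qed

text \<open>The upper bound 1 on \<open>s $ i\<close> comes from comparing the inequality for the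
  kernel of \<open>L i\<close>, to which the \<open>i\<close>-th map contributes 0, with the scaling
  identity.\<close>

lemma HBL_polytope_memI:
  fixes L :: "'n::finite \<Rightarrow> real^'d \<Rightarrow> (nat \<Rightarrow>\<^sub>0 real)"
  assumes L: "\<And>j. linear (L j)" "\<And>j. range (L j) = Rn (k j)" and k: "\<And>j. 0 < k j"
    and s0: "\<And>j. 0 \<le> s $ j" and eq: "(\<Sum>j\<in>UNIV. s $ j * real (k j)) = real CARD('d)"
    and ge: "\<And>V. subspace V \<Longrightarrow> real (dim V) \<le> (\<Sum>j\<in>UNIV. s $ j * real (dim (L j ` V)))"
  shows "s \<in> HBL_polytope k L"
proof -
  have "s $ i \<le> 1" for i
  proof -
    let ?K = "{x. L i x = 0}"
    have K: "subspace ?K" by (rule linear_subspace_kernel[OF L(1)])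
    have dk: "dim (L j ` UNIV) = k j" for j by (simp add: L(2) dim_Rn)
    have dK: "dim ?K + k i = CARD('d)"
      using dim_image_linear[OF L(1)[of i] subspace_UNIV] dk[of i] by simp
    have split: "(\<Sum>j\<in>UNIV. f j) = f i + (\<Sum>j\<in>UNIV - {i}. f j)" for f :: "_ \<Rightarrow> real"
      by (rule sum.remove) auto
    have "dim (L i ` ?K) = 0"
      using dim_image_linear[OF L(1)[of i] K] by simp
    then have "real (dim ?K) \<le> (\<Sum>j\<in>UNIV - {i}. s $ j * real (dim (L j ` ?K)))"
      using ge[OF K] by (simp add: split)
    also have "\<dots> \<le> (\<Sum>j\<in>UNIV - {i}. s $ j * real (k j))"
      using dim_image_mono[OF L(1) K subspace_UNIV] dk s0 by (intro sum_mono mult_left_mono) auto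
    also have "\<dots> = real CARD('d) - s $ i * real (k i)"
      using eq by (simp add: split)
    finally have "s $ i * real (k i) \<le> real (k i)"
      using dK by linarith
    then show ?thesis using k[of i] by simp
  qed
  then show ?thesis
    using s0 eq ge by (auto simp: HBL_polytope_def)
qed

text \<open>Farkas: \<open>u\<close> collects the multipliers of the subspace inequalities,
  \<open>\<omega>\<close> is that of the scaling identity, and the slack in the middle condition
  belongs to \<open>0 \<le> s $ j\<close>. A vector separating \<open>(- l, - m)\<close> from the
  cone of consequences would either be 0 or give, after scaling, a point of the polytope at which
  the bound fails.\<close>

lemma dual_certificate:
  fixes L :: "'n::finite \<Rightarrow> real^'d \<Rightarrow> (nat \<Rightarrow>\<^sub>0 real)"
  assumes L: "\<And>j. linear (L j)" "\<And>j. range (L j) = Rn (k j)" and k: "\<And>j. 0 < k j"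
    and m: "\<forall>s\<in>HBL_polytope k L. l \<bullet> s \<le> m"
  shows "\<exists>u \<omega>. (\<forall>p\<in>profiles L. 0 \<le> u p) \<and>
     (\<forall>j. (\<Sum>p\<in>profiles L. u p * fst p $ j) - \<omega> * real (k j) \<le> - l $ j) \<and>
     (\<Sum>p\<in>profiles L. u p * fst (snd p)) - \<omega> * real CARD('d) = - m"
proof -
  let ?Z = "profiles L"
  have Z: "finite ?Z" by (rule finite_profiles[OF L(1)])
  define T where "T = {q :: (real^'n) \<times> real. \<exists>u \<omega>. (\<forall>p\<in>?Z. 0 \<le> u p) \<and>
     (\<forall>j. (\<Sum>p\<in>?Z. u p * fst p $ j) - \<omega> * real (k j) \<le> fst q $ j) \<and>
     (\<Sum>p\<in>?Z. u p * fst (snd p)) - \<omega> * real CARD('d) = snd q}"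
  let ?e = "((\<chi> j. real (k j)) :: real^'n, real CARD('d))"
  \<comment> \<open>Generators for the subspace inequalities, for the scaling identity in both
    directions and for the sign conditions. Their finiteness makes the cone closed, hence separable
    from points outside.\<close>
  define G where "G = (\<lambda>p. (fst p, fst (snd p))) ` ?Z \<union> {?e, - ?e} \<union> range (\<lambda>j. (axis j 1 :: real^'n, 0::real))"
  have "finite G" using Z by (simp add: G_def)
  have T_add: "q + q' \<in> T" if qq: "q \<in> T" "q' \<in> T" for q q'
  proof -
    obtain u \<omega> where u: "\<forall>p\<in>?Z. 0 \<le> u p" "\<And>j. (\<Sum>p\<in>?Z. u p * fst p $ j) - \<omega> * real (k j) \<le> fst q $ j"
       "(\<Sum>p\<in>?Z. u p * fst (snd p)) - \<omega> * real CARD('d) = snd q"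
      using qq(1) unfolding T_def by blast
    obtain u' \<omega>' where u': "\<forall>p\<in>?Z. 0 \<le> u' p" "\<And>j. (\<Sum>p\<in>?Z. u' p * fst p $ j) - \<omega>' * real (k j) \<le> fst q' $ j"
       "(\<Sum>p\<in>?Z. u' p * fst (snd p)) - \<omega>' * real CARD('d) = snd q'"
      using qq(2) unfolding T_def by blast
    show ?thesis
      unfolding T_def mem_Collect_eq
    proof (intro exI[of _ "\<lambda>p. u p + u' p"] exI[of _ "\<omega> + \<omega>'"] conjI allI ballI)
      show "0 \<le> u p + u' p" if "p \<in> ?Z" for p using u(1) u'(1) that by simp
      show "(\<Sum>p\<in>?Z. (u p + u' p) * fst p $ j) - (\<omega> + \<omega>') * real (k j) \<le> fst (q + q') $ j" for j
        using u(2)[of j] u'(2)[of j] by (simp add: distrib_right sum.distrib)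
      show "(\<Sum>p\<in>?Z. (u p + u' p) * fst (snd p)) - (\<omega> + \<omega>') * real CARD('d) = snd (q + q')"
        using u(3) u'(3) by (simp add: distrib_right sum.distrib)
    qed
  qed
  have T_scale: "c *\<^sub>R q \<in> T" if q: "q \<in> T" and c: "c \<ge> 0" for q c
  proof -
    obtain u \<omega> where u: "\<forall>p\<in>?Z. 0 \<le> u p" "\<And>j. (\<Sum>p\<in>?Z. u p * fst p $ j) - \<omega> * real (k j) \<le> fst q $ j"
       "(\<Sum>p\<in>?Z. u p * fst (snd p)) - \<omega> * real CARD('d) = snd q"
      using q unfolding T_def by blast
    have s: "(\<Sum>p\<in>?Z. (c * u p) * g p) - (c * \<omega>) * r = c * ((\<Sum>p\<in>?Z. u p * g p) - \<omega> * r)" for g r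
      by (simp add: sum_distrib_left right_diff_distrib mult.assoc)
    show ?thesis
      unfolding T_def mem_Collect_eq
    proof (intro exI[of _ "\<lambda>p. c * u p"] exI[of _ "c * \<omega>"] conjI allI ballI)
      show "0 \<le> c * u p" if "p \<in> ?Z" for p using u(1) c that by simp
      show "(\<Sum>p\<in>?Z. c * u p * fst p $ j) - c * \<omega> * real (k j) \<le> fst (c *\<^sub>R q) $ j" for j
        unfolding s using mult_left_mono[OF u(2) c] by simp
      show "(\<Sum>p\<in>?Z. c * u p * fst (snd p)) - c * \<omega> * real CARD('d) = snd (c *\<^sub>R q)"
        unfolding s u(3) by simp
    qed
  qed
  have T0: "0 \<in> T"
    unfolding T_def by (auto intro!: exI[of _ "\<lambda>_. 0"] exI[of _ 0])
  have T: "convex_cone T"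
    unfolding convex_cone_iff using T0 T_add T_scale by blast
  have "G \<subseteq> T"
  proof
    fix q assume "q \<in> G"
    then consider (1) p where "p \<in> ?Z" "q = (fst p, fst (snd p))" | (2) "q = ?e" | (3) "q = - ?e"
      | (4) j where "q = (axis j 1, 0)"
      unfolding G_def by blast
    then show "q \<in> T"
    proof cases
      case 1
      have s: "(\<Sum>r\<in>?Z. (if r = p then 1 else 0) * g r) = g p" for g :: "_ \<Rightarrow> real"
        using Z 1(1) by (simp add: if_distrib[of "\<lambda>x. x * _"] sum.delta' cong: if_cong)
      show ?thesis
        unfolding T_def 1(2)
        by (intro CollectI exI[of _ "\<lambda>r. if r = p then 1 else 0"] exI[of _ 0]) (simp only: s, simp)
    next
      case 2
      then show ?thesis unfolding T_def by (auto intro!: exI[of _ "\<lambda>_. 0"] exI[of _ "-1"])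
    next
      case 3
      then show ?thesis unfolding T_def by (auto intro!: exI[of _ "\<lambda>_. 0"] exI[of _ "1"])
    next
      case 4
      then show ?thesis unfolding T_def by (auto intro!: exI[of _ "\<lambda>_. 0"] exI[of _ "0"] simp: axis_def)
    qed
  qed
  then have GT: "convex_cone hull G \<subseteq> T" by (rule hull_minimal[where S = convex_cone, OF _ T])
  have "(- l, - m) \<in> convex_cone hull G"
  proof (rule ccontr)
    let ?H = "convex_cone hull G"
    assume "(- l, - m) \<notin> ?H"
    then obtain a b where ab: "a \<bullet> (- l, - m) < b" "\<And>x. x \<in> ?H \<Longrightarrow> a \<bullet> x > b"
      using separating_hyperplane_closed_point[OF convex_convex_cone_hull closed_convex_cone_hull[OF \<open>finite G\<close>]]
      by metis
    have "b < 0" using ab(2)[OF convex_cone_hull_contains_0] by simp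
    have H0: "a \<bullet> x \<ge> 0" if x: "x \<in> ?H" for x
    proof (rule ccontr)
      assume neg: "\<not> 0 \<le> a \<bullet> x"
      \<comment> \<open>A negative value could be scaled to \<open>b\<close> itself, which strict
        separation forbids.\<close>
      let ?c = "b / (a \<bullet> x)"
      have "?c \<ge> 0" using neg \<open>b < 0\<close> by (simp add: divide_nonpos_neg)
      then have "?c *\<^sub>R x \<in> ?H" by (rule convex_cone_hull_mul[OF x])
      then have "a \<bullet> (?c *\<^sub>R x) > b" by (rule ab(2))
      then show False using neg by simp
    qed
    have G0: "a \<bullet> x \<ge> 0" if "x \<in> G" for x
      by (rule H0) (rule hull_inc[OF that])
    obtain \<sigma> \<rho> where a: "a = (\<sigma>, \<rho>)" by fastforce
    have \<sigma>0: "0 \<le> \<sigma> $ j" for j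
      using G0[of "(axis j 1, 0)"] by (simp add: G_def a inner_axis)
    have e: "(\<Sum>j\<in>UNIV. \<sigma> $ j * real (k j)) = - \<rho> * real CARD('d)"
      using G0[of ?e] G0[of "- ?e"] by (simp add: G_def a inner_vec_def sum_negf)
    have V: "(\<Sum>j\<in>UNIV. \<sigma> $ j * real (dim (L j ` V))) + \<rho> * real (dim V) \<ge> 0" if "subspace V" for V
    proof -
      have "profile L V \<in> ?Z" using that by (simp add: profiles_def)
      then have "(fst (profile L V), fst (snd (profile L V))) \<in> G" unfolding G_def by blast
      from G0[OF this] show ?thesis by (simp add: a profile_def inner_vec_def)
    qed
    have lt: "- (\<sigma> \<bullet> l) - \<rho> * m < 0" using ab(1) \<open>b < 0\<close> by (simp add: a)
    show False
    \<comment> \<open>For negative \<open>\<rho>\<close>, division by \<open>- \<rho>\<close>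
      normalises \<open>\<sigma>\<close> into the polytope; otherwise the positive
      \<open>k j\<close> force \<open>\<sigma> = 0\<close>.\<close>
    proof (cases "\<rho> < 0")
      case True
      have "(1 / - \<rho>) *\<^sub>R \<sigma> \<in> HBL_polytope k L"
      proof (rule HBL_polytope_memI[OF L k])
        show "0 \<le> ((1 / - \<rho>) *\<^sub>R \<sigma>) $ j" for j using \<sigma>0[of j] True by (simp add: divide_nonneg_neg)
        have "(\<Sum>j\<in>UNIV. ((1 / - \<rho>) *\<^sub>R \<sigma>) $ j * real (k j)) = (1 / - \<rho>) * (\<Sum>j\<in>UNIV. \<sigma> $ j * real (k j))"
          by (simp add: sum_distrib_left)
        also have "\<dots> = real CARD('d)" unfolding e using True by simp
        finally show "(\<Sum>j\<in>UNIV. ((1 / - \<rho>) *\<^sub>R \<sigma>) $ j * real (k j)) = real CARD('d)" .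
        fix V :: "(real^'d) set" assume "subspace V"
        have "- \<rho> * real (dim V) \<le> (\<Sum>j\<in>UNIV. \<sigma> $ j * real (dim (L j ` V)))"
          using V[OF \<open>subspace V\<close>] by simp
        then have "real (dim V) \<le> (1 / - \<rho>) * (\<Sum>j\<in>UNIV. \<sigma> $ j * real (dim (L j ` V)))"
          using True by (simp add: field_simps)
        also have "\<dots> = (\<Sum>j\<in>UNIV. ((1 / - \<rho>) *\<^sub>R \<sigma>) $ j * real (dim (L j ` V)))"
          by (simp add: sum_distrib_left)
        finally show "real (dim V) \<le> (\<Sum>j\<in>UNIV. ((1 / - \<rho>) *\<^sub>R \<sigma>) $ j * real (dim (L j ` V)))" .
      qed
      then have "l \<bullet> ((1 / - \<rho>) *\<^sub>R \<sigma>) \<le> m" using m by blast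
      then have "\<sigma> \<bullet> l \<le> - \<rho> * m" using True by (simp add: field_simps inner_commute)
      then show False using lt by simp
    next
      case False
      then have "(\<Sum>j\<in>UNIV. \<sigma> $ j * real (k j)) \<le> 0" using e by simp
      moreover have "0 \<le> \<sigma> $ j * real (k j)" for j using \<sigma>0 by simp
      ultimately have "\<forall>j\<in>UNIV. \<sigma> $ j * real (k j) = 0"
        by (subst sum_nonneg_eq_0_iff[symmetric]) (auto intro!: antisym sum_nonneg simp del: mult_eq_0_iff)
      then have "\<sigma> $ j = 0" for j using k[of j] by (metis UNIV_I mult_eq_0_iff of_nat_eq_0_iff less_irrefl)
      then have "\<sigma> = 0" by (simp add: vec_eq_iff)
      then have "\<rho> = 0" using e by simp
      then show False using lt \<open>\<sigma> = 0\<close> by simp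
    qed
  qed
  then have "(- l, - m) \<in> T" using GT by blast
  then show ?thesis unfolding T_def by simp
qed

text \<open>Among all dual certificates of a given total weight, one that maximises the weighted sum of the
  squared dimensions is supported on a chain: replacing two incomparable subspaces by their sum and
  their intersection keeps the certificate valid and strictly increases that sum.\<close>

lemma chain_certificate:
  fixes L :: "'n::finite \<Rightarrow> real^'d \<Rightarrow> (nat \<Rightarrow>\<^sub>0 real)"
  assumes L: "\<And>j. linear (L j)" "\<And>j. range (L j) = Rn (k j)" and k: "\<And>j. 0 < k j"
    and m: "\<forall>s\<in>HBL_polytope k L. l \<bullet> s \<le> m"
  shows "\<exists>\<C> u \<omega>. \<C> \<subseteq> profile_rep L ` profiles L \<and> (\<forall>V\<in>\<C>. \<forall>W\<in>\<C>. V \<subseteq> W \<or> W \<subseteq> V) \<and>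
     (\<forall>W\<in>\<C>. 0 \<le> u W) \<and>
     (\<forall>j. (\<Sum>W\<in>\<C>. u W * real (dim (L j ` W))) - \<omega> * real (k j) \<le> - l $ j) \<and>
     (\<Sum>W\<in>\<C>. u W * real (dim W)) - \<omega> * real CARD('d) = - m"
proof -
  let ?Z = "profiles L"
  have Z: "finite ?Z" by (rule finite_profiles[OF L(1)])
  obtain u0 \<omega> where u0: "\<forall>p\<in>?Z. 0 \<le> u0 p" "\<And>j. (\<Sum>p\<in>?Z. u0 p * fst p $ j) - \<omega> * real (k j) \<le> - l $ j"
     "(\<Sum>p\<in>?Z. u0 p * fst (snd p)) - \<omega> * real CARD('d) = - m"
    using dual_certificate[OF L k m] by blast
  let ?z = "profile L {0}"
  have zZ: "?z \<in> ?Z" by (auto simp: profiles_def)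
  have "dim {0 :: nat \<Rightarrow>\<^sub>0 real} = 0"
    by (rule dim_unique[of "{}"]) (auto simp: independent_empty)
  then have z0: "fst ?z = 0" "fst (snd ?z) = 0"
    by (auto simp: profile_def vec_eq_iff linear_0[OF L(1)])
  \<comment> \<open>Weight on the zero subspace leaves the sums in the certificate unchanged and
    makes the total \<open>M\<close> positive, as the passage to a convex combination
    requires.\<close>
  define u where "u p = u0 p + (if p = ?z then 1 else 0)" for p
  have usum: "(\<Sum>p\<in>?Z. u p * g p) = (\<Sum>p\<in>?Z. u0 p * g p)" if "g ?z = 0" for g :: "_ \<Rightarrow> real"
    using that by (intro sum.cong) (auto simp: u_def)
  have u_nonneg: "0 \<le> u p" if "p \<in> ?Z" for p using u0(1) that by (simp add: u_def)
  define M where "M = (\<Sum>p\<in>?Z. u p)"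
  have "M \<ge> u ?z" unfolding M_def using u_nonneg zZ Z by (intro member_le_sum) auto
  then have M: "M > 0" using u0(1) zZ by (force simp: u_def)
  define x0 where "x0 = (\<Sum>p\<in>?Z. (u p / M) *\<^sub>R p)"
  have x0_hull: "x0 \<in> convex hull ?Z"
    unfolding convex_hull_finite[OF Z] x0_def
    using u_nonneg M by (auto intro!: exI[of _ "\<lambda>p. u p / M"] simp: M_def simp flip: sum_divide_distrib)
  \<comment> \<open>Convex combinations of profiles that are at least as good as \<open>x0\<close>.
    Compactness yields a maximiser of the squared component.\<close>
  define X where "X = convex hull ?Z \<inter> ((\<Inter>j. {x. fst x $ j \<le> fst x0 $ j}) \<inter> {x. fst (snd x) = fst (snd x0)})"
  have "compact X"
    unfolding X_def
    by (intro compact_Int_closed finite_imp_compact_convex_hull[OF Z] closed_Int closed_INT ballI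
        closed_Collect_le closed_Collect_eq continuous_intros)
  moreover have "X \<noteq> {}" using x0_hull by (auto simp: X_def)
  moreover have "continuous_on X (\<lambda>x. snd (snd x))" by (intro continuous_intros)
  ultimately obtain x where x: "x \<in> X" "\<And>y. y \<in> X \<Longrightarrow> snd (snd y) \<le> snd (snd x)"
    using continuous_attains_sup[of X "\<lambda>x. snd (snd x)"] by blast
  then obtain v where v: "\<And>p. p \<in> ?Z \<Longrightarrow> 0 \<le> v p" "sum v ?Z = 1" "(\<Sum>p\<in>?Z. v p *\<^sub>R p) = x"
    unfolding X_def convex_hull_finite[OF Z] by blast
  let ?S = "{p\<in>?Z. 0 < v p}"
  let ?R = "profile_rep L"
  have chain: "?R p \<subseteq> ?R q \<or> ?R q \<subseteq> ?R p" if p: "p \<in> ?S" and q: "q \<in> ?S" for p q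
  proof (rule ccontr)
    assume nc: "\<not> (?R p \<subseteq> ?R q \<or> ?R q \<subseteq> ?R p)"
    then have "p \<noteq> q" by auto
    have Rp: "subspace (?R p)" "profile L (?R p) = p" and Rq: "subspace (?R q)" "profile L (?R q) = q"
      using profile_rep[of p L] profile_rep[of q L] p q by simp_all
    let ?A = "?R p" and ?B = "?R q"
    let ?D = "span (?A \<union> ?B)" and ?I = "?A \<inter> ?B"
    have DI: "subspace ?D" "subspace ?I" using Rp Rq by (auto intro: subspace_inter)
    have dimeq: "dim ?D + dim ?I = dim ?A + dim ?B" by (rule dim_span_Un_Int[OF Rp(1) Rq(1)])
    have "?A \<noteq> ?D" "?A \<subseteq> ?D" using nc by (auto intro: span_base)
    then have lt: "dim ?A < dim ?D"
      using Rp DI subspace_dim_equal dim_subset by (metis not_le)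
    have "?B \<noteq> ?D" "?B \<subseteq> ?D" using nc by (auto intro: span_base)
    then have lt': "dim ?B < dim ?D"
      using Rq DI subspace_dim_equal dim_subset by (metis not_le)
    define p1 where "p1 = profile L ?D"
    define q1 where "q1 = profile L ?I"
    have p1q1: "p1 \<in> ?Z" "q1 \<in> ?Z" using DI by (auto simp: p1_def q1_def profiles_def)
    \<comment> \<open>The largest mass that can be moved from \<open>p\<close> and \<open>q\<close>
      to the profiles of the sum and the intersection while the weights stay nonnegative.\<close>
    define \<epsilon> where "\<epsilon> = min (v p) (v q)"
    have \<epsilon>: "\<epsilon> > 0" "\<epsilon> \<le> v p" "\<epsilon> \<le> v q" using p q by (auto simp: \<epsilon>_def)
    define \<delta> :: "_ \<Rightarrow> _ \<Rightarrow> real" where "\<delta> r s = (if s = r then 1 else 0)" for r s :: "(real^'n) \<times> real \<times> real"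
    define w where "w r = v r + \<epsilon> * (\<delta> p1 r + \<delta> q1 r - \<delta> p r - \<delta> q r)" for r
    have \<delta>: "(\<Sum>r\<in>?Z. \<delta> s r) = 1" "(\<Sum>r\<in>?Z. \<delta> s r *\<^sub>R r) = s" if "s \<in> ?Z" for s
      using that Z by (simp_all add: \<delta>_def sum.delta' if_distrib[of "\<lambda>x. x *\<^sub>R _"] cong: if_cong)
    have pq: "p \<in> ?Z" "q \<in> ?Z" using p q by auto
    have "0 \<le> w r" if "r \<in> ?Z" for r
    proof -
      have "\<epsilon> * (\<delta> p r + \<delta> q r) \<le> v r"
        using \<epsilon> \<open>p \<noteq> q\<close> v(1)[OF that] by (auto simp: \<delta>_def)
      moreover have "0 \<le> \<epsilon> * (\<delta> p1 r + \<delta> q1 r)"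
        using \<epsilon>(1) by (auto simp: \<delta>_def)
      ultimately show ?thesis
        by (simp add: w_def algebra_simps)
    qed
    moreover have "sum w ?Z = 1"
      using v(2) \<delta>(1) p1q1 pq
      by (simp add: w_def sum.distrib sum_subtractf flip: sum_distrib_left)
    moreover have wx: "(\<Sum>r\<in>?Z. w r *\<^sub>R r) = x + \<epsilon> *\<^sub>R (p1 + q1 - p - q)"
    proof -
      have "(\<Sum>r\<in>?Z. w r *\<^sub>R r) = (\<Sum>r\<in>?Z. v r *\<^sub>R r)
          + \<epsilon> *\<^sub>R ((\<Sum>r\<in>?Z. \<delta> p1 r *\<^sub>R r) + (\<Sum>r\<in>?Z. \<delta> q1 r *\<^sub>R r) - (\<Sum>r\<in>?Z. \<delta> p r *\<^sub>R r) - (\<Sum>r\<in>?Z. \<delta> q r *\<^sub>R r))"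
        unfolding w_def scaleR_sum_right sum.distrib[symmetric] sum_subtractf[symmetric]
        by (intro sum.cong refl) (simp add: scaleR_add_left scaleR_diff_left scaleR_add_right scaleR_diff_right right_diff_distrib distrib_left)
      then show ?thesis using v(3) \<delta>(2) p1q1 pq by simp
    qed
    ultimately have hull: "x + \<epsilon> *\<^sub>R (p1 + q1 - p - q) \<in> convex hull ?Z"
      unfolding convex_hull_finite[OF Z] by blast
    let ?y = "x + \<epsilon> *\<^sub>R (p1 + q1 - p - q)"
    have le: "fst ?y $ j \<le> fst x $ j" for j
    proof -
      have "fst (p1 + q1 - p - q) $ j = real (dim (L j ` ?D)) + real (dim (L j ` ?I)) - real (dim (L j ` ?A)) - real (dim (L j ` ?B))"
        using arg_cong[OF Rp(2), of "\<lambda>p. fst p $ j"] arg_cong[OF Rq(2), of "\<lambda>p. fst p $ j"]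
        by (simp add: p1_def q1_def profile_def)
      also have "\<dots> \<le> 0"
        using dim_image_submodular[OF L(1)[of j] Rp(1) Rq(1)] by linarith
      finally show ?thesis using \<epsilon>(1) by (simp add: mult_nonneg_nonpos)
    qed
    have eq: "fst (snd ?y) = fst (snd x)"
    proof -
      have "fst (snd (p1 + q1 - p - q)) = real (dim ?D) + real (dim ?I) - real (dim ?A) - real (dim ?B)"
        using arg_cong[OF Rp(2), of "\<lambda>p. fst (snd p)"] arg_cong[OF Rq(2), of "\<lambda>p. fst (snd p)"]
        by (simp add: p1_def q1_def profile_def)
      also have "\<dots> = 0" using dimeq by linarith
      finally show ?thesis by simp
    qed
    have "fst x $ j \<le> fst x0 $ j" for j using x(1) by (simp add: X_def)
    then have "fst ?y $ j \<le> fst x0 $ j" for j by (rule order_trans[OF le])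
    moreover have "fst (snd ?y) = fst (snd x0)" using eq x(1) by (simp add: X_def)
    ultimately have "?y \<in> X"
      unfolding X_def using hull by blast
    then have "snd (snd ?y) \<le> snd (snd x)" by (rule x(2))
    then have "snd (snd (p1 + q1 - p - q)) \<le> 0"
      using \<epsilon>(1) by (simp add: mult_le_0_iff)
    moreover have "snd (snd (p1 + q1 - p - q)) = (real (dim ?D))\<^sup>2 + (real (dim ?I))\<^sup>2 - (real (dim ?A))\<^sup>2 - (real (dim ?B))\<^sup>2"
      using arg_cong[OF Rp(2), of "\<lambda>p. snd (snd p)"] arg_cong[OF Rq(2), of "\<lambda>p. snd (snd p)"]
      by (simp add: p1_def q1_def profile_def)
    \<comment> \<open>Strict convexity of the square: sum and intersection have the same total
      dimension as the two subspaces but lie further apart.\<close>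
    moreover have "(a\<^sup>2 + i\<^sup>2 - c\<^sup>2 - e\<^sup>2 :: real) > 0" if "a + i = c + e" "c < a" "e < a" for a i c e
    proof -
      have e: "e = a + i - c" using that by simp
      have "a\<^sup>2 + i\<^sup>2 - c\<^sup>2 - e\<^sup>2 = 2 * ((a - c) * (c - i))"
        unfolding e by (simp add: power2_eq_square algebra_simps)
      moreover have "i < c" using that by simp
      ultimately show ?thesis using that by simp
    qed
    ultimately show False
      using dimeq lt lt' by (smt (verit) of_nat_add of_nat_le_iff of_nat_less_iff)
  qed
  have inj: "inj_on ?R ?S"
    by (rule inj_onI) (metis (no_types, lifting) mem_Collect_eq profile_rep)
  have sum_chain: "(\<Sum>W\<in>?R ` ?S. (M * v (profile L W)) * g (profile L W)) = M * (\<Sum>p\<in>?Z. v p * g p)"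
    for g :: "_ \<Rightarrow> real"
  proof -
    have "(\<Sum>W\<in>?R ` ?S. (M * v (profile L W)) * g (profile L W)) = (\<Sum>p\<in>?S. (M * v p) * g p)"
      unfolding sum.reindex[OF inj] by (intro sum.cong) (simp_all add: profile_rep)
    also have "\<dots> = (\<Sum>p\<in>?Z. (M * v p) * g p)"
      using Z v(1) by (intro sum.mono_neutral_left) (auto simp: less_le)
    finally show ?thesis by (simp add: sum_distrib_left mult.assoc)
  qed
  have xc: "(\<Sum>p\<in>?Z. v p * fst p $ j) = fst x $ j" "(\<Sum>p\<in>?Z. v p * fst (snd p)) = fst (snd x)" for j
    using v(3) by (auto simp: fst_sum snd_sum)
  have x0c: "M * fst x0 $ j = (\<Sum>p\<in>?Z. u0 p * fst p $ j)" "M * fst (snd x0) = (\<Sum>p\<in>?Z. u0 p * fst (snd p))" for j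
    using M usum[of "\<lambda>p. fst p $ j"] usum[of "\<lambda>p. fst (snd p)"] z0
    by (auto simp: x0_def fst_sum snd_sum sum_distrib_left)
  show ?thesis
  proof (intro exI[of _ "?R ` ?S"] exI[of _ "\<lambda>W. M * v (profile L W)"] exI[of _ \<omega>] conjI ballI allI)
    show "?R ` ?S \<subseteq> ?R ` ?Z" by auto
    show "V \<subseteq> W \<or> W \<subseteq> V" if "V \<in> ?R ` ?S" "W \<in> ?R ` ?S" for V W
      using that chain by blast
    show "0 \<le> M * v (profile L W)" if "W \<in> ?R ` ?S" for W
    proof -
      obtain p where p: "p \<in> ?S" "W = ?R p" using \<open>W \<in> ?R ` ?S\<close> by blast
      then have "profile L W = p" by (simp add: profile_rep)
      then show ?thesis using p(1) M by simp
    qed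
    fix j
    have "(\<Sum>W\<in>?R ` ?S. M * v (profile L W) * real (dim (L j ` W))) = M * fst x $ j"
      using sum_chain[of "\<lambda>p. fst p $ j"] xc(1)[of j] by (simp add: profile_def)
    also have "\<dots> \<le> M * fst x0 $ j"
      using x(1) M unfolding X_def by (intro mult_left_mono) auto
    also have "\<dots> \<le> \<omega> * real (k j) - l $ j"
      using u0(2)[of j] by (simp add: x0c)
    finally show "(\<Sum>W\<in>?R ` ?S. M * v (profile L W) * real (dim (L j ` W))) - \<omega> * real (k j) \<le> - l $ j"
      by simp
  next
    have "(\<Sum>W\<in>?R ` ?S. M * v (profile L W) * real (dim W)) = M * fst (snd x)"
      using sum_chain[of "\<lambda>p. fst (snd p)"] xc(2) by (simp add: profile_def)
    also have "\<dots> = M * fst (snd x0)"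
      using x(1) unfolding X_def by simp
    finally show "(\<Sum>W\<in>?R ` ?S. M * v (profile L W) * real (dim W)) - \<omega> * real CARD('d) = - m"
      using u0(3) by (simp add: x0c)
  qed
qed

section \<open>Boxes adapted to a chain\<close>

lemma closed_functional_box:
  fixes \<phi> :: "'i \<Rightarrow> 'a::euclidean_space \<Rightarrow> real"
  assumes "\<And>i. i \<in> I \<Longrightarrow> linear (\<phi> i)"
  shows "closed {x. \<forall>i\<in>I. \<bar>\<phi> i x\<bar> \<le> \<rho> i}"
proof -
  have "{x. \<forall>i\<in>I. \<bar>\<phi> i x\<bar> \<le> \<rho> i} = (\<Inter>i\<in>I. {x. \<bar>\<phi> i x\<bar> \<le> \<rho> i})" by auto
  also have "closed \<dots>"
    using assms by (intro closed_INT ballI closed_Collect_le continuous_intros linear_continuous_on)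
      (simp_all add: linear_conv_bounded_linear)
  finally show ?thesis .
qed

text \<open>Along the vectors \<open>b i\<close> the functionals are the coordinates, so the
  indicator splits into indicators of intervals of length \<open>2 * \<rho> i\<close>.\<close>

lemma span_int_functional_box:
  fixes \<phi> :: "'i \<Rightarrow> 'a::euclidean_space \<Rightarrow> real" and b :: "'i \<Rightarrow> 'a"
  assumes dist: "distinct is" and lin: "\<And>i. i \<in> set is \<Longrightarrow> linear (\<phi> i)"
    and dual: "\<And>i j. i \<in> set is \<Longrightarrow> j \<in> set is \<Longrightarrow> \<phi> i (b j) = (if i = j then 1 else 0)"
    and \<rho>: "\<And>i. i \<in> set is \<Longrightarrow> 0 \<le> \<rho> i"
  shows "span_int (map b is) (indicator {x. \<forall>i\<in>set is. \<bar>\<phi> i x\<bar> \<le> \<rho> i}) 0 = ennreal (\<Prod>i\<in>set is. 2 * \<rho> i)"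
proof -
  let ?Q = "{x. \<forall>i\<in>set is. \<bar>\<phi> i x\<bar> \<le> \<rho> i}"
  interpret product_sigma_finite "\<lambda>_::'i. lborel :: real measure" ..
  have Q: "?Q \<in> sets borel"
    using closed_functional_box[of "set is" \<phi>, OF lin] by (rule borel_closed)
  have "\<phi> i (\<Sum>j\<in>set is. t j *\<^sub>R b j) = t i" if i: "i \<in> set is" for i t
  proof -
    have "\<phi> i (\<Sum>j\<in>set is. t j *\<^sub>R b j) = (\<Sum>j\<in>set is. t j * (if i = j then 1 else 0))"
      using dual[OF i] by (simp add: linear_sum[OF lin[OF i]] linear_scale[OF lin[OF i]])
    also have "\<dots> = (\<Sum>j\<in>set is. if i = j then t j else 0)"
      by (intro sum.cong) auto
    finally show ?thesis using i by simp
  qed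
  then have Qiff: "(\<Sum>j\<in>set is. t j *\<^sub>R b j) \<in> ?Q \<longleftrightarrow> (\<forall>i\<in>set is. t i \<in> {- \<rho> i..\<rho> i})" for t
    by (simp add: abs_le_iff minus_le_iff conj_commute)
  have ind: "indicator ?Q (\<Sum>j\<in>set is. t j *\<^sub>R b j)
      = (\<Prod>i\<in>set is. indicator {- \<rho> i..\<rho> i} (t i) :: ennreal)" for t
  proof (cases "\<forall>i\<in>set is. t i \<in> {- \<rho> i..\<rho> i}")
    case True
    then have "(\<Sum>j\<in>set is. t j *\<^sub>R b j) \<in> ?Q" using Qiff by blast
    moreover have "(\<Prod>i\<in>set is. indicator {- \<rho> i..\<rho> i} (t i) :: ennreal) = 1"
      using True by (intro prod.neutral) (auto simp: indicator_def)
    ultimately show ?thesis by (simp only: indicator_simps)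
  next
    case False
    then obtain i where i: "i \<in> set is" "t i \<notin> {- \<rho> i..\<rho> i}" by blast
    have "(\<Sum>j\<in>set is. t j *\<^sub>R b j) \<notin> ?Q" using False Qiff by blast
    moreover have "(\<Prod>i\<in>set is. indicator {- \<rho> i..\<rho> i} (t i) :: ennreal) = 0"
      using i by (intro prod_zero) (auto simp: indicator_def)
    ultimately show ?thesis by (simp only: indicator_simps not_False_eq_True)
  qed
  have "span_int (map b is) (indicator ?Q) 0
      = (\<integral>\<^sup>+ t. indicator ?Q (0 + (\<Sum>j\<in>set is. t j *\<^sub>R b j)) \<partial>Pi\<^sub>M (set is) (\<lambda>_. lborel))"
    using Q by (intro nn_integral_PiM_eq_span_int[symmetric] dist) auto
  also have "\<dots> = (\<integral>\<^sup>+ t. (\<Prod>i\<in>set is. indicator {- \<rho> i..\<rho> i} (t i)) \<partial>Pi\<^sub>M (set is) (\<lambda>_. lborel))"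
    by (simp only: add_0 ind)
  also have "\<dots> = (\<Prod>i\<in>set is. \<integral>\<^sup>+ x. indicator {- \<rho> i..\<rho> i} x \<partial>lborel)"
    by (intro product_nn_integral_prod) auto
  also have "\<dots> = (\<Prod>i\<in>set is. ennreal (2 * \<rho> i))"
    using \<rho> by (intro prod.cong) auto
  also have "\<dots> = ennreal (\<Prod>i\<in>set is. 2 * \<rho> i)"
    using \<rho> by (intro prod_ennreal) auto
  finally show ?thesis .
qed

text \<open>By counting, a basis of \<open>K\<close> together with the vectors \<open>b i\<close> is
  a basis of the whole space; the functionals are the members of its dual basis that belong to the
  \<open>b i\<close>.\<close>

lemma dual_functionals_exist:
  fixes K :: "'a::euclidean_space set"
  assumes K: "subspace K" and G: "finite G" and sp: "span (K \<union> b ` G) = UNIV"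
    and card: "dim K + card G = DIM('a)"
  shows "\<exists>\<phi>. \<forall>i\<in>G. linear (\<phi> i) \<and> (\<forall>x\<in>K. \<phi> i x = 0) \<and>
    (\<forall>j\<in>G. \<phi> i (b j) = (if i = j then 1 else (0::real)))"
proof -
  obtain B where B: "B \<subseteq> K" "independent B" "K \<subseteq> span B" "card B = dim K"
    using basis_exists by blast
  have "finite B" using B(2) by (rule independent_imp_finite)
  have "span (B \<union> b ` G) = span (span B \<union> b ` G)" by (simp add: span_span_Un)
  also have "span B = K" using B(1,3) K by (metis span_minimal subset_antisym)
  finally have sp': "span (B \<union> b ` G) = UNIV" using sp by simp
  have c1: "card (B \<union> b ` G) + card (B \<inter> b ` G) = card B + card (b ` G)"
    using card_Un_Int[of B "b ` G"] \<open>finite B\<close> G by simp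
  have c2: "card (b ` G) \<le> card G" by (rule card_image_le[OF G])
  have ind: "independent (B \<union> b ` G)"
    using sp' c1 c2 card B(4) \<open>finite B\<close> G by (intro card_le_dim_spanning[of _ UNIV]) auto
  have "card (B \<union> b ` G) = DIM('a)"
    using dim_eq_card[OF _ ind, of UNIV] sp' by simp
  then have "card (b ` G) = card G" "card (B \<inter> b ` G) = 0"
    using c1 c2 card B(4) by linarith+
  then have inj: "inj_on b G" and disj: "B \<inter> b ` G = {}"
    using G \<open>finite B\<close> by (auto intro: eq_card_imp_inj_on)
  have "\<exists>f. linear f \<and> (\<forall>x\<in>K. f x = 0) \<and> (\<forall>j\<in>G. f (b j) = (if i = j then 1 else (0::real)))"
    if i: "i \<in> G" for i
  proof -
    obtain f where f: "linear f" "\<And>x. x \<in> B \<union> b ` G \<Longrightarrow> f x = (if x = b i then 1 else (0::real))"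
      using linear_independent_extend[OF ind, of "\<lambda>x. if x = b i then 1 else (0::real)"] by blast
    have "x \<noteq> b i" if "x \<in> B" for x using disj i that by blast
    then have "B \<subseteq> {x. f x = 0}" using f(2) by auto
    then have "K \<subseteq> {x. f x = 0}"
      using span_minimal[OF _ linear_subspace_kernel[OF f(1)]] B(3) by blast
    moreover have "f (b j) = (if i = j then 1 else 0)" if "j \<in> G" for j
      using f(2)[of "b j"] inj i that by (auto dest: inj_onD)
    ultimately show ?thesis using f(1) by blast
  qed
  then show ?thesis by metis
qed

text \<open>Greedy selection of vectors that are independent modulo \<open>K\<close>. If
  \<open>K\<close> is the kernel of a map, the number of selected indices below \<open>h\<close> is
  the dimension of the image of the span of the first \<open>h\<close> vectors; this turns products
  of side lengths into the exponents of a certificate.\<close>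

definition new_indices :: "'a::euclidean_space set \<Rightarrow> (nat \<Rightarrow> 'a) \<Rightarrow> nat \<Rightarrow> nat set" where
  "new_indices K b n = {i. i < n \<and> b i \<notin> span (K \<union> b ` {..<i})}"

lemma finite_new_indices [simp]: "finite (new_indices K b n)"
  by (simp add: new_indices_def)

lemma new_indices_Suc: "new_indices K b (Suc n)
    = (if b n \<in> span (K \<union> b ` {..<n}) then new_indices K b n else insert n (new_indices K b n))"
  by (auto simp: new_indices_def less_Suc_eq)

lemma dim_span_Un_image_lessThan:
  "dim (span (K \<union> b ` {..<n})) = dim K + card (new_indices K b n)"
proof (induction n)
  case 0
  show ?case by (simp add: new_indices_def)
next
  case (Suc n)
  have "n \<notin> new_indices K b n" by (simp add: new_indices_def)
  then show ?case
    using Suc by (auto simp: lessThan_Suc new_indices_Suc dim_insert)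
qed

lemma span_Un_image_new_indices:
  "span (K \<union> b ` {..<n}) = span (K \<union> b ` new_indices K b n)"
proof (induction n)
  case 0
  show ?case by (simp add: new_indices_def)
next
  case (Suc n)
  have "span (K \<union> b ` {..<Suc n}) = span (insert (b n) (span (K \<union> b ` {..<n})))"
    using span_insert_span[of "{}" "b n" "K \<union> b ` {..<n}"] by (simp add: lessThan_Suc)
  also have "\<dots> = span (K \<union> b ` new_indices K b (Suc n))"
  proof (cases "b n \<in> span (K \<union> b ` {..<n})")
    case True
    then show ?thesis using Suc by (simp add: new_indices_Suc insert_absorb)
  next
    case False
    then show ?thesis
      using span_insert_span[of "{}" "b n" "K \<union> b ` new_indices K b n"] Suc
      by (simp add: new_indices_Suc)
  qed
  finally show ?case .
qed

text \<open>With decreasing side lengths, the coordinate of a box point along a new direction only sees the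
  sides of that and of later directions.\<close>

lemma box_functional_bound:
  fixes K :: "'a::euclidean_space set" and b :: "nat \<Rightarrow> 'a"
  assumes K: "subspace K" and b: "span (b ` {..<DIM('a)}) = UNIV"
  defines "G \<equiv> new_indices K b (DIM('a))"
  shows "\<exists>\<phi> \<Gamma>. \<Gamma> \<ge> 1 \<and> (\<forall>i\<in>G. linear (\<phi> i) \<and> (\<forall>x\<in>K. \<phi> i x = 0) \<and>
       (\<forall>j\<in>G. \<phi> i (b j) = (if i = j then 1 else (0::real)))) \<and>
     (\<forall>r \<tau>. (\<forall>i<DIM('a). 0 < r i) \<and> (\<forall>i j. i \<le> j \<longrightarrow> j < DIM('a) \<longrightarrow> r j \<le> r i) \<and>
        (\<forall>i<DIM('a). \<bar>\<tau> i\<bar> \<le> r i) \<longrightarrow>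
        (\<forall>i\<in>G. \<bar>\<phi> i (\<Sum>j<DIM('a). \<tau> j *\<^sub>R b j)\<bar> \<le> \<Gamma> * r i))"
proof -
  let ?d = "DIM('a)"
  have full: "span (K \<union> b ` {..<?d}) = UNIV"
    using b span_mono[of "b ` {..<?d}" "K \<union> b ` {..<?d}"] by auto
  have fin: "finite G" by (simp add: G_def)
  have sp: "span (K \<union> b ` G) = UNIV"
    using span_Un_image_new_indices[of K b ?d] full by (simp add: G_def)
  have dims: "dim K + card G = ?d"
    using dim_span_Un_image_lessThan[of K b ?d] unfolding full G_def by simp
  obtain \<phi> where \<phi>: "\<And>i. i \<in> G \<Longrightarrow> linear (\<phi> i)" "\<And>i x. i \<in> G \<Longrightarrow> x \<in> K \<Longrightarrow> \<phi> i x = 0"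
     "\<And>i j. i \<in> G \<Longrightarrow> j \<in> G \<Longrightarrow> \<phi> i (b j) = (if i = j then 1 else (0::real))"
    using dual_functionals_exist[OF K fin sp dims] by blast
  \<comment> \<open>A rejected earlier vector lies in the span of \<open>K\<close> and the earlier
    selected ones, all of which \<open>\<phi> i\<close> kills.\<close>
  have zero: "\<phi> i (b j) = 0" if i: "i \<in> G" and "j < i" for i j
  proof -
    have "K \<union> b ` new_indices K b i \<subseteq> {x. \<phi> i x = 0}"
      using \<phi>(2)[OF i] \<phi>(3)[OF i] i by (auto simp: new_indices_def G_def)
    then have "span (K \<union> b ` {..<i}) \<subseteq> {x. \<phi> i x = 0}"
      unfolding span_Un_image_new_indices[of K b i]
      by (rule span_minimal[OF _ linear_subspace_kernel[OF \<phi>(1)[OF i]]])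
    moreover have "b j \<in> span (K \<union> b ` {..<i})" using \<open>j < i\<close> by (intro span_base) auto
    ultimately show ?thesis by blast
  qed
  define \<Gamma> where "\<Gamma> = 1 + (\<Sum>i\<in>G. \<Sum>j<?d. \<bar>\<phi> i (b j)\<bar>)"
  have "\<Gamma> \<ge> 1" by (simp add: \<Gamma>_def sum_nonneg)
  moreover have "\<bar>\<phi> i (\<Sum>j<?d. \<tau> j *\<^sub>R b j)\<bar> \<le> \<Gamma> * r i"
    if r: "\<forall>i<?d. 0 < r i" "\<forall>i j. i \<le> j \<longrightarrow> j < ?d \<longrightarrow> r j \<le> r i" "\<forall>i<?d. \<bar>\<tau> i\<bar> \<le> r i"
      and i: "i \<in> G" for r \<tau> i
  proof -
    have id: "i < ?d" using i by (simp add: G_def new_indices_def)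
    have "\<bar>\<phi> i (\<Sum>j<?d. \<tau> j *\<^sub>R b j)\<bar> = \<bar>\<Sum>j<?d. \<tau> j * \<phi> i (b j)\<bar>"
      by (simp add: linear_sum[OF \<phi>(1)[OF i]] linear_scale[OF \<phi>(1)[OF i]])
    also have "\<dots> \<le> (\<Sum>j<?d. \<bar>\<tau> j * \<phi> i (b j)\<bar>)" by (rule sum_abs)
    also have "\<dots> \<le> (\<Sum>j<?d. r i * \<bar>\<phi> i (b j)\<bar>)"
    proof (rule sum_mono)
      fix j assume "j \<in> {..<?d}"
      show "\<bar>\<tau> j * \<phi> i (b j)\<bar> \<le> r i * \<bar>\<phi> i (b j)\<bar>"
      proof (cases "j < i")
        case True
        then show ?thesis using zero[OF i] by simp
      next
        case False
        then have "\<bar>\<tau> j\<bar> \<le> r i"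
          using r \<open>j \<in> {..<?d}\<close> by (meson lessThan_iff not_le order_trans)
        then show ?thesis by (simp add: abs_mult mult_right_mono)
      qed
    qed
    also have "\<dots> = r i * (\<Sum>j<?d. \<bar>\<phi> i (b j)\<bar>)" by (simp add: sum_distrib_left)
    also have "\<dots> \<le> r i * \<Gamma>"
    proof (rule mult_left_mono)
      have "(\<Sum>j<?d. \<bar>\<phi> i (b j)\<bar>) \<le> (\<Sum>i\<in>G. \<Sum>j<?d. \<bar>\<phi> i (b j)\<bar>)"
        using i by (intro member_le_sum) (auto simp: G_def sum_nonneg)
      then show "(\<Sum>j<?d. \<bar>\<phi> i (b j)\<bar>) \<le> \<Gamma>" by (simp add: \<Gamma>_def)
      show "0 \<le> r i" using r(1) id by (simp add: less_imp_le)
    qed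
    finally show ?thesis by (simp add: mult.commute)
  qed
  ultimately show ?thesis using \<phi> by blast
qed

lemma basis_mod_new_indices:
  fixes K :: "'a::euclidean_space set"
  assumes "subspace K" "span (b ` {..<DIM('a)}) = UNIV"
  shows "basis_mod K (map b (sorted_list_of_set (new_indices K b (DIM('a))))) UNIV"
proof -
  let ?G = "new_indices K b (DIM('a))"
  have full: "span (K \<union> b ` {..<DIM('a)}) = UNIV"
    using assms(2) span_mono[of "b ` {..<DIM('a)}" "K \<union> b ` {..<DIM('a)}"] by auto
  show ?thesis
    unfolding basis_mod_def
    using span_Un_image_new_indices[of K b "DIM('a)"] dim_span_Un_image_lessThan[of K b "DIM('a)"]
    unfolding full by simp
qed

text \<open>The box is enclosed in \<open>?Q\<close>, a cylinder cut out by functionals that vanish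
  on the kernel. Membership in \<open>?Q\<close> depends on \<open>L x\<close> alone, so the measure
  of its image is, up to a factor, an iterated integral along the selected vectors.\<close>

lemma box_image_measure:
  fixes L :: "'a::euclidean_space \<Rightarrow> (nat \<Rightarrow>\<^sub>0 real)"
  assumes L: "linear L" "range L = Rn m" and b: "span (b ` {..<DIM('a)}) = UNIV"
  defines "G \<equiv> new_indices {x. L x = 0} b (DIM('a))"
  shows "\<exists>\<Gamma>\<ge>1. \<forall>r. (\<forall>i<DIM('a). 0 < r i) \<and> (\<forall>i j. i \<le> j \<longrightarrow> j < DIM('a) \<longrightarrow> r j \<le> r i) \<longrightarrow>
    (\<exists>S q. (\<forall>\<tau>. (\<forall>i<DIM('a). \<bar>\<tau> i\<bar> \<le> r i) \<longrightarrow> L (\<Sum>j<DIM('a). \<tau> j *\<^sub>R b j) \<in> S) \<and>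
       (\<lambda>t. indicator S (Rn_of m t) :: real) \<in> borel_measurable (coord_measure m) \<and>
       0 \<le> q \<and> (\<integral>\<^sup>+ t. indicator S (Rn_of m t) \<partial>coord_measure m) = ennreal q \<and>
       q \<le> \<Gamma> * (\<Prod>i\<in>G. r i))"
proof -
  let ?d = "DIM('a)" and ?K = "{x. L x = 0}"
  have K: "subspace ?K" by (rule linear_subspace_kernel[OF L(1)])
  obtain \<phi> \<Gamma> where \<Gamma>: "\<Gamma> \<ge> 1" and \<phi>: "\<And>i. i \<in> G \<Longrightarrow> linear (\<phi> i)" "\<And>i x. i \<in> G \<Longrightarrow> L x = 0 \<Longrightarrow> \<phi> i x = 0"
     "\<And>i j. i \<in> G \<Longrightarrow> j \<in> G \<Longrightarrow> \<phi> i (b j) = (if i = j then 1 else (0::real))"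
    and bound: "\<And>r \<tau> i. (\<forall>i<?d. 0 < r i) \<Longrightarrow> (\<forall>i j. i \<le> j \<longrightarrow> j < ?d \<longrightarrow> r j \<le> r i) \<Longrightarrow>
        (\<forall>i<?d. \<bar>\<tau> i\<bar> \<le> r i) \<Longrightarrow> i \<in> G \<Longrightarrow> \<bar>\<phi> i (\<Sum>j<?d. \<tau> j *\<^sub>R b j)\<bar> \<le> \<Gamma> * r i"
    using box_functional_bound[OF K b] unfolding G_def by blast
  obtain c where c: "\<And>i. i < m \<Longrightarrow> L (c i) = Poly_Mapping.single i 1" "basis_mod ?K (map c [0..<m]) UNIV"
    using coords_basis_exists[OF L] by blast
  let ?bs = "map b (sorted_list_of_set G)"
  have G: "finite G" by (simp add: G_def)
  obtain \<kappa> where \<kappa>: "\<kappa> > 0" "\<And>g x. g \<in> borel_measurable borel \<Longrightarrow> invariant_under ?K g \<Longrightarrow>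
      span_int (map c [0..<m]) g x = ennreal \<kappa> * span_int ?bs g x"
    using span_int_change_of_basis[OF K c(2) basis_mod_new_indices[OF K b]] unfolding G_def by blast
  \<comment> \<open>The sides of the cylinder are \<open>2 * \<Gamma> * r i\<close>, and
    \<open>\<kappa>\<close> is the change of basis from the selected vectors to the lifted unit
    vectors; the summand 1 secures the lower bound.\<close>
  define \<Gamma>' where "\<Gamma>' = 1 + \<kappa> * (2 * \<Gamma>) ^ card G"
  have "\<Gamma>' \<ge> 1" using \<kappa>(1) \<Gamma> by (simp add: \<Gamma>'_def)
  moreover have "\<exists>S q. (\<forall>\<tau>. (\<forall>i<?d. \<bar>\<tau> i\<bar> \<le> r i) \<longrightarrow> L (\<Sum>j<?d. \<tau> j *\<^sub>R b j) \<in> S) \<and>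
       (\<lambda>t. indicator S (Rn_of m t) :: real) \<in> borel_measurable (coord_measure m) \<and>
       0 \<le> q \<and> (\<integral>\<^sup>+ t. indicator S (Rn_of m t) \<partial>coord_measure m) = ennreal q \<and>
       q \<le> \<Gamma>' * (\<Prod>i\<in>G. r i)"
    if r: "\<forall>i<?d. 0 < r i" "\<forall>i j. i \<le> j \<longrightarrow> j < ?d \<longrightarrow> r j \<le> r i" for r
  proof -
    have rG: "0 < r i" if "i \<in> G" for i using that r(1) by (simp add: G_def new_indices_def)
    let ?Q = "{x. \<forall>i\<in>G. \<bar>\<phi> i x\<bar> \<le> \<Gamma> * r i}"
    let ?g = "indicator ?Q :: 'a \<Rightarrow> ennreal"
    have Q[measurable]: "?Q \<in> sets borel"
      by (rule borel_closed[OF closed_functional_box]) (rule \<phi>(1))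
    have Qinv: "x + y \<in> ?Q \<longleftrightarrow> x \<in> ?Q" if "L y = 0" for x y
      using \<phi>(2)[OF _ that] by (simp add: linear_add[OF \<phi>(1)])
    then have ginv: "invariant_under ?K ?g"
      by (simp add: invariant_under_def indicator_def)
    have LQ: "L x \<in> L ` ?Q \<longleftrightarrow> x \<in> ?Q" for x
    proof
      assume "L x \<in> L ` ?Q"
      then obtain y where y: "y \<in> ?Q" "L x = L y" by auto
      then have "y + (x - y) \<in> ?Q" using Qinv[of "x - y" y] by (simp add: linear_diff[OF L(1)])
      then show "x \<in> ?Q" by simp
    qed blast
    have Lc: "L (\<Sum>i<m. t i *\<^sub>R c i) = Rn_of m t" for t
      using c(1) by (simp add: linear_sum[OF L(1)] linear_scale[OF L(1)] Rn_of_eq_sum)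
    have ind: "indicator (L ` ?Q) (Rn_of m t) = (indicator ?Q (\<Sum>i<m. t i *\<^sub>R c i) :: 'z::zero_neq_one)" for t
      using LQ[of "\<Sum>i<m. t i *\<^sub>R c i"] unfolding Lc by (simp add: indicator_def)
    have "span_int ?bs ?g 0 = ennreal (\<Prod>i\<in>G. 2 * (\<Gamma> * r i))"
      using span_int_functional_box[of "sorted_list_of_set G" \<phi> b "\<lambda>i. \<Gamma> * r i"] \<phi> \<Gamma> rG G
      by (simp add: less_imp_le)
    also have "(\<Prod>i\<in>G. 2 * (\<Gamma> * r i)) = (2 * \<Gamma>) ^ card G * (\<Prod>i\<in>G. r i)"
      by (simp add: prod.distrib mult.assoc power_mult_distrib)
    finally have Ib: "span_int ?bs ?g 0 = ennreal ((2 * \<Gamma>) ^ card G * (\<Prod>i\<in>G. r i))" .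
    have "(\<integral>\<^sup>+ t. indicator (L ` ?Q) (Rn_of m t) \<partial>coord_measure m)
       = (\<integral>\<^sup>+ t. ?g (0 + (\<Sum>i\<in>set [0..<m]. t i *\<^sub>R c i)) \<partial>Pi\<^sub>M (set [0..<m]) (\<lambda>_. lborel))"
      by (simp add: ind atLeast0LessThan)
    also have "\<dots> = span_int (map c [0..<m]) ?g 0"
      by (intro nn_integral_PiM_eq_span_int) auto
    also have "\<dots> = ennreal \<kappa> * span_int ?bs ?g 0"
      by (rule \<kappa>(2)[OF _ ginv]) auto
    also have "\<dots> = ennreal (\<kappa> * ((2 * \<Gamma>) ^ card G * (\<Prod>i\<in>G. r i)))"
      unfolding Ib using \<kappa>(1) \<Gamma> rG by (simp add: ennreal_mult prod_nonneg less_imp_le)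
    finally have I: "(\<integral>\<^sup>+ t. indicator (L ` ?Q) (Rn_of m t) \<partial>coord_measure m)
        = ennreal (\<kappa> * ((2 * \<Gamma>) ^ card G * (\<Prod>i\<in>G. r i)))" .
    have P0: "0 \<le> (\<Prod>i\<in>G. r i)" using rG by (simp add: prod_nonneg less_imp_le)
    show ?thesis
    proof (intro exI[of _ "L ` ?Q"] exI[of _ "\<kappa> * ((2 * \<Gamma>) ^ card G * (\<Prod>i\<in>G. r i))"] conjI allI impI I)
      show "L (\<Sum>j<?d. \<tau> j *\<^sub>R b j) \<in> L ` ?Q" if "\<forall>i<?d. \<bar>\<tau> i\<bar> \<le> r i" for \<tau>
        using bound[OF r that] by blast
      show "(\<lambda>t. indicator (L ` ?Q) (Rn_of m t) :: real) \<in> borel_measurable (coord_measure m)"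
        unfolding ind by measurable
      show "0 \<le> \<kappa> * ((2 * \<Gamma>) ^ card G * (\<Prod>i\<in>G. r i))"
        using \<kappa>(1) \<Gamma> P0 by simp
      show "\<kappa> * ((2 * \<Gamma>) ^ card G * (\<Prod>i\<in>G. r i)) \<le> \<Gamma>' * (\<Prod>i\<in>G. r i)"
        using P0 by (simp add: \<Gamma>'_def algebra_simps)
    qed
  qed
  ultimately show ?thesis by blast
qed

text \<open>The largest member of the chain is treated first: a basis adapted to the remaining
  members is built inside it and then extended to \<open>V'\<close>.\<close>

lemma adapted_basis_list:
  fixes V' :: "'a::euclidean_space set"
  assumes "finite \<C>" "subspace V'" "\<And>W. W \<in> \<C> \<Longrightarrow> subspace W \<and> W \<subseteq> V'"
    and "\<And>V W. V \<in> \<C> \<Longrightarrow> W \<in> \<C> \<Longrightarrow> V \<subseteq> W \<or> W \<subseteq> V"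
  shows "\<exists>bs. basis_mod {0} bs V' \<and> (\<forall>W\<in>\<C>. span (set (take (dim W) bs)) = W)"
  using assms
proof (induction "card \<C>" arbitrary: \<C> V')
  case 0
  then have "\<C> = {}" by simp
  then show ?case
    using basis_mod_exists[of "{0}" V'] subspace_0[OF 0(3)] 0(3) by auto
next
  case (Suc n)
  then have ne: "\<C> \<noteq> {}" by auto
  obtain W where W: "W \<in> \<C>" "\<And>V. V \<in> \<C> \<Longrightarrow> W \<subseteq> V \<Longrightarrow> V = W"
    using finite_has_maximal[OF Suc(3) ne] by auto
  have max: "V \<subseteq> W" if "V \<in> \<C>" for V
    using Suc(6)[OF that W(1)] W(2)[OF that] by auto
  have sW: "subspace W" "W \<subseteq> V'" using Suc(5)[OF W(1)] by auto
  have "n = card (\<C> - {W})" using Suc(2,3) W(1) by simp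
  then obtain bs where bs: "basis_mod {0} bs W" "\<And>V. V \<in> \<C> - {W} \<Longrightarrow> span (set (take (dim V) bs)) = V"
    using Suc(1)[of "\<C> - {W}" W] Suc(3,5,6) sW max by (metis (no_types, lifting) DiffD1 finite_Diff)
  obtain cs where cs: "basis_mod W cs V'"
    using basis_mod_exists[OF sW(1) Suc(4) sW(2)] by blast
  have len: "length bs = dim W" and spW: "span (set bs) = W"
    using bs(1) by (auto simp: basis_mod_def span_insert_0)
  have "span (set (take (dim V) (bs @ cs))) = V" if V: "V \<in> \<C>" for V
  proof (cases "V = W")
    case True
    then show ?thesis using len spW by simp
  next
    case False
    have "dim V \<le> length bs" unfolding len by (rule dim_subset[OF max[OF V]])
    then show ?thesis using bs(2)[of V] V False by simp
  qed
  moreover have "basis_mod {0} (bs @ cs) V'"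
    by (rule basis_mod_append[OF _ bs(1) cs]) simp
  ultimately show ?case by blast
qed

text \<open>Interchange of the sums over indices and over the chain: \<open>W\<close> counts once
  for each index of \<open>G\<close> below \<open>h W\<close>.\<close>

lemma prod_exp_flag:
  assumes "finite G" "finite \<C>"
  shows "(\<Prod>i\<in>G. exp ((\<Sum>W\<in>\<C>. if i < h W then u W else 0) - \<eta>))
    = exp ((\<Sum>W\<in>\<C>. u W * real (card {i\<in>G. i < h W})) - \<eta> * real (card G))"
proof -
  have "(\<Sum>i\<in>G. \<Sum>W\<in>\<C>. if i < h W then u W else 0) = (\<Sum>W\<in>\<C>. \<Sum>i\<in>G. if i < h W then u W else 0)"
    by (rule sum.swap)
  also have "\<dots> = (\<Sum>W\<in>\<C>. u W * real (card {i\<in>G. i < h W}))"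
    using assms(1) by (intro sum.cong refl) (simp add: sum.If_cases Int_def)
  finally show ?thesis
    using assms by (simp add: exp_sum[symmetric] sum_subtractf mult.commute)
qed

text \<open>Each \<open>W\<close> of the chain stretches the first \<open>dim W\<close> directions
  of an adapted basis by \<open>exp (u W)\<close>, while \<open>\<omega>\<close> shrinks all of
  them. The volume of the box thus counts \<open>dim W\<close>; in the \<open>j\<close>-th target
  only the selected indices count, and these number the dimension of the image of \<open>W\<close>.
  The constant \<open>\<gamma>\<close> is fixed before \<open>u\<close> and
  \<open>\<omega>\<close>.\<close>

lemma chain_test_sets:
  fixes L :: "'n::finite \<Rightarrow> real^'d \<Rightarrow> (nat \<Rightarrow>\<^sub>0 real)"
  assumes L: "\<And>j. linear (L j)" "\<And>j. range (L j) = Rn (k j)" and k: "\<And>j. 0 < k j"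
    and \<C>: "finite \<C>" "\<And>W. W \<in> \<C> \<Longrightarrow> subspace W" "\<And>V W. V \<in> \<C> \<Longrightarrow> W \<in> \<C> \<Longrightarrow> V \<subseteq> W \<or> W \<subseteq> V"
  shows "\<exists>\<gamma>>0. \<forall>u \<omega>. (\<forall>W\<in>\<C>. 0 \<le> u W) \<longrightarrow>
    (\<exists>A S q. A \<in> sets borel \<and>
       ennreal (\<gamma> * exp ((\<Sum>W\<in>\<C>. u W * real (dim W)) - \<omega> * real CARD('d))) \<le> emeasure lborel A \<and>
       (\<forall>j. (\<forall>x\<in>A. L j x \<in> S j) \<and>
         (\<lambda>t. indicator (S j) (Rn_of (k j) t) :: real) \<in> borel_measurable (coord_measure (k j)) \<and>
         0 \<le> q j \<and> (\<integral>\<^sup>+ t. indicator (S j) (Rn_of (k j) t) \<partial>coord_measure (k j)) = ennreal (q j) \<and>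
         q j \<le> exp ((\<Sum>W\<in>\<C>. u W * real (dim (L j ` W))) - \<omega> * real (k j))))"
proof -
  let ?d = "CARD('d)" and ?K = "\<lambda>j. {x. L j x = 0}"
  obtain bs where bs: "basis_mod {0} bs (UNIV :: (real^'d) set)" "\<And>W. W \<in> \<C> \<Longrightarrow> span (set (take (dim W) bs)) = W"
    using adapted_basis_list[OF \<C>(1) subspace_UNIV, OF _ \<C>(3)] \<C>(2) by auto
  have len: "length bs = ?d" and spbs: "span (set bs) = UNIV"
    using bs(1) by (auto simp: basis_mod_def span_insert_0)
  define b where "b i = bs ! i" for i
  have im: "b ` {..<n} = set (take n bs)" if "n \<le> ?d" for n
    using that len unfolding b_def by (auto simp: set_conv_nth image_iff) (metis nth_take)+
  have bspan: "span (b ` {..<?d}) = UNIV"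
    using im[of ?d] len spbs by simp
  have bspan': "span (b ` {..<DIM(real^'d)}) = UNIV" using bspan by simp
  have dW: "dim W \<le> ?d" for W :: "(real^'d) set"
    using dim_subset_UNIV[of W] by simp
  have bW: "span (b ` {..<dim W}) = W" if "W \<in> \<C>" for W
    using bs(2)[OF that] im[OF dW] by simp
  let ?G = "\<lambda>j. new_indices (?K j) b ?d"
  have cardG: "card {i \<in> ?G j. i < dim W} = dim (L j ` W)" if "subspace W" "span (b ` {..<dim W}) = W" for j W
  proof -
    have "{i \<in> ?G j. i < dim W} = new_indices (?K j) b (dim W)"
      using dW[of W] by (auto simp: new_indices_def)
    then have "dim (?K j) + card {i \<in> ?G j. i < dim W} = dim (span (?K j \<union> b ` {..<dim W}))"
      by (simp only: dim_span_Un_image_lessThan)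
    also have "span (?K j \<union> b ` {..<dim W}) = span (W \<union> ?K j)"
      using that(2) span_Un_span[of "?K j" "b ` {..<dim W}"] by (simp add: Un_commute)
    also have "dim (span (W \<union> ?K j)) = dim (L j ` W) + dim (?K j)"
      using dim_image_eq_dim_span_Un[OF L(1) that(1)] by simp
    finally show ?thesis by simp
  qed
  have "{i \<in> ?G j. i < dim (UNIV :: (real^'d) set)} = ?G j" for j
    by (auto simp: new_indices_def)
  then have cardGk: "card (?G j) = k j" for j
    using cardG[OF subspace_UNIV, of j] bspan L(2) by (simp add: dim_Rn)
  have "\<exists>\<Gamma>\<ge>1. \<forall>r. (\<forall>i<?d. 0 < r i) \<and> (\<forall>i l. i \<le> l \<longrightarrow> l < ?d \<longrightarrow> r l \<le> r i) \<longrightarrow>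
    (\<exists>S q. (\<forall>\<tau>. (\<forall>i<?d. \<bar>\<tau> i\<bar> \<le> r i) \<longrightarrow> L j (\<Sum>l<?d. \<tau> l *\<^sub>R b l) \<in> S) \<and>
       (\<lambda>t. indicator S (Rn_of (k j) t) :: real) \<in> borel_measurable (coord_measure (k j)) \<and>
       0 \<le> q \<and> (\<integral>\<^sup>+ t. indicator S (Rn_of (k j) t) \<partial>coord_measure (k j)) = ennreal q \<and>
       q \<le> \<Gamma> * (\<Prod>i\<in>?G j. r i))" (is "?X j") for j
    using box_image_measure[OF L(1)[of j] L(2)[of j] bspan'] by simp
  then have "\<forall>j. ?X j" by blast
  from choice[OF this] obtain \<Gamma>1 where \<Gamma>1: "\<And>j. \<Gamma>1 j \<ge> 1"
    "\<And>j r. (\<forall>i<?d. 0 < r i) \<and> (\<forall>i l. i \<le> l \<longrightarrow> l < ?d \<longrightarrow> r l \<le> r i) \<Longrightarrow>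
    (\<exists>S q. (\<forall>\<tau>. (\<forall>i<?d. \<bar>\<tau> i\<bar> \<le> r i) \<longrightarrow> L j (\<Sum>l<?d. \<tau> l *\<^sub>R b l) \<in> S) \<and>
       (\<lambda>t. indicator S (Rn_of (k j) t) :: real) \<in> borel_measurable (coord_measure (k j)) \<and>
       0 \<le> q \<and> (\<integral>\<^sup>+ t. indicator S (Rn_of (k j) t) \<partial>coord_measure (k j)) = ennreal q \<and>
       q \<le> \<Gamma>1 j * (\<Prod>i\<in>?G j. r i))"
    by blast
  define \<Gamma> where "\<Gamma> = (\<Sum>j\<in>UNIV. \<Gamma>1 j)"
  have \<Gamma>ge: "\<Gamma>1 j \<le> \<Gamma>" for j
    unfolding \<Gamma>_def using \<Gamma>1(1) by (intro member_le_sum) (auto intro: order_trans[OF zero_le_one])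
  have \<Gamma>: "\<Gamma> \<ge> 1" using \<Gamma>ge \<Gamma>1(1) order_trans by blast
  have map: "map b [0..<?d] = bs" unfolding b_def len[symmetric] by (rule map_nth)
  obtain \<kappa> where \<kappa>: "\<kappa> > 0" "\<And>g. g \<in> borel_measurable borel \<Longrightarrow> span_int bs g 0 = ennreal \<kappa> * (\<integral>\<^sup>+ x. g x \<partial>lborel)"
    using span_int_const_eq_lborel[OF bs(1)] by blast
  obtain \<beta> where \<beta>: "\<And>i. i < ?d \<Longrightarrow> linear (\<beta> i)"
    "\<And>i j. i < ?d \<Longrightarrow> j < ?d \<Longrightarrow> \<beta> i (b j) = (if i = j then 1 else (0::real))"
    using dual_functionals_exist[of "{0}" "{..<?d}" b] bspan by (auto simp: span_insert_0)
  have rep: "x = (\<Sum>l<?d. \<beta> l x *\<^sub>R b l)" for x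
  proof -
    have "linear (\<lambda>x. \<Sum>l<?d. \<beta> l x *\<^sub>R b l)"
      using \<beta>(1) by (intro linear_compose_sum ballI linearI)
        (auto simp: linear_add linear_scale scaleR_add_left)
    moreover have "b i = (\<Sum>l<?d. \<beta> l (b i) *\<^sub>R b l)" if "i < ?d" for i
      using \<beta>(2) that by (simp add: if_distrib[of "\<lambda>x. x *\<^sub>R _"] cong: if_cong)
    ultimately show ?thesis
      using linear_eq_on[OF linear_id, of "\<lambda>x. \<Sum>l<?d. \<beta> l x *\<^sub>R b l" x "b ` {..<?d}"] bspan by auto
  qed
  \<comment> \<open>\<open>2 ^ ?d\<close> comes from the intervals of length \<open>2 * r i\<close>,
    \<open>\<kappa>\<close> from the basis and \<open>\<Gamma> ^ ?d\<close> from the extra shrinking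
    of the sides.\<close>
  define \<gamma> where "\<gamma> = 2 ^ ?d / (\<kappa> * \<Gamma> ^ ?d)"
  have "\<gamma> > 0" using \<kappa>(1) \<Gamma> by (simp add: \<gamma>_def)
  moreover have "\<exists>A S q. A \<in> sets borel \<and>
       ennreal (\<gamma> * exp ((\<Sum>W\<in>\<C>. u W * real (dim W)) - \<omega> * real ?d)) \<le> emeasure lborel A \<and>
       (\<forall>j. (\<forall>x\<in>A. L j x \<in> S j) \<and>
         (\<lambda>t. indicator (S j) (Rn_of (k j) t) :: real) \<in> borel_measurable (coord_measure (k j)) \<and>
         0 \<le> q j \<and> (\<integral>\<^sup>+ t. indicator (S j) (Rn_of (k j) t) \<partial>coord_measure (k j)) = ennreal (q j) \<and>
         q j \<le> exp ((\<Sum>W\<in>\<C>. u W * real (dim (L j ` W))) - \<omega> * real (k j)))"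
    if u: "\<forall>W\<in>\<C>. 0 \<le> u W" for u \<omega>
  proof -
    \<comment> \<open>The sides decrease because the weights are nonnegative. The term
      \<open>ln \<Gamma>\<close> shrinks every side by the factor \<open>\<Gamma>\<close>, which
      absorbs the constants \<open>\<Gamma>1 j\<close> of the image bounds because each target has
      positive dimension.\<close>
    define r where "r i = exp ((\<Sum>W\<in>\<C>. if i < dim W then u W else 0) - (\<omega> + ln \<Gamma>))" for i
    have r0: "0 < r i" for i by (simp add: r_def)
    have "r l \<le> r i" if "i \<le> l" for i l
      unfolding r_def using u that by (intro exp_le_cancel_iff[THEN iffD2] diff_right_mono sum_mono) auto
    then have r: "(\<forall>i<?d. 0 < r i) \<and> (\<forall>i l. i \<le> l \<longrightarrow> l < ?d \<longrightarrow> r l \<le> r i)" using r0 by blast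
    have prodr: "(\<Prod>i\<in>H. r i) = exp ((\<Sum>W\<in>\<C>. u W * real (card {i\<in>H. i < dim W})) - \<omega> * real (card H)) / \<Gamma> ^ card H"
      if "finite H" for H
    proof -
      have "exp (ln \<Gamma> * real (card H)) = \<Gamma> ^ card H"
        using \<Gamma> by (simp add: exp_of_nat2_mult)
      then show ?thesis
        unfolding r_def prod_exp_flag[OF that \<C>(1)] by (simp add: exp_diff distrib_right exp_add diff_add_eq_diff_diff_swap)
    qed
    let ?A = "{x. \<forall>i\<in>{..<?d}. \<bar>\<beta> i x\<bar> \<le> r i}"
    have A: "?A \<in> sets borel"
      using \<beta>(1) by (intro borel_closed closed_functional_box) auto
    have "ennreal \<kappa> * emeasure lborel ?A = span_int (map b [0..<?d]) (indicator ?A) 0"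
      unfolding map using A by (subst \<kappa>(2)) auto
    also have "\<dots> = ennreal (\<Prod>i<?d. 2 * r i)"
      using span_int_functional_box[of "[0..<?d]" \<beta> b r] \<beta> r0
      by (simp add: atLeast0LessThan less_imp_le)
    also have "(\<Prod>i<?d. 2 * r i) = 2 ^ ?d * (\<Prod>i<?d. r i)" by (simp add: prod.distrib)
    also have "{i\<in>{..<?d}. i < dim W} = {..<dim W}" for W :: "(real^'d) set" using dW[of W] by auto
    then have "2 ^ ?d * (\<Prod>i<?d. r i) = \<kappa> * (\<gamma> * exp ((\<Sum>W\<in>\<C>. u W * real (dim W)) - \<omega> * real ?d))"
      using \<kappa>(1) \<Gamma> by (simp add: prodr \<gamma>_def)
    finally have "ennreal \<kappa> * emeasure lborel ?A = ennreal \<kappa> * ennreal (\<gamma> * exp ((\<Sum>W\<in>\<C>. u W * real (dim W)) - \<omega> * real ?d))"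
      using \<kappa>(1) \<open>\<gamma> > 0\<close> by (simp add: ennreal_mult)
    then have mA: "emeasure lborel ?A = ennreal (\<gamma> * exp ((\<Sum>W\<in>\<C>. u W * real (dim W)) - \<omega> * real ?d))"
      using \<kappa>(1) by (simp add: ennreal_mult_cancel_left)
    have "\<forall>j. \<exists>S q. (\<forall>\<tau>. (\<forall>i<?d. \<bar>\<tau> i\<bar> \<le> r i) \<longrightarrow> L j (\<Sum>l<?d. \<tau> l *\<^sub>R b l) \<in> S) \<and>
       (\<lambda>t. indicator S (Rn_of (k j) t) :: real) \<in> borel_measurable (coord_measure (k j)) \<and>
       0 \<le> q \<and> (\<integral>\<^sup>+ t. indicator S (Rn_of (k j) t) \<partial>coord_measure (k j)) = ennreal q \<and>
       q \<le> \<Gamma>1 j * (\<Prod>i\<in>?G j. r i)"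
      using \<Gamma>1(2)[OF r] by blast
    from choice[OF this] obtain S where "\<forall>j. \<exists>q. (\<forall>\<tau>. (\<forall>i<?d. \<bar>\<tau> i\<bar> \<le> r i) \<longrightarrow> L j (\<Sum>l<?d. \<tau> l *\<^sub>R b l) \<in> S j) \<and>
       (\<lambda>t. indicator (S j) (Rn_of (k j) t) :: real) \<in> borel_measurable (coord_measure (k j)) \<and>
       0 \<le> q \<and> (\<integral>\<^sup>+ t. indicator (S j) (Rn_of (k j) t) \<partial>coord_measure (k j)) = ennreal q \<and>
       q \<le> \<Gamma>1 j * (\<Prod>i\<in>?G j. r i)"
      by blast
    from choice[OF this] obtain q where
      S: "\<And>j \<tau>. (\<forall>i<?d. \<bar>\<tau> i\<bar> \<le> r i) \<Longrightarrow> L j (\<Sum>l<?d. \<tau> l *\<^sub>R b l) \<in> S j"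
        "\<And>j. (\<lambda>t. indicator (S j) (Rn_of (k j) t) :: real) \<in> borel_measurable (coord_measure (k j))"
      and q: "\<And>j. 0 \<le> q j" "\<And>j. (\<integral>\<^sup>+ t. indicator (S j) (Rn_of (k j) t) \<partial>coord_measure (k j)) = ennreal (q j)"
        "\<And>j. q j \<le> \<Gamma>1 j * (\<Prod>i\<in>?G j. r i)"
      by blast
    show ?thesis
    proof (intro exI[of _ ?A] exI[of _ S] exI[of _ q] conjI allI ballI A S(2) q(1,2))
      show "ennreal (\<gamma> * exp ((\<Sum>W\<in>\<C>. u W * real (dim W)) - \<omega> * real ?d)) \<le> emeasure lborel ?A"
        using mA by simp
    next
      fix j x assume "x \<in> ?A"
      then have "L j (\<Sum>l<?d. \<beta> l x *\<^sub>R b l) \<in> S j" by (intro S(1)) auto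
      then show "L j x \<in> S j" using rep[of x] by simp
    next
      fix j
      let ?E = "exp ((\<Sum>W\<in>\<C>. u W * real (dim (L j ` W))) - \<omega> * real (k j))"
      have "(\<Prod>i\<in>?G j. r i) = ?E / \<Gamma> ^ k j"
        unfolding prodr[OF finite_new_indices] cardGk using cardG[OF \<C>(2) bW] by simp
      then have "q j \<le> \<Gamma>1 j * (?E / \<Gamma> ^ k j)" using q(3)[of j] by simp
      also have "\<dots> \<le> \<Gamma> ^ k j * (?E / \<Gamma> ^ k j)"
        using \<Gamma>ge[of j] self_le_power[OF \<Gamma> k[of j]] \<Gamma>
        by (intro mult_right_mono) (auto intro: order_trans)
      also have "\<dots> = ?E" using \<Gamma> by simp
      finally show "q j \<le> ?E" .
    qed
  qed
  ultimately show ?thesis by blast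
qed

section \<open>The HBL property implies growth\<close>

lemma HBL_polytope_bdd_above:
  fixes t :: "real^'n"
  assumes "\<forall>j. 0 < t $ j"
  shows "bdd_above ((\<lambda>s. \<Prod>j\<in>UNIV. t $ j powr s $ j) ` HBL_polytope k L)"
proof -
  have "continuous_on (HBL_polytope k L) (\<lambda>s::real^'n. \<Prod>j\<in>UNIV. t $ j powr s $ j)"
    using assms by (intro continuous_intros) (simp add: less_imp_neq[symmetric])
  then show ?thesis
    by (intro bounded_imp_bdd_above compact_imp_bounded compact_continuous_image compact_HBL_polytope)
qed

lemma prod_powr_pos: "(\<And>j. 0 < t j) \<Longrightarrow> 0 < (\<Prod>j\<in>A. t j powr s j)" for t s :: "'n \<Rightarrow> real"
  by (intro prod_pos ballI) (metis less_irrefl powr_gt_zero)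

lemma SUP_HBL_polytope_pos:
  fixes t :: "real^'n"
  assumes t: "\<forall>j. 0 < t $ j" and ne: "HBL_polytope k L \<noteq> {}"
  shows "0 < (SUP s\<in>HBL_polytope k L. \<Prod>j\<in>UNIV. t $ j powr s $ j)"
  using HBL_polytope_SUP_attained[OF t ne] prod_powr_pos[of "\<lambda>j. t $ j" "\<lambda>j. _ $ j" UNIV] t by metis

text \<open>Reciprocal scaling inverts every monomial, so a minimiser for one scaling is a maximiser
  for the other.\<close>

lemma INF_HBL_polytope_eq_inverse_SUP:
  fixes t :: "real^'n"
  assumes t: "\<forall>j. 0 < t $ j" and ne: "HBL_polytope k L \<noteq> {}"
  shows "(INF s\<in>HBL_polytope k L. \<Prod>j\<in>UNIV. t $ j powr s $ j)
    = inverse (SUP s\<in>HBL_polytope k L. \<Prod>j\<in>UNIV. (\<chi> j. inverse (t $ j)) $ j powr s $ j)"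
proof -
  let ?P = "HBL_polytope k L"
  let ?h = "\<lambda>s::real^'n. \<Prod>j\<in>UNIV. t $ j powr s $ j"
  let ?g = "\<lambda>s::real^'n. \<Prod>j\<in>UNIV. (\<chi> j. inverse (t $ j)) $ j powr s $ j"
  have t': "\<forall>j. 0 < (\<chi> j. inverse (t $ j)) $ j" using t by simp
  have g: "?g s = inverse (?h s)" for s
    using t by (simp add: inverse_powr less_imp_le prod_inversef[symmetric] o_def)
  have hpos: "0 < ?h s" for s using t by (intro prod_powr_pos) auto
  obtain s1 where s1: "s1 \<in> ?P" "?h s1 = (INF s\<in>?P. ?h s)"
    using HBL_polytope_INF_attained[OF t ne] by blast
  obtain s2 where s2: "s2 \<in> ?P" "?g s2 = (SUP s\<in>?P. ?g s)"
    using HBL_polytope_SUP_attained[OF t' ne] by blast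
  have "bdd_below (?h ` ?P)"
    using hpos by (intro bdd_belowI2[of _ 0]) (simp add: less_imp_le)
  then have "?h s1 \<le> ?h s2"
    unfolding s1(2) by (rule cINF_lower[OF _ s2(1)])
  moreover have "?g s1 \<le> ?g s2"
    unfolding s2(2) by (rule cSUP_upper[OF s1(1) HBL_polytope_bdd_above[OF t']])
  then have "?h s2 \<le> ?h s1"
    unfolding g using hpos by simp
  ultimately have "?h s1 = inverse (?g s2)" unfolding g by simp
  then show ?thesis unfolding s1(2) s2(2) .
qed

text \<open>The test functions are \<open>t $ j * y $ j\<close> times the indicator of
  \<open>S j\<close>. On the box \<open>A\<close> the integrand is \<open>B\<close> at the scaled
  point, and the volume of \<open>A\<close> is at least \<open>\<gamma> / M\<close>, with
  \<open>M\<close> the maximal monomial. The measure of \<open>S j\<close> is at most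
  \<open>1 / t $ j\<close>, so the integrals are at most \<open>y $ j\<close> and monotonicity
  applies.\<close>

lemma growth_if_HBL_function:
  fixes k :: "'n::finite \<Rightarrow> nat"
    and L :: "'n \<Rightarrow> real^'d \<Rightarrow> (nat \<Rightarrow>\<^sub>0 real)"
    and B :: "real^'n \<Rightarrow> real"
  assumes k: "\<And>j. 0 < k j" and L: "\<And>j. linear (L j)" "\<And>j. range (L j) = Rn (k j)"
    and ne: "HBL_polytope k L \<noteq> {}"
    and B0: "\<forall>y\<in>orthant. 0 \<le> B y"
    and mono: "\<forall>y\<in>orthant. \<forall>j. mono_on {0..} (\<lambda>u. B (\<chi> i. if i = j then u else y $ i))"
    and HBL: "HBL_function k L B"
  shows "\<exists>C>0. \<forall>t y :: real^'n. (\<forall>j. 0 < t $ j \<and> 0 < y $ j) \<longrightarrow>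
          B (\<chi> j. t $ j * y $ j)
            \<le> C * (SUP s\<in>HBL_polytope k L. \<Prod>j\<in>UNIV. t $ j powr s $ j) * B y"
proof -
  let ?P = "HBL_polytope k L"
  obtain C0 where C0: "C0 \<ge> 0" "\<And>f. (\<forall>j. integrable (lebesgue_Rn (k j)) (f j) \<and> (\<forall>y\<in>Rn (k j). 0 \<le> f j y)) \<Longrightarrow>
        (\<integral>\<^sup>+ x. ennreal (B (\<chi> j. f j (L j x))) \<partial>lebesgue)
          \<le> ennreal (C0 * B (\<chi> j. integral\<^sup>L (lebesgue_Rn (k j)) (f j)))"
    using HBL unfolding HBL_function_def by blast
  let ?R = "profile_rep L ` profiles L"
  let ?chains = "{\<C>. \<C> \<subseteq> ?R \<and> (\<forall>V\<in>\<C>. \<forall>W\<in>\<C>. V \<subseteq> W \<or> W \<subseteq> V)}"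
  have R: "finite ?R" by (intro finite_imageI finite_profiles L(1))
  have fch: "finite ?chains" using R by simp
  define X where "X \<C> \<gamma> \<longleftrightarrow> \<gamma> > 0 \<and> (\<forall>u \<omega>. (\<forall>W\<in>\<C>. 0 \<le> u W) \<longrightarrow>
    (\<exists>A S q. A \<in> sets borel \<and>
       ennreal (\<gamma> * exp ((\<Sum>W\<in>\<C>. u W * real (dim W)) - \<omega> * real CARD('d))) \<le> emeasure lborel A \<and>
       (\<forall>j. (\<forall>x\<in>A. L j x \<in> S j) \<and>
         (\<lambda>t. indicator (S j) (Rn_of (k j) t) :: real) \<in> borel_measurable (coord_measure (k j)) \<and>
         0 \<le> q j \<and> (\<integral>\<^sup>+ t. indicator (S j) (Rn_of (k j) t) \<partial>coord_measure (k j)) = ennreal (q j) \<and>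
         q j \<le> exp ((\<Sum>W\<in>\<C>. u W * real (dim (L j ` W))) - \<omega> * real (k j)))))"
    for \<C> \<gamma>
  have "\<exists>\<gamma>. X \<C> \<gamma>" if \<C>: "\<C> \<in> ?chains" for \<C>
    unfolding X_def
  proof (rule chain_test_sets[OF L k])
    show "finite \<C>" using \<C> R finite_subset by auto
    show "subspace W" if "W \<in> \<C>" for W using \<C> that profile_rep by blast
    show "V \<subseteq> W \<or> W \<subseteq> V" if "V \<in> \<C>" "W \<in> \<C>" for V W using \<C> that by blast
  qed
  then have "\<forall>\<C>\<in>?chains. \<exists>\<gamma>. X \<C> \<gamma>" by (intro ballI)
  from bchoice[OF this] obtain g where g: "\<forall>\<C>\<in>?chains. X \<C> (g \<C>)"
    by (rule exE)
  \<comment> \<open>The minimum over the finitely many chains makes the constant independent of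
    \<open>t\<close>; the inserted 1 keeps the set nonempty.\<close>
  define \<gamma> where "\<gamma> = Min (insert 1 (g ` ?chains))"
  have \<gamma>: "\<gamma> > 0" using g fch by (auto simp: \<gamma>_def X_def)
  have \<gamma>le: "\<gamma> \<le> g \<C>" if "\<C> \<in> ?chains" for \<C>
    unfolding \<gamma>_def using fch that by (intro Min_le) auto
  \<comment> \<open>\<open>C0\<close> may be 0, hence the summand 1.\<close>
  define C where "C = (C0 + 1) / \<gamma>"
  have "C > 0" using \<gamma> C0(1) by (simp add: C_def)
  moreover have "B (\<chi> j. t $ j * y $ j) \<le> C * (SUP s\<in>?P. \<Prod>j\<in>UNIV. t $ j powr s $ j) * B y"
    if ty: "\<forall>j. 0 < t $ j \<and> 0 < y $ j" for t y :: "real^'n"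
  proof -
    define M where "M = (SUP s\<in>?P. \<Prod>j\<in>UNIV. t $ j powr s $ j)"
    have tpos: "\<forall>j. 0 < t $ j" using ty by blast
    have M: "M > 0" unfolding M_def by (rule SUP_HBL_polytope_pos[OF tpos ne])
    \<comment> \<open>In logarithms the monomial is a linear functional of \<open>s\<close> bounded
      by \<open>ln M\<close>, which is the setting of linear duality.\<close>
    define l :: "real^'n" where "l = (\<chi> j. ln (t $ j))"
    have lM: "\<forall>s\<in>?P. l \<bullet> s \<le> ln M"
    proof
      fix s assume s: "s \<in> ?P"
      have "exp (l \<bullet> s) = (\<Prod>j\<in>UNIV. t $ j powr s $ j)"
        using tpos by (simp add: l_def powr_def exp_sum inner_vec_def mult.commute less_imp_neq[symmetric])
      also have "\<dots> \<le> M"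
        unfolding M_def by (rule cSUP_upper[OF s HBL_polytope_bdd_above[OF tpos]])
      finally show "l \<bullet> s \<le> ln M" using M by (simp add: ln_ge_iff)
    qed
    obtain \<C> u \<omega> where \<C>: "\<C> \<in> ?chains" "\<forall>W\<in>\<C>. 0 \<le> u W"
      "\<And>j. (\<Sum>W\<in>\<C>. u W * real (dim (L j ` W))) - \<omega> * real (k j) \<le> - l $ j"
      "(\<Sum>W\<in>\<C>. u W * real (dim W)) - \<omega> * real CARD('d) = - ln M"
      using chain_certificate[OF L k lM] by (elim exE conjE) (rule that, auto)
    obtain A S q where ASq: "A \<in> sets borel \<and>
       ennreal (g \<C> * exp ((\<Sum>W\<in>\<C>. u W * real (dim W)) - \<omega> * real CARD('d))) \<le> emeasure lborel A \<and>
       (\<forall>j. (\<forall>x\<in>A. L j x \<in> S j) \<and>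
         (\<lambda>t. indicator (S j) (Rn_of (k j) t) :: real) \<in> borel_measurable (coord_measure (k j)) \<and>
         0 \<le> q j \<and> (\<integral>\<^sup>+ t. indicator (S j) (Rn_of (k j) t) \<partial>coord_measure (k j)) = ennreal (q j) \<and>
         q j \<le> exp ((\<Sum>W\<in>\<C>. u W * real (dim (L j ` W))) - \<omega> * real (k j)))"
      using conjunct2[OF bspec[OF g \<C>(1), unfolded X_def], THEN spec[of _ u], THEN spec[of _ \<omega>],
        THEN mp, OF \<C>(2)]
      by (elim exE) (rule that)
    then have A: "A \<in> sets borel"
      "ennreal (g \<C> * exp ((\<Sum>W\<in>\<C>. u W * real (dim W)) - \<omega> * real CARD('d))) \<le> emeasure lborel A"
      and S: "\<And>j x. x \<in> A \<Longrightarrow> L j x \<in> S j"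
        "\<And>j. (\<lambda>t. indicator (S j) (Rn_of (k j) t) :: real) \<in> borel_measurable (coord_measure (k j))"
      and q: "\<And>j. 0 \<le> q j" "\<And>j. (\<integral>\<^sup>+ t. indicator (S j) (Rn_of (k j) t) \<partial>coord_measure (k j)) = ennreal (q j)"
         "\<And>j. q j \<le> exp ((\<Sum>W\<in>\<C>. u W * real (dim (L j ` W))) - \<omega> * real (k j))"
      by simp_all
    have "exp (- ln M) = 1 / M" using M by (simp add: exp_minus inverse_eq_divide)
    then have mA: "ennreal (\<gamma> / M) \<le> emeasure lborel A"
      using A(2) \<gamma>le[OF \<C>(1)] M unfolding \<C>(4)
      by (intro order_trans[OF ennreal_leI A(2)[unfolded \<C>(4)]]) (simp add: divide_right_mono)
    have qt: "t $ j * q j \<le> 1" for j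
    proof -
      have "q j \<le> exp (- l $ j)"
        using q(3)[of j] \<C>(3)[of j] by (meson exp_le_cancel_iff order_trans)
      also have "\<dots> = 1 / t $ j" using tpos by (simp add: l_def exp_minus inverse_eq_divide)
      finally show ?thesis using tpos by (simp add: field_simps)
    qed
    let ?f = "\<lambda>j z. (t $ j * y $ j) * indicator (S j) z :: real"
    have fint: "integrable (lebesgue_Rn (k j)) (?f j)" "integral\<^sup>L (lebesgue_Rn (k j)) (?f j) = t $ j * y $ j * q j" for j
    proof -
      have ty0: "0 \<le> t $ j * y $ j" using ty by (simp add: less_imp_le)
      have m: "(\<lambda>x. ?f j (Rn_of (k j) x)) \<in> borel_measurable (coord_measure (k j))"
        using S(2)[of j] by measurable
      have "(\<integral>\<^sup>+ x. ennreal (?f j (Rn_of (k j) x)) \<partial>coord_measure (k j))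
         = (\<integral>\<^sup>+ x. ennreal (t $ j * y $ j) * indicator (S j) (Rn_of (k j) x) \<partial>coord_measure (k j))"
        using ty0 by (intro nn_integral_cong) (simp add: indicator_def)
      also have "\<dots> = ennreal (t $ j * y $ j) * ennreal (q j)"
      proof -
        have "(\<lambda>x. ennreal (indicator (S j) (Rn_of (k j) x))) \<in> borel_measurable (coord_measure (k j))"
          using S(2)[of j] by measurable
        then show ?thesis
          by (subst nn_integral_cmult) (simp_all add: q(2) ennreal_indicator)
      qed
      also have "\<dots> = ennreal (t $ j * y $ j * q j)"
        using ty0 q(1) by (simp add: ennreal_mult)
      finally have I: "(\<integral>\<^sup>+ x. ennreal (?f j (Rn_of (k j) x)) \<partial>coord_measure (k j)) = ennreal (t $ j * y $ j * q j)" .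
      have f0: "\<And>z. 0 \<le> ?f j z" using ty0 by simp
      have r0: "0 \<le> t $ j * y $ j * q j" using ty0 q(1)[of j] by simp
      show "integrable (lebesgue_Rn (k j)) (?f j)"
        by (rule lebesgue_Rn_integral_from_coords(1)[OF m f0 I r0])
      show "integral\<^sup>L (lebesgue_Rn (k j)) (?f j) = t $ j * y $ j * q j"
        by (rule lebesgue_Rn_integral_from_coords(2)[OF m f0 I r0])
    qed
    have int_orthant: "(\<chi> j. integral\<^sup>L (lebesgue_Rn (k j)) (?f j)) \<in> orthant"
      unfolding fint(2) using ty q(1) by (simp add: orthant_def less_imp_le)
    have le: "B (\<chi> j. integral\<^sup>L (lebesgue_Rn (k j)) (?f j)) \<le> B y"
    proof (rule mono_on_coordinates_imp_mono[OF mono int_orthant])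
      show "(\<chi> j. integral\<^sup>L (lebesgue_Rn (k j)) (?f j)) $ j \<le> y $ j" for j
        unfolding fint(2) using mult_left_mono[OF qt[of j], of "y $ j"] ty by (simp add: mult_ac less_imp_le)
    qed
    let ?ty = "\<chi> j. t $ j * y $ j"
    have o: "?ty \<in> orthant" "y \<in> orthant" using ty by (simp_all add: orthant_def less_imp_le)
    have "ennreal (B ?ty * (\<gamma> / M)) = ennreal (B ?ty) * ennreal (\<gamma> / M)"
      using B0 o \<gamma> M by (intro ennreal_mult) auto
    also have "\<dots> \<le> ennreal (B ?ty) * emeasure lborel A"
      by (intro mult_left_mono mA) simp
    also have "\<dots> = (\<integral>\<^sup>+ x. ennreal (B ?ty) * indicator A x \<partial>lborel)"
      using A(1) by (simp add: nn_integral_cmult_indicator)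
    also have "\<dots> \<le> (\<integral>\<^sup>+ x. ennreal (B (\<chi> j. ?f j (L j x))) \<partial>lborel)"
      using S(1) by (intro nn_integral_mono) (simp add: indicator_def)
    also have "\<dots> = (\<integral>\<^sup>+ x. ennreal (B (\<chi> j. ?f j (L j x))) \<partial>lebesgue)"
      by (simp add: nn_integral_completion)
    also have "\<dots> \<le> ennreal (C0 * B (\<chi> j. integral\<^sup>L (lebesgue_Rn (k j)) (?f j)))"
      using fint(1) ty by (intro C0(2)) (simp add: less_imp_le)
    also have "\<dots> \<le> ennreal ((C0 + 1) * B y)"
      using C0(1) by (intro ennreal_leI mult_mono le bspec[OF B0 int_orthant]) auto
    finally have "B ?ty * (\<gamma> / M) \<le> (C0 + 1) * B y"
      using C0(1) B0 o by (subst (asm) ennreal_le_iff) auto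
    then show ?thesis
      unfolding M_def[symmetric] C_def using \<gamma> M by (simp add: field_simps)
  qed
  ultimately show ?thesis by blast
qed

section \<open>Upper and lower growth\<close>

lemma upper_growth_iff_lower_growth:
  fixes B :: "real^'n::finite \<Rightarrow> real"
  assumes ne: "HBL_polytope k L \<noteq> {}"
  shows "(\<exists>C>0. \<forall>t y :: real^'n. (\<forall>j. 0 < t $ j \<and> 0 < y $ j) \<longrightarrow>
          B (\<chi> j. t $ j * y $ j)
            \<le> C * (SUP s\<in>HBL_polytope k L. \<Prod>j\<in>UNIV. t $ j powr s $ j) * B y)
    \<longleftrightarrow> (\<exists>c>0. \<forall>t y :: real^'n. (\<forall>j. 0 < t $ j \<and> 0 < y $ j) \<longrightarrow>
          B (\<chi> j. t $ j * y $ j)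
            \<ge> c * (INF s\<in>HBL_polytope k L. \<Prod>j\<in>UNIV. t $ j powr s $ j) * B y)"
    (is "(\<exists>C>0. ?U C) \<longleftrightarrow> (\<exists>c>0. ?L c)")
proof -
  let ?S = "\<lambda>t::real^'n. SUP s\<in>HBL_polytope k L. \<Prod>j\<in>UNIV. t $ j powr s $ j"
  let ?I = "\<lambda>t::real^'n. INF s\<in>HBL_polytope k L. \<Prod>j\<in>UNIV. t $ j powr s $ j"
  define rcp :: "real^'n \<Rightarrow> real^'n" where "rcp t = (\<chi> j. inverse (t $ j))" for t
  have rcp_pos: "\<forall>j. 0 < rcp t $ j" if "\<forall>j. 0 < t $ j" for t using that by (simp add: rcp_def)
  have rcp_rcp: "rcp (rcp t) = t" for t by (simp add: rcp_def vec_eq_iff)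
  have scale_rcp: "(\<chi> j. rcp t $ j * (\<chi> j. t $ j * y $ j) $ j) = y" if "\<forall>j. 0 < t $ j" for t y
    using that by (simp add: rcp_def vec_eq_iff less_imp_neq[symmetric] mult.assoc[symmetric])
  have IS: "?I t = inverse (?S (rcp t))" if "\<forall>j. 0 < t $ j" for t
    unfolding rcp_def by (rule INF_HBL_polytope_eq_inverse_SUP[OF that ne])
  have Spos: "0 < ?S t" if "\<forall>j. 0 < t $ j" for t
    by (rule SUP_HBL_polytope_pos[OF that ne])
  show ?thesis
  proof
    assume "\<exists>C>0. ?U C"
    then obtain C where C: "C > 0" "?U C" by blast
    have "?L (inverse C)"
    proof (intro allI impI)
      fix t y :: "real^'n" assume ty: "\<forall>j. 0 < t $ j \<and> 0 < y $ j"
      then have t: "\<forall>j. 0 < t $ j" by blast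
      have "B y \<le> C * ?S (rcp t) * B (\<chi> j. t $ j * y $ j)"
        using C(2)[rule_format, of "rcp t" "\<chi> j. t $ j * y $ j"] ty rcp_pos[OF t] scale_rcp[OF t, of y] by simp
      then show "inverse C * ?I t * B y \<le> B (\<chi> j. t $ j * y $ j)"
        unfolding IS[OF t] using C(1) Spos[OF rcp_pos[OF t]] by (simp add: field_simps)
    qed
    then show "\<exists>c>0. ?L c" using C(1) by (intro exI[of _ "inverse C"]) simp
  next
    assume "\<exists>c>0. ?L c"
    then obtain c where c: "c > 0" "?L c" by blast
    have "?U (inverse c)"
    proof (intro allI impI)
      fix t y :: "real^'n" assume ty: "\<forall>j. 0 < t $ j \<and> 0 < y $ j"
      then have t: "\<forall>j. 0 < t $ j" by blast
      have "B y \<ge> c * ?I (rcp t) * B (\<chi> j. t $ j * y $ j)"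
        using c(2)[rule_format, of "rcp t" "\<chi> j. t $ j * y $ j"] ty rcp_pos[OF t] scale_rcp[OF t, of y] by simp
      then show "B (\<chi> j. t $ j * y $ j) \<le> inverse c * ?S t * B y"
        unfolding IS[OF rcp_pos[OF t]] rcp_rcp using c(1) Spos[OF t] by (simp add: field_simps)
    qed
    then show "\<exists>C>0. ?U C" using c(1) by (intro exI[of _ "inverse c"]) simp
  qed
qed

theorem theorem1:
  fixes k :: "'n::finite \<Rightarrow> nat"
    and L :: "'n \<Rightarrow> real^'d \<Rightarrow> (nat \<Rightarrow>\<^sub>0 real)"
    and B :: "real^'n \<Rightarrow> real"
  assumes "\<forall>j. 0 < k j"
    and "\<forall>j. linear (L j)"
    and "\<forall>j. range (L j) = Rn (k j)"
    and "HBL_polytope k L \<noteq> {}"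
    and "\<forall>y\<in>orthant. 0 \<le> B y"
    and "\<forall>y\<in>orthant. \<forall>j. mono_on {0..} (\<lambda>u. B (\<chi> i. if i = j then u else y $ i))"
    and "\<forall>y\<in>orthant. (\<exists>j. y $ j = 0) \<longrightarrow> B y = 0"
  shows
    "(HBL_function k L B \<longleftrightarrow>
       (\<exists>C>0. \<forall>t y :: real^'n. (\<forall>j. 0 < t $ j \<and> 0 < y $ j) \<longrightarrow>
          B (\<chi> j. t $ j * y $ j)
            \<le> C * (SUP s\<in>HBL_polytope k L. \<Prod>j\<in>UNIV. t $ j powr s $ j) * B y)) \<and>
     (HBL_function k L B \<longleftrightarrow>
       (\<exists>c>0. \<forall>t y :: real^'n. (\<forall>j. 0 < t $ j \<and> 0 < y $ j) \<longrightarrow>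
          B (\<chi> j. t $ j * y $ j)
            \<ge> c * (INF s\<in>HBL_polytope k L. \<Prod>j\<in>UNIV. t $ j powr s $ j) * B y))"
proof -
  have k: "\<And>j. 0 < k j" and L: "\<And>j. linear (L j)" "\<And>j. range (L j) = Rn (k j)"
    using assms(1-3) by auto
  have "HBL_function k L B \<longleftrightarrow>
       (\<exists>C>0. \<forall>t y :: real^'n. (\<forall>j. 0 < t $ j \<and> 0 < y $ j) \<longrightarrow>
          B (\<chi> j. t $ j * y $ j)
            \<le> C * (SUP s\<in>HBL_polytope k L. \<Prod>j\<in>UNIV. t $ j powr s $ j) * B y)"
    (is "_ \<longleftrightarrow> ?growth")
  proof
    show "HBL_function k L B \<Longrightarrow> ?growth"
      by (rule growth_if_HBL_function[OF k L assms(4-6)])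
    assume ?growth
    then obtain C where "C > 0" "\<And>t y :: real^'n. (\<And>j. 0 < t $ j \<and> 0 < y $ j) \<Longrightarrow>
       B (\<chi> j. t $ j * y $ j) \<le> C * (SUP s\<in>HBL_polytope k L. \<Prod>j\<in>UNIV. t $ j powr s $ j) * B y"
      by blast
    then show "HBL_function k L B"
      by (rule HBL_function_if_growth[OF L assms(4,5,7)])
  qed
  then show ?thesis
    using upper_growth_iff_lower_growth[OF assms(4), of B] by blast
qed

end
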